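(* Let $P$ (depending on a parameter $a>0$) be one of the following random probability measures on $(\mathbb{X},\mathcal{X})$ with base measure $H$: the Dirichlet process $\mathrm{DP}(a,H)$; the Dirichlet process with general stick-breaking weights $\mathrm{DPG}(g_a,H)$ satisfying the moment assumption (M) stated in the context; the two-parameter Poisson-Dirichlet process $\mathrm{PDP}(a,b,H)$; the normalized inverse Gaussian process $\mathrm{N\text{-}IGP}(a,H)$; the normalized generalized gamma process $\mathrm{NGGP}(\sigma,a,H)$; the generalized Dirichlet process $\mathrm{GDP}(a,r,H)$ (with $b$, $\sigma$, $r$ fixed). Fix an arbitrary $\tau>0$ and take $a=n^{\tau}$, $n=1,2,\dots$, writing $P=P_n$ for the corresponding random probability measure (all defined on the common probability space). Then for every measurable $A\in\mathcal{X}$, as $n\to\infty$, $$P_n(A)\to H(A)\quad\text{almost surely}.$$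
   Context: $(\Omega,\mathcal{F},\mathbb{P})$ is a complete probability space on which all random variables are defined; $\mathbb{X}$ is a separable complete metric space with Borel $\sigma$-algebra $\mathcal{X}$; $H$ is a nonatomic probability measure on $(\mathbb{X},\mathcal{X})$. Stick-breaking process with base measure $H$: a random probability measure $P=\sum_{i=1}^\infty w_i\delta_{\theta_i}$ with $w_1=v_1$, $w_i=v_i\prod_{j=1}^{i-1}(1-v_j)$ for $i\ge2$, where $\theta_1,\theta_2,\dots$ are i.i.d. with law $H$, and the stick-breaking weights $v_1,v_2,\dots$ are $[0,1]$-valued random variables, independent of $(\theta_i)$, such that $\sum_i w_i=1$ a.s. The first five processes below are stick-breaking processes determined by the joint law of $(v_i)$: (1) $\mathrm{DP}(a,H)$, $a>0$: $v_i$ i.i.d. $\mathrm{Beta}(1,a)$. (2) $\mathrm{DPG}(g_a,H)$: $v_i$ i.i.d. with a general distribution $g_a$ on $(0,1)$ depending on $a>0$. Assumption (M): for every $p\in\mathbb{N}$ (positive integers), $\mathbb{E}[v_i^p]=\frac{C_p}{a^{k_p}}+o\left(\frac1{a^{k_p}}\right)$ as $a\to\infty$, where $(k_p)$ is a positive sequence with $jk_i\ge ik_j$ for $i\ge j$, and the $C_p$ are finite nonzero constants independent of $a$. (3) $\mathrm{PDP}(a,b,H)$, $b\in(0,1)$, $a>-b$: $v_i$ independent with $v_i\sim\mathrm{Beta}(1-b,a+ib)$. (4) $\mathrm{N\text{-}IGP}(a,H)$, $a>0$: with $K_\mu$ the modified Bessel function of the third kind (Macdonald function), for $x\in(0,1)$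 $$f_{v_1}(x)=\frac{a^{1/2}x^{-1/2}(1-x)^{-1}}{(2\pi)^{1/2}K_{-1/2}(a)}K_{-1}\Big(\frac{a}{\sqrt{1-x}}\Big),$$ $$f_{v_n|v_1,\dots,v_{n-1}}(x)=\frac{a^{1/2}\prod_{i=1}^{n-1}(1-v_i)^{-1/4}\,x^{-1/2}(1-x)^{-\frac54+\frac n4}}{(2\pi)^{1/2}K_{-n/2}\Big(\frac{a}{\sqrt{\prod_{i=1}^{n-1}(1-v_i)}}\Big)}K_{-\frac12-\frac n2}\Big(\frac{a}{\sqrt{(1-x)\prod_{i=1}^{n-1}(1-v_i)}}\Big),\quad n\ge2.$$ (5) $\mathrm{NGGP}(\sigma,a,H)$, $\sigma\in(0,1)$, $a>0$: with $\Gamma(c;x)=\int_x^\infty u^{c-1}e^{-u}du$ and $(q)_j=q(q+1)\cdots(q+j-1)$, $(q)_0=1$, for $x\in(0,1)$ $$f_{v_1}(x)=\frac{x^{-\sigma}(1-x)^{\sigma-1}e^a}{\Gamma(\sigma)\Gamma(1-\sigma)}\sum_{j=0}^\infty\frac{(1-\sigma)_j}{j!}\frac{a^{j/\sigma}}{(1-x)^j}\Gamma\Big(1-\frac j\sigma;\frac{a}{(1-x)^\sigma}\Big),$$ $$f_{v_n|v_1,\dots,v_{n-1}}(x)=\frac{\sigma\Gamma((n-1)\sigma)x^{-\sigma}(1-x)^{n\sigma-1}}{\Gamma(1-\sigma)\Gamma(n\sigma)}\cdot\frac{\sum_{j=0}^\infty\frac{(1-n\sigma)_j}{j!}\frac{a^{j/\sigma}}{(1-x)^j\prod_{i=1}^{n-1}(1-v_i)^j}\Gamma\Big(n-\frac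 j\sigma;\frac{a}{(1-x)^\sigma\prod_{i=1}^{n-1}(1-v_i)^\sigma}\Big)}{\sum_{j=0}^\infty\frac{(1-(n-1)\sigma)_j}{j!}\frac{a^{j/\sigma}}{\prod_{i=1}^{n-1}(1-v_i)^j}\Gamma\Big(n-1-\frac j\sigma;\frac{a}{\prod_{i=1}^{n-1}(1-v_i)^\sigma}\Big)},\quad n\ge2.$$ (6) $\mathrm{GDP}(a,r,H)$, $a>0$, $r\in\{1,2,\dots\}$: the random probability measure such that for every measurable partition $(A_1,\dots,A_n)$ of $\mathbb{X}$, with $a_i=aH(A_i)$, the vector $(P(A_1),\dots,P(A_n))$ has density on the simplex $\{x_i\ge0,\sum x_i=1\}$ $$\frac{(r!)^a}{\prod_{i=1}^n\Gamma(ra_i)}\prod_{i=1}^nx_i^{ra_i-1}\int_0^\infty t^{ra-1}e^{-rt}\prod_{j=1}^n\Phi_2^{(r-1)}\big(a_j\mathbf{I}_{r-1};ra_j;tx_j\mathbf{J}_{r-1}\big)dt,$$ where $\mathbf{I}_{r-1}=(1,\dots,1)$, $\mathbf{J}_{r-1}=(1,2,\dots,r-1)$ and $\Phi_2^{(N)}(\mathbf{b};c;\mathbf{x})=\sum_{i_1,\dots,i_N\ge0}\frac{(b_1)_{i_1}\cdots(b_N)_{i_N}}{(c)_{i_1+\cdots+i_N}}\frac{x_1^{i_1}\cdots x_N^{i_N}}{i_1!\cdots i_N!}$ is the confluent form of the fourth Lauricella hypergeometric function ($\Phi_2^{(0)}=1$). *)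

theory Defs
  imports "HOL-Probability.Probability" "HOL-Library.Landau_Symbols"
begin

text \<open>The Macdonald function (modified Bessel function of the third kind), given for real order and
  positive argument by its standard integral representation.\<close>

definition bessel_K :: "real \<Rightarrow> real \<Rightarrow> real" where
  "bessel_K \<mu> x = (LBINT t:{0<..}. exp (- x * cosh t) * cosh (\<mu> * t))"

definition upper_Gamma :: "real \<Rightarrow> real \<Rightarrow> real" where
  "upper_Gamma c x = (LBINT u:{x<..}. u powr (c - 1) * exp (- u))"

text \<open>The confluent form of the fourth Lauricella function in \<open>N\<close> variables. The parameters and
  arguments are indexed by \<open>1, \<dots>, N\<close>, and the sum runs over all multi-indices. For \<open>N = 0\<close> there is
  a single (empty) multi-index and the value is 1.\<close>

definition Lauricella_Phi2 ::
    "nat \<Rightarrow> (nat \<Rightarrow> real) \<Rightarrow> real \<Rightarrow> (nat \<Rightarrow> real) \<Rightarrow> real" where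
  "Lauricella_Phi2 N b c x =
    (\<Sum>\<^sub>\<infinity>i\<in>({1..N} \<rightarrow>\<^sub>E (UNIV :: nat set)).
       (\<Prod>k\<in>{1..N}. pochhammer (b k) (i k)) / pochhammer c (\<Sum>k\<in>{1..N}. i k)
       * (\<Prod>k\<in>{1..N}. x k ^ i k / fact (i k)))"

definition beta_density :: "real \<Rightarrow> real \<Rightarrow> real \<Rightarrow> real" where
  "beta_density p q x =
    indicator {0<..<1} x * (x powr (p - 1) * (1 - x) powr (q - 1) / Beta p q)"

definition nonatomic :: "'x measure \<Rightarrow> bool" where
  "nonatomic H \<longleftrightarrow>
    (\<forall>A\<in>sets H. emeasure H A > 0 \<longrightarrow>
       (\<exists>B\<in>sets H. B \<subseteq> A \<and> 0 < emeasure H B \<and> emeasure H B < emeasure H A))"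

definition random_prob_measure :: "'w measure \<Rightarrow> ('w \<Rightarrow> 'x::topological_space measure) \<Rightarrow> bool" where
  "random_prob_measure M P \<longleftrightarrow> P \<in> M \<rightarrow>\<^sub>M prob_algebra borel"

text \<open>\<open>f (X \<omega>)\<close> is the density of the conditional law of the real random variable \<open>Y\<close> given the
  random element \<open>X\<close> of \<open>N\<close>.\<close>

definition has_cond_density ::
    "'w measure \<Rightarrow> 'b measure \<Rightarrow> ('w \<Rightarrow> 'b) \<Rightarrow> ('w \<Rightarrow> real) \<Rightarrow> ('b \<Rightarrow> real \<Rightarrow> real) \<Rightarrow> bool" where
  "has_cond_density M N X Y f \<longleftrightarrow>
    X \<in> M \<rightarrow>\<^sub>M N \<and> Y \<in> M \<rightarrow>\<^sub>M borel \<and>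
    (\<lambda>(x, y). f x y) \<in> borel_measurable (N \<Otimes>\<^sub>M borel) \<and>
    (\<forall>B\<in>sets borel. AE \<omega> in M.
       nn_cond_exp M (vimage_algebra (space M) X N) (\<lambda>\<omega>'. indicator B (Y \<omega>')) \<omega>
       = (\<integral>\<^sup>+y\<in>B. ennreal (f (X \<omega>) y) \<partial>lborel))"

text \<open>Sequences are indexed from 0: \<open>v i\<close>, \<open>\<theta> i\<close> and \<open>stick_weight v i\<close> stand for
  \<open>v\<close>, \<open>\<theta>\<close> and \<open>w\<close> with index \<open>i + 1\<close> in the usual one-based notation.\<close>

definition stick_weight :: "(nat \<Rightarrow> 'w \<Rightarrow> real) \<Rightarrow> nat \<Rightarrow> 'w \<Rightarrow> real" where
  "stick_weight v i \<omega> = v i \<omega> * (\<Prod>j<i. 1 - v j \<omega>)"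

definition stick_breaking ::
    "'w measure \<Rightarrow> 'x::topological_space measure \<Rightarrow> (nat \<Rightarrow> 'w \<Rightarrow> real) \<Rightarrow> ('w \<Rightarrow> 'x measure) \<Rightarrow> bool"
  where
  "stick_breaking M H v P \<longleftrightarrow>
    random_prob_measure M P \<and>
    (\<forall>i. v i \<in> borel_measurable M \<and> (\<forall>\<omega>\<in>space M. v i \<omega> \<in> {0..1})) \<and>
    (AE \<omega> in M. (\<lambda>i. stick_weight v i \<omega>) sums 1) \<and>
    (\<exists>\<theta> :: nat \<Rightarrow> 'w \<Rightarrow> 'x.
       prob_space.indep_vars M (\<lambda>_. borel) \<theta> UNIV \<and>
       (\<forall>i. distr M borel (\<theta> i) = H) \<and>
       prob_space.indep_set M
         (sets (vimage_algebra (space M) (\<lambda>\<omega> i. v i \<omega>) (\<Pi>\<^sub>M i\<in>UNIV. borel)))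
         (sets (vimage_algebra (space M) (\<lambda>\<omega> i. \<theta> i \<omega>) (\<Pi>\<^sub>M i\<in>UNIV. borel))) \<and>
       (AE \<omega> in M. \<forall>A\<in>sets borel.
          (\<lambda>i. stick_weight v i \<omega> * indicator A (\<theta> i \<omega>)) sums measure (P \<omega>) A))"

definition is_DP :: "'w measure \<Rightarrow> real \<Rightarrow> 'x::topological_space measure \<Rightarrow> ('w \<Rightarrow> 'x measure) \<Rightarrow> bool"
  where
  "is_DP M a H P \<longleftrightarrow> 0 < a \<and>
    (\<exists>v. stick_breaking M H v P \<and>
       prob_space.indep_vars M (\<lambda>_. borel) v UNIV \<and>
       (\<forall>i. distributed M lborel (v i) (\<lambda>x. ennreal (beta_density 1 a x))))"

text \<open>Here \<open>G\<close> is the common law of the weights, a probability distribution on \<open>(0,1)\<close>.\<close>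

definition is_DPG ::
    "'w measure \<Rightarrow> real measure \<Rightarrow> 'x::topological_space measure \<Rightarrow> ('w \<Rightarrow> 'x measure) \<Rightarrow> bool" where
  "is_DPG M G H P \<longleftrightarrow>
    prob_space G \<and> sets G = sets borel \<and> emeasure G {0<..<1} = 1 \<and>
    (\<exists>v. stick_breaking M H v P \<and>
       prob_space.indep_vars M (\<lambda>_. borel) v UNIV \<and>
       (\<forall>i. distr M borel (v i) = G))"

definition moment_assumption :: "(real \<Rightarrow> real measure) \<Rightarrow> bool" where
  "moment_assumption g \<longleftrightarrow>
    (\<forall>a>0. prob_space (g a) \<and> sets (g a) = sets borel \<and> emeasure (g a) {0<..<1} = 1) \<and>
    (\<exists>(k :: nat \<Rightarrow> real) (C :: nat \<Rightarrow> real).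
       (\<forall>p\<ge>1. k p > 0 \<and> C p \<noteq> 0) \<and>
       (\<forall>i j. 1 \<le> j \<longrightarrow> j \<le> i \<longrightarrow> real j * k i \<ge> real i * k j) \<and>
       (\<forall>p\<ge>1. (\<lambda>a. (\<integral>x. x ^ p \<partial>g a) - C p / a powr k p) \<in> o[at_top](\<lambda>a. 1 / a powr k p)))"

definition is_PDP ::
    "'w measure \<Rightarrow> real \<Rightarrow> real \<Rightarrow> 'x::topological_space measure \<Rightarrow> ('w \<Rightarrow> 'x measure) \<Rightarrow> bool" where
  "is_PDP M a b H P \<longleftrightarrow> 0 < b \<and> b < 1 \<and> - b < a \<and>
    (\<exists>v. stick_breaking M H v P \<and>
       prob_space.indep_vars M (\<lambda>_. borel) v UNIV \<and>
       (\<forall>i. distributed M lborel (v i)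
              (\<lambda>x. ennreal (beta_density (1 - b) (a + real (Suc i) * b) x))))"

text \<open>The joint law of the weights is given by the density \<open>f1\<close> of the first one and, for \<open>n \<ge> 2\<close>,
  the conditional density \<open>f n\<close> of the \<open>n\<close>-th one given the first \<open>n - 1\<close>. The index \<open>n\<close> of \<open>f\<close> is
  one-based while \<open>v\<close> is zero-based, so \<open>f (Suc m)\<close> is the conditional density of \<open>v m\<close> and its
  argument \<open>y\<close> carries the values of \<open>v 0, \<dots>, v (m - 1)\<close>.\<close>

definition weights_have_densities ::
    "'w measure \<Rightarrow> (nat \<Rightarrow> 'w \<Rightarrow> real) \<Rightarrow> (real \<Rightarrow> real) \<Rightarrow> (nat \<Rightarrow> (nat \<Rightarrow> real) \<Rightarrow> real \<Rightarrow> real) \<Rightarrow> bool"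
  where
  "weights_have_densities M v f1 f \<longleftrightarrow>
    distributed M lborel (v 0) (\<lambda>x. ennreal (f1 x)) \<and>
    (\<forall>m\<ge>1. has_cond_density M (\<Pi>\<^sub>M i\<in>{..<m}. borel) (\<lambda>\<omega>. \<lambda>i\<in>{..<m}. v i \<omega>) (v m) (f (Suc m)))"

definition NIG_density1 :: "real \<Rightarrow> real \<Rightarrow> real" where
  "NIG_density1 a x = indicator {0<..<1} x *
    (a powr (1/2) * x powr (-1/2) * (1 - x) powr (-1)
       / ((2 * pi) powr (1/2) * bessel_K (-1/2) a)
     * bessel_K (-1) (a / sqrt (1 - x)))"

definition NIG_density :: "real \<Rightarrow> nat \<Rightarrow> (nat \<Rightarrow> real) \<Rightarrow> real \<Rightarrow> real" where
  "NIG_density a n y x = indicator {0<..<1} x *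
    (a powr (1/2) * (\<Prod>i<n-1. (1 - y i) powr (-1/4)) * x powr (-1/2)
         * (1 - x) powr (-5/4 + real n / 4)
       / ((2 * pi) powr (1/2) * bessel_K (- real n / 2) (a / sqrt (\<Prod>i<n-1. 1 - y i)))
     * bessel_K (-1/2 - real n / 2) (a / sqrt ((1 - x) * (\<Prod>i<n-1. 1 - y i))))"

definition is_NIGP ::
    "'w measure \<Rightarrow> real \<Rightarrow> 'x::topological_space measure \<Rightarrow> ('w \<Rightarrow> 'x measure) \<Rightarrow> bool" where
  "is_NIGP M a H P \<longleftrightarrow> 0 < a \<and>
    (\<exists>v. stick_breaking M H v P \<and>
       weights_have_densities M v (NIG_density1 a) (NIG_density a))"

definition NGG_density1 :: "real \<Rightarrow> real \<Rightarrow> real \<Rightarrow> real" where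
  "NGG_density1 \<sigma> a x = indicator {0<..<1} x *
    (x powr (- \<sigma>) * (1 - x) powr (\<sigma> - 1) * exp a / (Gamma \<sigma> * Gamma (1 - \<sigma>))
     * (\<Sum>j. pochhammer (1 - \<sigma>) j / fact j * (a powr (real j / \<sigma>) / (1 - x) ^ j)
            * upper_Gamma (1 - real j / \<sigma>) (a / (1 - x) powr \<sigma>)))"

definition NGG_density :: "real \<Rightarrow> real \<Rightarrow> nat \<Rightarrow> (nat \<Rightarrow> real) \<Rightarrow> real \<Rightarrow> real" where
  "NGG_density \<sigma> a n y x = indicator {0<..<1} x *
    (\<sigma> * Gamma (real (n - 1) * \<sigma>) * x powr (- \<sigma>) * (1 - x) powr (real n * \<sigma> - 1)
       / (Gamma (1 - \<sigma>) * Gamma (real n * \<sigma>))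
     * ((\<Sum>j. pochhammer (1 - real n * \<sigma>) j / fact j
              * (a powr (real j / \<sigma>) / ((1 - x) ^ j * (\<Prod>i<n-1. (1 - y i) ^ j)))
              * upper_Gamma (real n - real j / \<sigma>)
                  (a / ((1 - x) powr \<sigma> * (\<Prod>i<n-1. (1 - y i) powr \<sigma>))))
        / (\<Sum>j. pochhammer (1 - real (n - 1) * \<sigma>) j / fact j
              * (a powr (real j / \<sigma>) / (\<Prod>i<n-1. (1 - y i) ^ j))
              * upper_Gamma (real n - 1 - real j / \<sigma>)
                  (a / (\<Prod>i<n-1. (1 - y i) powr \<sigma>)))))"

definition is_NGGP ::
    "'w measure \<Rightarrow> real \<Rightarrow> real \<Rightarrow> 'x::topological_space measure \<Rightarrow> ('w \<Rightarrow> 'x measure) \<Rightarrow> bool" where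
  "is_NGGP M \<sigma> a H P \<longleftrightarrow> 0 < \<sigma> \<and> \<sigma> < 1 \<and> 0 < a \<and>
    (\<exists>v. stick_breaking M H v P \<and>
       weights_have_densities M v (NGG_density1 \<sigma> a) (NGG_density \<sigma> a))"

text \<open>The density at the point \<open>x\<close> of the simplex, with \<open>\<alpha> i = a H(A i)\<close> for \<open>i \<in> {1..n}\<close>.\<close>

definition GDP_density :: "real \<Rightarrow> nat \<Rightarrow> nat \<Rightarrow> (nat \<Rightarrow> real) \<Rightarrow> (nat \<Rightarrow> real) \<Rightarrow> real" where
  "GDP_density a r n \<alpha> x =
    (fact r) powr a / (\<Prod>i\<in>{1..n}. Gamma (real r * \<alpha> i))
    * (\<Prod>i\<in>{1..n}. x i powr (real r * \<alpha> i - 1))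
    * (LBINT t:{0<..}. t powr (real r * a - 1) * exp (- real r * t)
         * (\<Prod>j\<in>{1..n}. Lauricella_Phi2 (r - 1) (\<lambda>_. \<alpha> j) (real r * \<alpha> j)
                           (\<lambda>k. t * x j * real k)))"

text \<open>A density on the simplex is taken with respect to Lebesgue measure in the first \<open>n - 1\<close>
  coordinates, the last one being \<open>1\<close> minus their sum. The formula makes sense only if
  \<open>n \<ge> 2\<close> and all cells have positive \<open>H\<close>-measure; for nonatomic \<open>H\<close> these
  partitions determine the law of the remaining ones.\<close>

definition is_GDP ::
    "'w measure \<Rightarrow> real \<Rightarrow> nat \<Rightarrow> 'x::topological_space measure \<Rightarrow> ('w \<Rightarrow> 'x measure) \<Rightarrow> bool" where
  "is_GDP M a r H P \<longleftrightarrow> 0 < a \<and> 1 \<le> r \<and> random_prob_measure M P \<and>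
    (\<forall>n (A :: nat \<Rightarrow> 'x set).
       2 \<le> n \<longrightarrow> (\<forall>i\<in>{1..n}. A i \<in> sets borel \<and> 0 < measure H (A i)) \<longrightarrow>
       disjoint_family_on A {1..n} \<longrightarrow> (\<Union>i\<in>{1..n}. A i) = UNIV \<longrightarrow>
       distributed M (\<Pi>\<^sub>M i\<in>{1..n-1}. lborel) (\<lambda>\<omega>. \<lambda>i\<in>{1..n-1}. measure (P \<omega>) (A i))
         (\<lambda>x. let x' = x(n := 1 - (\<Sum>i\<in>{1..n-1}. x i))
              in if \<forall>i\<in>{1..n}. 0 \<le> x' i
                 then ennreal (GDP_density a r n (\<lambda>i. a * measure H (A i)) x') else 0))"

end

theory Submission
  imports Defs
begin

text \<open>All six cases reduce to summable tail bounds for \<open>P\<^sub>n(A)\<close> and Borel-Cantelli.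

  For a stick-breaking process, Hoeffding's inequality conditionally on the weights bounds
  \<open>Pr (\<bar>P(A) - H(A)\<bar> > e)\<close> by a constant times \<open>E ((\<Sum> w\<^sub>i\<^sup>2) ^ q) \<le> E (\<Sum> w\<^sub>i ^ q)\<close>. If
  \<open>E (v\<^sub>i ^ q | v\<^sub>1, \<dots>) \<le> \<delta> E (v\<^sub>i | v\<^sub>1, \<dots>)\<close> for all \<open>i\<close>, the last sum is at most \<open>\<delta> E (\<Sum> w\<^sub>i) \<le> \<delta>\<close>,
  and \<open>\<delta>\<close> decays like an arbitrarily large power of \<open>1 / a\<close> as \<open>q\<close> grows. For general weights this is the
  moment assumption. In the other cases the (conditional) density of \<open>v\<^sub>i\<close> is proportional to
  \<open>x powr (s - 1) * \<phi> x\<close> with \<open>\<phi> x / (1 - x) powr c\<close> decreasing and \<open>c\<close> of order \<open>a\<close>, so Chebyshev's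
  association inequality allows comparison with a Beta law. For the normalized processes \<open>\<phi>\<close> is a mixture of
  functions \<open>(1 - x) powr m * exp (- z * (1 - x) powr (- s) * h)\<close>, each of which has this property.

  For the generalized Dirichlet process, \<open>P(A)\<close> is a ratio of independent sums of gamma variables,
  and Chernoff's bound gives exponential tails.\<close>

section \<open>Tail bounds for stick-breaking processes\<close>

text \<open>Second moments are too weak: for a Dirichlet process the expected sum of squared weights
  is 1 / (a + 1), so Chebyshev gives tails of order n powr (- \<tau>), not summable for small
  \<tau>. Raising the sum of squares to the power q multiplies the rate, and q is chosen last, in
  terms of \<tau>. The coupling of the \<open>P n\<close> for different n is arbitrary, so the first
  Borel-Cantelli lemma is the available one. \<open>stick_moment_bound\<close> carries the same q-th
  power of the remaining stick on both sides, so it follows by integrating a comparison of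
  conditional moments of \<open>v i\<close> given the earlier weights. No normalizing constant is
  ever evaluated: the comparison is homogeneous in the density, so Bessel functions and incomplete
  gamma series in denominators stay as they are and only the dependence on x matters. The
  generalized Dirichlet process is given by finite-dimensional densities instead of sticks. Its
  tails come from the partition into A and its complement, which requires both cells to have
  positive measure; sets of measure 0 or 1 are reached by approximation, and this is where
  nonatomicity enters.\<close>

definition stick_moment_bound :: "'w measure \<Rightarrow> (nat \<Rightarrow> 'w \<Rightarrow> real) \<Rightarrow> nat \<Rightarrow> real \<Rightarrow> bool" where
  "stick_moment_bound M v q \<delta> \<longleftrightarrow> (\<forall>i.
    (\<integral>\<^sup>+\<omega>. ennreal (v i \<omega> ^ q) * ennreal ((\<Prod>j<i. 1 - v j \<omega>) ^ q) \<partial>M)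
      \<le> ennreal \<delta> * (\<integral>\<^sup>+\<omega>. ennreal (v i \<omega>) * ennreal ((\<Prod>j<i. 1 - v j \<omega>) ^ q) \<partial>M))"

text \<open>Borel-Cantelli is applied along the countably many thresholds 1 / (k + 1), so that one
  exceptional null set serves all accuracies.\<close>

lemma (in prob_space) AE_tendsto_if_summable_tails:
  fixes X :: "nat \<Rightarrow> 'a \<Rightarrow> real"
  assumes [measurable]: "\<And>n. X n \<in> borel_measurable M"
    and sm: "\<And>e. e > 0 \<Longrightarrow> summable (\<lambda>n. prob {\<omega>\<in>space M. e < \<bar>X n \<omega> - c\<bar>})"
  shows "AE \<omega> in M. (\<lambda>n. X n \<omega>) \<longlonglongrightarrow> c"
proof -
  have "AE \<omega> in M. \<forall>k. eventually (\<lambda>n. \<omega> \<in> space M - {\<omega>\<in>space M. 1 / real (Suc k) < \<bar>X n \<omega> - c\<bar>}) sequentially"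
    unfolding AE_all_countable
    by (intro allI borel_cantelli_AE1 sm) (auto simp: emeasure_eq_measure)
  then show ?thesis
  proof eventually_elim
    case (elim \<omega>)
    show ?case
    proof (rule LIMSEQ_I)
      fix e :: real assume "e > 0"
      then obtain k where k: "1 / real (Suc k) < e"
        using nat_approx_posE by metis
      from elim[rule_format, of k] have "\<forall>\<^sub>F n in sequentially. norm (X n \<omega> - c) < e"
        by eventually_elim (use k in auto)
      then show "\<exists>no. \<forall>n\<ge>no. norm (X n \<omega> - c) < e"
        by (simp add: eventually_sequentially)
    qed
  qed
qed

text \<open>With total weight at most 1, the sum of squares is at most the largest weight, whose
  q-th power is one of the terms on the right.\<close>

lemma sum_squares_power_le:
  fixes w :: "'i \<Rightarrow> real"
  assumes "finite I" "\<And>i. i \<in> I \<Longrightarrow> 0 \<le> w i" "(\<Sum>i\<in>I. w i) \<le> 1" "q \<ge> 1"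
  shows "(\<Sum>i\<in>I. (w i)\<^sup>2) ^ q \<le> (\<Sum>i\<in>I. w i ^ q)"
proof (cases "I = {}")
  case False
  then have "Max (w ` I) \<in> w ` I" using assms by (intro Max_in) auto
  then obtain k where k: "k \<in> I" "w k = Max (w ` I)" by auto
  then have le: "w i \<le> w k" if "i \<in> I" for i using that assms(1) by auto
  have "(\<Sum>i\<in>I. (w i)\<^sup>2) \<le> (\<Sum>i\<in>I. w k * w i)"
    using le assms(2) by (intro sum_mono) (auto simp: power2_eq_square intro!: mult_right_mono)
  also have "\<dots> = w k * (\<Sum>i\<in>I. w i)" by (simp add: sum_distrib_left)
  also have "\<dots> \<le> w k * 1" using assms(3) assms(2)[OF k(1)] by (intro mult_left_mono) auto
  finally have "(\<Sum>i\<in>I. (w i)\<^sup>2) ^ q \<le> w k ^ q" by (intro power_mono sum_nonneg) auto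
  also have "\<dots> \<le> (\<Sum>i\<in>I. w i ^ q)"
    using member_le_sum[of k I "\<lambda>i. w i ^ q"] k assms by auto
  finally show ?thesis .
qed (use assms in \<open>auto simp: power_0_left\<close>)

text \<open>A single term of the exponential series bounds exp y from below. This trades an
  exponential tail for a power of any prescribed order.\<close>

lemma exp_minus_le_fact:
  assumes "y > (0::real)"
  shows "exp (- y) \<le> fact q / y ^ q"
proof -
  have "y ^ q / fact q \<le> exp y"
  proof -
    have "(\<Sum>n\<in>{q}. y ^ n / fact n) \<le> (\<Sum>n. y ^ n / fact n)"
      using assms summable_exp[of y] by (intro sum_le_suminf) (auto simp: field_simps)
    then show ?thesis by (simp add: exp_def scaleR_conv_of_real field_simps)
  qed
  then show ?thesis using assms by (simp add: exp_minus field_simps)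
qed

text \<open>This is the estimate for frozen weights: the i-th summand ranges over an interval of
  length \<open>w i\<close>, so Hoeffding's exponent is -2 e^2 divided by the sum of squared
  weights. Passing to a q-th power makes the bound linear in the \<open>w i ^ q\<close>, ready to be
  integrated over random weights.\<close>

lemma (in prob_space) weighted_sum_tail_bound:
  fixes \<theta> :: "nat \<Rightarrow> 'a \<Rightarrow> 'x::topological_space" and w :: "nat \<Rightarrow> real"
  assumes indep: "indep_vars (\<lambda>_. borel) \<theta> UNIV" and distr: "\<And>i. distr M borel (\<theta> i) = H"
    and A: "A \<in> sets borel"
    and w: "\<And>i. i < N \<Longrightarrow> 0 \<le> w i" "(\<Sum>i<N. w i) \<le> 1" and e: "e > 0" and q: "q \<ge> 1"
  shows "prob {\<omega>\<in>space M. e < \<bar>\<Sum>i<N. w i * (indicator A (\<theta> i \<omega>) - measure H A)\<bar>}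
    \<le> 2 * fact q / (2 * e\<^sup>2) ^ q * (\<Sum>i<N. w i ^ q)"
\<comment> \<open>Hoeffding's bound divides by the sum of squares; if that is zero, all weights
  vanish and the event is empty.\<close>
proof (cases "(\<Sum>i<N. (w i)\<^sup>2) = 0")
  case True
  then have "w i = 0" if "i < N" for i using that by (subst (asm) sum_nonneg_eq_0_iff) auto
  then have "{\<omega>\<in>space M. e < \<bar>\<Sum>i<N. w i * (indicator A (\<theta> i \<omega>) - measure H A)\<bar>} = {}" using e by simp
  then show ?thesis using w by (simp only: measure_empty) (auto intro!: divide_nonneg_nonneg mult_nonneg_nonneg sum_nonneg)
next
  case False
  then have pos: "(\<Sum>i<N. (w i)\<^sup>2) > 0" by (simp add: less_le sum_nonneg)
  have [measurable]: "\<theta> i \<in> M \<rightarrow>\<^sub>M borel" for i using indep by (auto simp: indep_vars_def)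
  note [measurable] = A
  define X where "X = (\<lambda>i \<omega>. w i * indicator A (\<theta> i \<omega>) :: real)"
  have [measurable]: "X i \<in> borel_measurable M" for i by (simp add: X_def)
  have EX: "expectation (X i) = w i * measure H A" for i
  proof -
    have "measure H A = measure (distr M borel (\<theta> i)) A" by (simp add: distr)
    also have "\<dots> = prob (\<theta> i -` A \<inter> space M)" by (simp add: measure_distr)
    also have "\<dots> = expectation (indicator (\<theta> i -` A \<inter> space M))" by simp
    also have "\<dots> = expectation (\<lambda>\<omega>. indicator A (\<theta> i \<omega>))"
      by (intro Bochner_Integration.integral_cong) (auto simp: indicator_def)
    finally show ?thesis by (simp add: X_def)
  qed
  interpret Hf: Hoeffding_ineq M "{..<N}" X "\<lambda>_. 0" w "\<Sum>i<N. expectation (X i)"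
  proof unfold_locales
    show "indep_vars (\<lambda>_. borel) X {..<N}"
      unfolding X_def by (rule indep_vars_compose2[OF indep_vars_subset[OF indep]]) auto
    show "AE x in M. X i x \<in> {0..w i}" if "i \<in> {..<N}" for i
      using w(1)[of i] that by (auto simp: X_def indicator_def)
  qed auto
  have "{\<omega>\<in>space M. e < \<bar>\<Sum>i<N. w i * (indicator A (\<theta> i \<omega>) - measure H A)\<bar>}
     \<subseteq> {\<omega>\<in>space M. \<bar>(\<Sum>i<N. X i \<omega>) - (\<Sum>i<N. expectation (X i))\<bar> \<ge> e}"
    unfolding EX by (auto simp: X_def sum_subtractf right_diff_distrib)
  then have "prob {\<omega>\<in>space M. e < \<bar>\<Sum>i<N. w i * (indicator A (\<theta> i \<omega>) - measure H A)\<bar>}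
     \<le> prob {\<omega>\<in>space M. \<bar>(\<Sum>i<N. X i \<omega>) - (\<Sum>i<N. expectation (X i))\<bar> \<ge> e}"
    by (rule finite_measure_mono) measurable
  also have "\<dots> \<le> 2 * exp (- 2 * e\<^sup>2 / (\<Sum>i<N. (w i - 0)\<^sup>2))"
    using e pos by (intro Hf.Hoeffding_ineq_abs_ge) auto
  also have "\<dots> = 2 * exp (- (2 * e\<^sup>2 / (\<Sum>i<N. (w i)\<^sup>2)))" by simp
  also have "\<dots> \<le> 2 * (fact q / (2 * e\<^sup>2 / (\<Sum>i<N. (w i)\<^sup>2)) ^ q)"
    using e pos by (intro mult_left_mono exp_minus_le_fact) auto
  also have "\<dots> = 2 * fact q / (2 * e\<^sup>2) ^ q * (\<Sum>i<N. (w i)\<^sup>2) ^ q"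
    by (simp add: power_divide)
  also have "\<dots> \<le> 2 * fact q / (2 * e\<^sup>2) ^ q * (\<Sum>i<N. w i ^ q)"
    using w q by (intro mult_left_mono sum_squares_power_le) auto
  finally show ?thesis .
qed

lemma one_minus_sum_stick_weight:
  "1 - (\<Sum>i<N. stick_weight v i \<omega>) = (\<Prod>j<N. 1 - v j \<omega>)"
  by (induction N) (auto simp: stick_weight_def algebra_simps)

text \<open>Weights and atoms are independent, so the law of the pair is a product measure and
  Fubini reduces the truncated sum to \<open>weighted_sum_tail_bound\<close> with the weights held
  fixed. The bound is uniform in the truncation N, and Fatou's lemma carries it to the
  limit.\<close>

lemma (in prob_space) stick_breaking_tail_bound:
  fixes H :: "'x::topological_space measure"
  assumes sb: "stick_breaking M H v P" and A: "A \<in> sets borel" and e: "e > 0" and q: "q \<ge> 1"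
    and \<delta>: "\<delta> \<ge> 0" and mb: "stick_moment_bound M v q \<delta>"
  shows "prob {\<omega>\<in>space M. e < \<bar>measure (P \<omega>) A - measure H A\<bar>} \<le> 2 * fact q / (2 * e\<^sup>2) ^ q * \<delta>"
proof -
  define h where "h = measure H A"
  define K where "K = 2 * fact q / (2 * e\<^sup>2) ^ q"
  have K: "K \<ge> 0" by (simp add: K_def)
  define w where "w = (\<lambda>i \<omega>. stick_weight v i \<omega>)"
  from sb have [measurable]: "P \<in> M \<rightarrow>\<^sub>M prob_algebra borel" "\<And>i. v i \<in> borel_measurable M"
    by (auto simp: stick_breaking_def random_prob_measure_def)
  note [measurable] = A
  from sb have v01: "0 \<le> v i \<omega>" "v i \<omega> \<le> 1" if "\<omega> \<in> space M" for i \<omega>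
    using that by (auto simp: stick_breaking_def)
  from sb have sums1: "AE \<omega> in M. (\<lambda>i. w i \<omega>) sums 1"
    by (auto simp: stick_breaking_def w_def)
  from sb obtain \<theta> where ind\<theta>: "indep_vars (\<lambda>_. borel) \<theta> UNIV" and d\<theta>: "\<And>i. distr M borel (\<theta> i) = H"
    and ind: "indep_set
         (sets (vimage_algebra (space M) (\<lambda>\<omega> i. v i \<omega>) (\<Pi>\<^sub>M i\<in>UNIV. borel)))
         (sets (vimage_algebra (space M) (\<lambda>\<omega> i. \<theta> i \<omega>) (\<Pi>\<^sub>M i\<in>UNIV. borel)))"
    and PA: "AE \<omega> in M. \<forall>A\<in>sets borel. (\<lambda>i. w i \<omega> * indicator A (\<theta> i \<omega>)) sums measure (P \<omega>) A"
    by (auto simp: stick_breaking_def w_def)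
  have [measurable]: "\<theta> i \<in> M \<rightarrow>\<^sub>M borel" for i using ind\<theta> by (auto simp: indep_vars_def)
  have [measurable]: "w i \<in> borel_measurable M" for i by (simp add: w_def stick_weight_def)
  define V where "V = (\<lambda>\<omega> i. v i \<omega>)"
  define \<Theta> where "\<Theta> = (\<lambda>\<omega> i. \<theta> i \<omega>)"
  have [measurable]: "V \<in> M \<rightarrow>\<^sub>M (\<Pi>\<^sub>M i\<in>UNIV. borel)" "\<Theta> \<in> M \<rightarrow>\<^sub>M (\<Pi>\<^sub>M i\<in>UNIV. borel)"
    unfolding V_def \<Theta>_def by (rule measurable_PiM_single'; simp)+
  interpret T: prob_space "distr M (\<Pi>\<^sub>M i\<in>UNIV. borel) \<Theta>" by (rule prob_space_distr) simp
  interpret V: prob_space "distr M (\<Pi>\<^sub>M i\<in>UNIV. borel) V" by (rule prob_space_distr) simp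
  have joint: "distr M (\<Pi>\<^sub>M i\<in>UNIV. borel) V \<Otimes>\<^sub>M distr M (\<Pi>\<^sub>M i\<in>UNIV. borel) \<Theta>
      = distr M ((\<Pi>\<^sub>M i\<in>UNIV. borel) \<Otimes>\<^sub>M (\<Pi>\<^sub>M i\<in>UNIV. borel)) (\<lambda>\<omega>. (V \<omega>, \<Theta> \<omega>))"
  proof (rule pair_measure_eqI)
    fix X Y assume XY: "X \<in> sets (distr M (\<Pi>\<^sub>M i\<in>UNIV. borel) V)" "Y \<in> sets (distr M (\<Pi>\<^sub>M i\<in>UNIV. borel) \<Theta>)"
    then have XY'[measurable]: "X \<in> sets (\<Pi>\<^sub>M i\<in>UNIV. borel)" "Y \<in> sets (\<Pi>\<^sub>M i\<in>UNIV. borel)" by auto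
    have "prob ((V -` X \<inter> space M) \<inter> (\<Theta> -` Y \<inter> space M)) = prob (V -` X \<inter> space M) * prob (\<Theta> -` Y \<inter> space M)"
      unfolding V_def \<Theta>_def by (intro indep_setD[OF ind] in_vimage_algebra XY')
    moreover have "(\<lambda>\<omega>. (V \<omega>, \<Theta> \<omega>)) -` (X \<times> Y) \<inter> space M = (V -` X \<inter> space M) \<inter> (\<Theta> -` Y \<inter> space M)" by auto
    ultimately show "emeasure (distr M (\<Pi>\<^sub>M i\<in>UNIV. borel) V) X * emeasure (distr M (\<Pi>\<^sub>M i\<in>UNIV. borel) \<Theta>) Y =
      emeasure (distr M ((\<Pi>\<^sub>M i\<in>UNIV. borel) \<Otimes>\<^sub>M (\<Pi>\<^sub>M i\<in>UNIV. borel)) (\<lambda>\<omega>. (V \<omega>, \<Theta> \<omega>))) (X \<times> Y)"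
      by (simp add: emeasure_distr emeasure_eq_measure ennreal_mult)
  qed (simp_all add: V.sigma_finite_measure_axioms T.sigma_finite_measure_axioms cong: sets_pair_measure_cong)
  have w01: "0 \<le> w i \<omega>" if "\<omega> \<in> space M" for i \<omega>
    using v01[OF that] unfolding w_def stick_weight_def by (auto intro!: mult_nonneg_nonneg prod_nonneg)
  have wsum: "(\<Sum>i<N. w i \<omega>) \<le> 1" if "\<omega> \<in> space M" for N \<omega>
  proof -
    have "0 \<le> (\<Prod>j<N. 1 - v j \<omega>)" using v01[OF that] by (intro prod_nonneg) auto
    then show ?thesis using one_minus_sum_stick_weight[of v \<omega> N] by (simp add: w_def)
  qed
  have wq: "ennreal (w i \<omega> ^ q) = ennreal (v i \<omega> ^ q) * ennreal ((\<Prod>j<i. 1 - v j \<omega>) ^ q)"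
    if "\<omega> \<in> space M" for i \<omega>
    using v01[OF that] by (simp add: w_def stick_weight_def power_mult_distrib ennreal_mult prod_nonneg)
  \<comment> \<open>The remaining stick lies in [0,1], so its q-th power may be replaced by the
    first; this bounds the right side of \<open>stick_moment_bound\<close> by \<delta> times the
    mean of \<open>w i\<close>.\<close>
  have wle: "ennreal (v i \<omega>) * ennreal ((\<Prod>j<i. 1 - v j \<omega>) ^ q) \<le> ennreal (w i \<omega>)"
    if "\<omega> \<in> space M" for i \<omega>
  proof -
    have p: "0 \<le> (\<Prod>j<i. 1 - v j \<omega>)" "(\<Prod>j<i. 1 - v j \<omega>) \<le> 1"
      using v01[OF that] by (auto intro!: prod_nonneg prod_le_1)
    then have "(\<Prod>j<i. 1 - v j \<omega>) ^ q \<le> (\<Prod>j<i. 1 - v j \<omega>) ^ 1" using q by (intro power_decreasing) auto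
    then show ?thesis using v01[OF that] p
      by (auto simp: w_def stick_weight_def ennreal_mult[symmetric] intro!: ennreal_leI mult_left_mono)
  qed
  \<comment> \<open>The means of the weights add up to at most 1, so \<delta> is paid only once for
    the whole sum.\<close>
  have moments: "(\<Sum>i<N. \<integral>\<^sup>+\<omega>. ennreal (w i \<omega> ^ q) \<partial>M) \<le> ennreal \<delta>" for N
  proof -
    have "(\<Sum>i<N. \<integral>\<^sup>+\<omega>. ennreal (w i \<omega> ^ q) \<partial>M)
      \<le> (\<Sum>i<N. ennreal \<delta> * (\<integral>\<^sup>+\<omega>. ennreal (v i \<omega>) * ennreal ((\<Prod>j<i. 1 - v j \<omega>) ^ q) \<partial>M))"
      using mb unfolding stick_moment_bound_def by (intro sum_mono) (simp add: wq cong: nn_integral_cong)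
    also have "\<dots> \<le> (\<Sum>i<N. ennreal \<delta> * (\<integral>\<^sup>+\<omega>. ennreal (w i \<omega>) \<partial>M))"
      by (intro sum_mono mult_left_mono nn_integral_mono wle) auto
    also have "\<dots> = ennreal \<delta> * (\<integral>\<^sup>+\<omega>. (\<Sum>i<N. ennreal (w i \<omega>)) \<partial>M)"
      by (simp add: sum_distrib_left nn_integral_sum)
    also have "\<dots> \<le> ennreal \<delta> * (\<integral>\<^sup>+\<omega>. 1 \<partial>M)"
      using wsum w01 by (intro mult_left_mono nn_integral_mono) (auto simp: sum_ennreal ennreal_le_1)
    also have "\<dots> = ennreal \<delta>" by (simp add: emeasure_space_1)
    finally show ?thesis .
  qed
  define S where "S = (\<lambda>N \<omega>. \<Sum>i<N. w i \<omega> * (indicator A (\<theta> i \<omega>) - h))"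
  have [measurable]: "S N \<in> borel_measurable M" for N by (simp add: S_def)
  have fin: "emeasure M {\<omega>\<in>space M. e < \<bar>S N \<omega>\<bar>} \<le> ennreal (K * \<delta>)" for N
  proof -
    define B where "B = {p \<in> space ((\<Pi>\<^sub>M i\<in>UNIV. borel) \<Otimes>\<^sub>M (\<Pi>\<^sub>M i\<in>UNIV. borel)).
      e < \<bar>\<Sum>i<N. (fst p i * (\<Prod>j<i. 1 - fst p j)) * (indicator A (snd p i) - h)\<bar>}"
    have [measurable]: "B \<in> sets ((\<Pi>\<^sub>M i\<in>UNIV. borel) \<Otimes>\<^sub>M (\<Pi>\<^sub>M i\<in>UNIV. borel))"
      unfolding B_def by measurable
    have "{\<omega>\<in>space M. e < \<bar>S N \<omega>\<bar>} = (\<lambda>\<omega>. (V \<omega>, \<Theta> \<omega>)) -` B \<inter> space M"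
      by (auto simp: B_def S_def V_def \<Theta>_def w_def stick_weight_def space_pair_measure space_PiM)
    then have "emeasure M {\<omega>\<in>space M. e < \<bar>S N \<omega>\<bar>}
        = emeasure (distr M (\<Pi>\<^sub>M i\<in>UNIV. borel) V \<Otimes>\<^sub>M distr M (\<Pi>\<^sub>M i\<in>UNIV. borel) \<Theta>) B"
      by (simp add: joint emeasure_distr)
    also have "\<dots> = (\<integral>\<^sup>+x. emeasure (distr M (\<Pi>\<^sub>M i\<in>UNIV. borel) \<Theta>) (Pair x -` B)
        \<partial>distr M (\<Pi>\<^sub>M i\<in>UNIV. borel) V)"
      by (subst T.emeasure_pair_measure_alt) (simp_all cong: sets_pair_measure_cong)
    also have "\<dots> = (\<integral>\<^sup>+\<omega>. emeasure (distr M (\<Pi>\<^sub>M i\<in>UNIV. borel) \<Theta>) (Pair (V \<omega>) -` B) \<partial>M)"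
      by (rule nn_integral_distr[OF \<open>V \<in> _\<close>], rule T.measurable_emeasure_Pair)
        (simp cong: sets_pair_measure_cong)
    also have "\<dots> \<le> (\<integral>\<^sup>+\<omega>. ennreal K * (\<Sum>i<N. ennreal (w i \<omega> ^ q)) \<partial>M)"
    proof (intro nn_integral_mono)
      fix \<omega> assume \<omega>: "\<omega> \<in> space M"
      have "emeasure (distr M (\<Pi>\<^sub>M i\<in>UNIV. borel) \<Theta>) (Pair (V \<omega>) -` B) = emeasure M (\<Theta> -` (Pair (V \<omega>) -` B) \<inter> space M)"
        by (rule emeasure_distr[OF \<open>\<Theta> \<in> _\<close>]) (rule sets_Pair1[OF \<open>B \<in> _\<close>])
      also have "\<Theta> -` (Pair (V \<omega>) -` B) \<inter> space M
          = {\<omega>'\<in>space M. e < \<bar>\<Sum>i<N. w i \<omega> * (indicator A (\<theta> i \<omega>') - h)\<bar>}"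
        by (auto simp: B_def V_def \<Theta>_def w_def stick_weight_def space_pair_measure space_PiM)
      also have "emeasure M \<dots> \<le> ennreal (K * (\<Sum>i<N. w i \<omega> ^ q))"
        unfolding emeasure_eq_measure h_def K_def using w01[OF \<omega>] wsum[OF \<omega>] e q
        by (intro ennreal_leI weighted_sum_tail_bound[OF ind\<theta> d\<theta> A]) auto
      also have "\<dots> = ennreal K * (\<Sum>i<N. ennreal (w i \<omega> ^ q))"
        using w01[OF \<omega>] K by (simp add: ennreal_mult sum_nonneg sum_ennreal)
      finally show "emeasure (distr M (\<Pi>\<^sub>M i\<in>UNIV. borel) \<Theta>) (Pair (V \<omega>) -` B) \<le> \<dots>" .
    qed
    also have "\<dots> = ennreal K * (\<Sum>i<N. \<integral>\<^sup>+\<omega>. ennreal (w i \<omega> ^ q) \<partial>M)"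
      by (simp add: nn_integral_cmult nn_integral_sum)
    also have "\<dots> \<le> ennreal K * ennreal \<delta>" by (intro mult_left_mono moments) auto
    finally show ?thesis using K \<delta> by (simp add: ennreal_mult)
  qed
  have lim: "AE \<omega> in M. (\<lambda>N. S N \<omega>) \<longlonglongrightarrow> measure (P \<omega>) A - h"
    using sums1 PA
  proof eventually_elim
    case (elim \<omega>)
    have "(\<lambda>i. w i \<omega> * indicator A (\<theta> i \<omega>) - w i \<omega> * h) sums (measure (P \<omega>) A - 1 * h)"
      using elim A by (intro sums_diff sums_mult2) auto
    then show ?case by (simp add: sums_def S_def right_diff_distrib)
  qed
  have [measurable]: "(\<lambda>\<omega>. measure (P \<omega>) A) \<in> borel_measurable M"
    using \<open>P \<in> M \<rightarrow>\<^sub>M prob_algebra borel\<close> by measurable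
  have "emeasure M {\<omega>\<in>space M. e < \<bar>measure (P \<omega>) A - h\<bar>}
      = (\<integral>\<^sup>+\<omega>. indicator {\<omega>\<in>space M. e < \<bar>measure (P \<omega>) A - h\<bar>} \<omega> \<partial>M)"
    by simp
  \<comment> \<open>The strict inequality is an open condition: if it holds for the limit, it holds
    for all large N. Hence the indicator is at most the lower limit of the truncated ones.\<close>
  also have "\<dots> \<le> (\<integral>\<^sup>+\<omega>. liminf (\<lambda>N. indicator {\<omega>\<in>space M. e < \<bar>S N \<omega>\<bar>} \<omega>) \<partial>M)"
  proof (rule nn_integral_mono_AE, use lim in eventually_elim)
    fix \<omega> assume l: "(\<lambda>N. S N \<omega>) \<longlonglongrightarrow> measure (P \<omega>) A - h"
    show "indicator {\<omega>\<in>space M. e < \<bar>measure (P \<omega>) A - h\<bar>} \<omega>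
       \<le> liminf (\<lambda>N. indicator {\<omega>\<in>space M. e < \<bar>S N \<omega>\<bar>} \<omega> :: ennreal)"
    proof (cases "\<omega> \<in> space M \<and> e < \<bar>measure (P \<omega>) A - h\<bar>")
      case True
      have "\<forall>\<^sub>F N in sequentially. e < \<bar>S N \<omega>\<bar>"
        using order_tendstoD(1)[OF tendsto_rabs[OF l]] True by auto
      then have "\<forall>\<^sub>F N in sequentially. 1 \<le> (indicator {\<omega>\<in>space M. e < \<bar>S N \<omega>\<bar>} \<omega> :: ennreal)"
        by eventually_elim (use True in auto)
      then show ?thesis using True by (auto intro: Liminf_bounded)
    qed auto
  qed
  also have "\<dots> \<le> liminf (\<lambda>N. \<integral>\<^sup>+\<omega>. indicator {\<omega>\<in>space M. e < \<bar>S N \<omega>\<bar>} \<omega> \<partial>M)"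
    by (intro nn_integral_liminf) auto
  also have "\<dots> = liminf (\<lambda>N. emeasure M {\<omega>\<in>space M. e < \<bar>S N \<omega>\<bar>})" by simp
  also have "\<dots> \<le> limsup (\<lambda>N. emeasure M {\<omega>\<in>space M. e < \<bar>S N \<omega>\<bar>})" by (intro Liminf_le_Limsup) auto
  also have "\<dots> \<le> ennreal (K * \<delta>)"
    using fin by (intro Limsup_bounded) auto
  finally show ?thesis
    using K \<delta> by (simp add: emeasure_eq_measure h_def K_def)
qed

section \<open>Size-biased moments of the stick-breaking weights\<close>

text \<open>A unit shift of the first parameter multiplies the Beta function by (s + 1 + k) / (s + c
  + 2 + k), at most (k + 2) / c because s \<le> 1. The numerators 2, 3, ... multiply up to the
  factorial.\<close>

lemma Beta_shift_le:
  fixes s c :: real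
  assumes "0 < s" "s \<le> 1" "0 < c"
  shows "Beta (s + 1 + real k) (c + 1) \<le> fact (k + 1) / c ^ k * Beta (s + 1) (c + 1)"
proof (induction k)
  case (Suc k)
  have np: "s + 1 + real k \<notin> \<int>\<^sub>\<le>\<^sub>0" using assms by auto
  have pos: "Beta (s + 1 + real k) (c + 1) > 0"
    using assms by (simp add: Beta_def Gamma_real_pos)
  have "Beta (s + 1 + real (Suc k)) (c + 1) = (s + 1 + real k) / (s + 1 + real k + (c + 1)) * Beta (s + 1 + real k) (c + 1)"
    using Beta_plus1_left[OF np, of "c + 1"] assms by (simp add: field_simps)
  also have "\<dots> \<le> (real k + 2) / c * Beta (s + 1 + real k) (c + 1)"
    using assms pos by (intro mult_right_mono frac_le) auto
  also have "\<dots> \<le> (real k + 2) / c * (fact (k + 1) / c ^ k * Beta (s + 1) (c + 1))"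
    using Suc assms by (intro mult_left_mono) auto
  also have "\<dots> = fact (Suc k + 1) / c ^ Suc k * Beta (s + 1) (c + 1)"
    by (simp add: field_simps)
  finally show ?case .
qed simp

text \<open>Chebyshev's association inequality: relative to \<open>x powr s * (1 - x) powr c\<close> the function
  \<open>\<phi> x / (1 - x) powr c\<close> is decreasing and \<open>x ^ (q - 1)\<close> is increasing. They are compared at the
  point \<open>x0\<close> where \<open>x0 ^ (q - 1)\<close> is the bound for the ratio of Beta moments.\<close>

lemma size_biased_moment_le:
  fixes f \<phi> :: "real \<Rightarrow> real"
  assumes [measurable]: "(\<lambda>x. ennreal (f x)) \<in> borel_measurable borel"
    and s: "0 < s" "s \<le> 1" and c: "0 < c" and q: "q \<ge> 1"
    and out: "\<And>x. x \<notin> {0<..<1} \<Longrightarrow> f x = 0"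
    and f: "\<And>x. x \<in> {0<..<1} \<Longrightarrow> f x = k * (x powr (s - 1) * \<phi> x)"
    and nn: "\<And>x. x \<in> {0<..<1} \<Longrightarrow> 0 \<le> \<phi> x"
    and dec: "\<And>x y. 0 < x \<Longrightarrow> x \<le> y \<Longrightarrow> y < 1 \<Longrightarrow> \<phi> y * (1 - x) powr c \<le> \<phi> x * (1 - y) powr c"
  shows "(\<integral>\<^sup>+x. ennreal (x ^ q) * ennreal (f x) \<partial>lborel)
    \<le> ennreal (fact q / c ^ (q - 1)) * (\<integral>\<^sup>+x. ennreal x * ennreal (f x) \<partial>lborel)"
\<comment> \<open>The constant k collects normalizers whose sign is left open; if it is not
  positive, the density becomes 0 in \<open>ennreal\<close>.\<close>
proof (cases "k \<le> 0")
  case True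
  have "f x \<le> 0" for x
    using True nn[of x] by (cases "x \<in> {0<..<1}") (auto simp: f out mult_nonpos_nonneg)
  then have "ennreal (f x) = 0" for x by (simp add: ennreal_eq_0_iff)
  then show ?thesis by simp
next
  case False
  define \<delta> where "\<delta> = fact q / c ^ (q - 1)"
  have \<delta>0: "\<delta> > 0" using c by (simp add: \<delta>_def)
  have fnn: "f x \<ge> 0" for x
    using False nn[of x] by (cases "x \<in> {0<..<1}") (auto simp: f out)
  show ?thesis
  \<comment> \<open>For \<delta> \<ge> 1 the claim is just x ^ q \<le> x on the unit interval.
    Otherwise q > 1 and the crossing point x0 lies inside (0,1).\<close>
  proof (cases "\<delta> \<ge> 1")
    case True
    have "(\<integral>\<^sup>+x. ennreal (x ^ q) * ennreal (f x) \<partial>lborel) \<le> (\<integral>\<^sup>+x. ennreal x * ennreal (f x) \<partial>lborel)"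
    proof (intro nn_integral_mono)
      fix x :: real
      show "ennreal (x ^ q) * ennreal (f x) \<le> ennreal x * ennreal (f x)"
      proof (cases "x \<in> {0<..<1}")
        case True
        then have "x ^ q \<le> x ^ 1" using q by (intro power_decreasing) auto
        then show ?thesis by (intro mult_right_mono) (auto intro: ennreal_leI)
      qed (simp add: out)
    qed
    also have "\<dots> = 1 * \<dots>" by simp
    also have "\<dots> \<le> ennreal \<delta> * (\<integral>\<^sup>+x. ennreal x * ennreal (f x) \<partial>lborel)"
      using True by (intro mult_right_mono) auto
    finally show ?thesis by (simp add: \<delta>_def)
  next
    case False
    define p where "p = q - 1"
    have p: "p > 0" using False q by (cases "q = 1") (auto simp: \<delta>_def p_def)
    define x0 where "x0 = root p \<delta>"
    have x0: "0 < x0" "x0 < 1" "x0 ^ p = \<delta>"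
      using p \<delta>0 False by (auto simp: x0_def)
    \<comment> \<open>T scales the Beta weight \<open>g\<close> so that it meets the size-biased
      function x * f x at x0; the monotone quotient then decides which of the two is larger on
      either side.\<close>
    define T where "T = k * \<phi> x0 / (1 - x0) powr c"
    have T: "T \<ge> 0" using nn[of x0] x0 \<open>\<not> k \<le> 0\<close> by (simp add: T_def)
    define g where "g = (\<lambda>x::real. indicator {0..1} x * (x powr s * (1 - x) powr c))"
    have [measurable]: "g \<in> borel_measurable borel" by (simp add: g_def)
    have g0: "g x \<ge> 0" for x by (simp add: g_def)
    have beta: "(\<integral>\<^sup>+x. ennreal (x ^ m * g x) \<partial>lborel) = ennreal (Beta (s + 1 + real m) (c + 1))" for m
    proof -
      have "((\<lambda>x. x powr (s + 1 + real m - 1) * (1 - x) powr (c + 1 - 1)) has_integral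
          Beta (s + 1 + real m) (c + 1)) {0..1}"
        using s c by (intro has_integral_Beta_real) auto
      then have "(\<integral>\<^sup>+x. ennreal (indicator {0..1} x * (x powr (s + 1 + real m - 1) * (1 - x) powr (c + 1 - 1))) \<partial>lborel)
          = ennreal (Beta (s + 1 + real m) (c + 1))"
        by (intro nn_integral_has_integral_lebesgue) auto
      moreover have "indicator {0..1} x * (x powr (s + 1 + real m - 1) * (1 - x) powr (c + 1 - 1)) = x ^ m * g x" for x
        using s by (cases "x = 0") (auto simp: g_def indicator_def powr_add powr_realpow)
      ultimately show ?thesis by simp
    qed
    have gfin: "(\<integral>\<^sup>+x. ennreal (g x) \<partial>lborel) = ennreal (Beta (s + 1) (c + 1))"
      using beta[of 0] by simp
    \<comment> \<open>This is (x ^ p - \<delta>) * (T * g x - x * f x) \<ge> 0, where both factors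
      change sign at x0, rearranged without subtraction for extended nonnegative reals.\<close>
    have pt: "ennreal (x ^ q) * ennreal (f x) + ennreal (\<delta> * T) * ennreal (g x)
        \<le> ennreal \<delta> * (ennreal x * ennreal (f x)) + ennreal T * ennreal (x ^ p * g x)" for x
    proof (cases "x \<in> {0<..<1}")
      case True
      define F where "F = x * f x"
      have Feq: "F = k * \<phi> x * x powr s" using True by (simp add: F_def f powr_diff)
      have geq: "g x = (1 - x) powr c * x powr s" using True by (simp add: g_def)
      have "x ^ p * F + \<delta> * (T * g x) \<le> \<delta> * F + x ^ p * (T * g x)"
      proof (cases "x0 \<le> x")
        case c1: True
        have "\<phi> x \<le> \<phi> x0 / (1 - x0) powr c * (1 - x) powr c"
          using dec[of x0 x] x0 c1 True by (simp add: field_simps)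
        then have "k * \<phi> x * x powr s \<le> k * (\<phi> x0 / (1 - x0) powr c * (1 - x) powr c) * x powr s"
          using \<open>\<not> k \<le> 0\<close> by (intro mult_right_mono mult_left_mono) auto
        then have FT: "F \<le> T * g x" by (simp add: Feq geq T_def)
        have "\<delta> \<le> x ^ p" using x0 c1 by (auto simp: x0(3)[symmetric] intro!: power_mono)
        then have "0 \<le> (x ^ p - \<delta>) * (T * g x - F)" using FT by simp
        then show ?thesis by (simp add: algebra_simps)
      next
        case c1: False
        have "\<phi> x \<ge> \<phi> x0 / (1 - x0) powr c * (1 - x) powr c"
          using dec[of x x0] x0 c1 True by (simp add: field_simps)
        then have "k * \<phi> x * x powr s \<ge> k * (\<phi> x0 / (1 - x0) powr c * (1 - x) powr c) * x powr s"
          using \<open>\<not> k \<le> 0\<close> by (intro mult_right_mono mult_left_mono) auto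
        then have FT: "F \<ge> T * g x" by (simp add: Feq geq T_def)
        have "x ^ p \<le> \<delta>" using x0 c1 True by (auto simp: x0(3)[symmetric] intro!: power_mono)
        then have "0 \<le> (\<delta> - x ^ p) * (F - T * g x)" using FT by simp
        then show ?thesis by (simp add: algebra_simps)
      qed
      moreover have "x ^ q = x * x ^ p" using q by (cases q) (auto simp: p_def)
      ultimately have "x ^ q * f x + \<delta> * T * g x \<le> \<delta> * (x * f x) + T * (x ^ p * g x)"
        by (simp add: F_def algebra_simps)
      then have "ennreal (x ^ q * f x + \<delta> * T * g x) \<le> ennreal (\<delta> * (x * f x) + T * (x ^ p * g x))"
        by (rule ennreal_leI)
      then show ?thesis
        using True fnn[of x] g0[of x] T \<delta>0 by (simp add: ennreal_plus ennreal_mult ennreal_mult' mult.assoc)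
    next
      case False
      then have "g x = 0" using s by (cases "x = 0 \<or> x = 1") (auto simp: g_def)
      then show ?thesis using False by (simp add: out)
    qed
    have "(\<integral>\<^sup>+x. ennreal (x ^ q) * ennreal (f x) \<partial>lborel) + ennreal (\<delta> * T) * (\<integral>\<^sup>+x. ennreal (g x) \<partial>lborel)
      = (\<integral>\<^sup>+x. ennreal (x ^ q) * ennreal (f x) + ennreal (\<delta> * T) * ennreal (g x) \<partial>lborel)"
      by (simp add: nn_integral_add nn_integral_cmult)
    also have "\<dots> \<le> (\<integral>\<^sup>+x. ennreal \<delta> * (ennreal x * ennreal (f x)) + ennreal T * ennreal (x ^ p * g x) \<partial>lborel)"
      by (intro nn_integral_mono pt)
    also have "\<dots> = ennreal \<delta> * (\<integral>\<^sup>+x. ennreal x * ennreal (f x) \<partial>lborel) + ennreal T * ennreal (Beta (s + 1 + real p) (c + 1))"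
      by (simp add: nn_integral_add nn_integral_cmult beta)
    also have "\<dots> \<le> ennreal \<delta> * (\<integral>\<^sup>+x. ennreal x * ennreal (f x) \<partial>lborel) + ennreal T * ennreal (\<delta> * Beta (s + 1) (c + 1))"
      using Beta_shift_le[OF s c, of p] q
      by (intro add_left_mono mult_left_mono ennreal_leI) (auto simp: \<delta>_def p_def)
    also have "ennreal T * ennreal (\<delta> * Beta (s + 1) (c + 1)) = ennreal (\<delta> * T) * (\<integral>\<^sup>+x. ennreal (g x) \<partial>lborel)"
      using T \<delta>0 by (simp add: gfin ennreal_mult' mult_ac)
    finally have "ennreal (\<delta> * T) * (\<integral>\<^sup>+x. ennreal (g x) \<partial>lborel) + (\<integral>\<^sup>+x. ennreal (x ^ q) * ennreal (f x) \<partial>lborel)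
      \<le> ennreal (\<delta> * T) * (\<integral>\<^sup>+x. ennreal (g x) \<partial>lborel) + ennreal \<delta> * (\<integral>\<^sup>+x. ennreal x * ennreal (f x) \<partial>lborel)"
      by (simp add: add.commute)
    moreover have "ennreal (\<delta> * T) * (\<integral>\<^sup>+x. ennreal (g x) \<partial>lborel) \<noteq> top"
      by (simp add: gfin ennreal_mult_eq_top_iff)
    ultimately show ?thesis by (simp add: ennreal_add_left_cancel_le \<delta>_def)
  qed
qed

section \<open>Moments of a weight times the remaining stick\<close>

text \<open>The weight \<open>v i\<close> is independent of the remaining stick, so both sides
  factor and share the expectation of the q-th power of that stick.\<close>

lemma (in prob_space) indep_stick_moments:
  fixes v :: "nat \<Rightarrow> 'a \<Rightarrow> real"
  assumes ind: "indep_vars (\<lambda>_. borel) v UNIV"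
    and v: "\<And>i \<omega>. \<omega> \<in> space M \<Longrightarrow> v i \<omega> \<in> {0..1}"
    and le: "\<And>i. (\<integral>\<^sup>+\<omega>. ennreal (v i \<omega> ^ q) \<partial>M) \<le> ennreal \<delta> * (\<integral>\<^sup>+\<omega>. ennreal (v i \<omega>) \<partial>M)"
  shows "stick_moment_bound M v q \<delta>"
  unfolding stick_moment_bound_def
proof
  fix i
  have [measurable]: "v i \<in> borel_measurable M" for i using ind by (auto simp: indep_vars_def)
  have factor: "(\<integral>\<^sup>+\<omega>. \<phi> (v i \<omega>) * ennreal ((\<Prod>j<i. 1 - v j \<omega>) ^ q) \<partial>M)
      = (\<integral>\<^sup>+\<omega>. \<phi> (v i \<omega>) \<partial>M) * (\<Prod>j<i. \<integral>\<^sup>+\<omega>. ennreal ((1 - v j \<omega>) ^ q) \<partial>M)"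
    if [measurable]: "\<phi> \<in> borel_measurable borel" for \<phi> :: "real \<Rightarrow> ennreal"
  proof -
    define Y where "Y = (\<lambda>j x. if j = (i::nat) then \<phi> x else ennreal ((1 - x) ^ q))"
    have prod': "(\<Prod>j\<in>{..i}. G j (Y j)) = G i \<phi> * (\<Prod>j<i. G j (\<lambda>x. ennreal ((1 - x) ^ q)))" for G :: "nat \<Rightarrow> _ \<Rightarrow> ennreal"
    proof -
      have "(\<Prod>j\<in>insert i {..<i}. G j (Y j)) = G i (Y i) * (\<Prod>j\<in>{..<i}. G j (Y j))" by (rule prod.insert) auto
      also have "(\<Prod>j\<in>{..<i}. G j (Y j)) = (\<Prod>j<i. G j (\<lambda>x. ennreal ((1 - x) ^ q)))"
        by (intro prod.cong) (auto simp: Y_def)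
      also have "Y i = \<phi>" by (simp add: Y_def)
      also have "insert i {..<i} = {..i}" by auto
      finally show ?thesis .
    qed
    have "(\<integral>\<^sup>+\<omega>. \<phi> (v i \<omega>) * ennreal ((\<Prod>j<i. 1 - v j \<omega>) ^ q) \<partial>M) = (\<integral>\<^sup>+\<omega>. (\<Prod>j\<in>{..i}. Y j (v j \<omega>)) \<partial>M)"
    proof (intro nn_integral_cong)
      fix \<omega> assume "\<omega> \<in> space M"
      then have "0 \<le> 1 - v j \<omega>" for j using v[of \<omega> j] by simp
      then have "ennreal ((\<Prod>j<i. 1 - v j \<omega>) ^ q) = (\<Prod>j<i. ennreal ((1 - v j \<omega>) ^ q))"
        by (simp add: prod_ennreal prod_power_distrib)
      then show "\<phi> (v i \<omega>) * ennreal ((\<Prod>j<i. 1 - v j \<omega>) ^ q) = (\<Prod>j\<in>{..i}. Y j (v j \<omega>))"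
        using prod'[of "\<lambda>j g. g (v j \<omega>)"] by simp
    qed
    also have "\<dots> = (\<Prod>j\<in>{..i}. \<integral>\<^sup>+\<omega>. Y j (v j \<omega>) \<partial>M)"
    proof (rule indep_vars_nn_integral)
      show "indep_vars (\<lambda>_. borel) (\<lambda>j \<omega>. Y j (v j \<omega>)) {..i}"
        by (rule indep_vars_compose2[OF indep_vars_subset[OF ind]]) (auto simp: Y_def)
    qed auto
    also have "\<dots> = (\<integral>\<^sup>+\<omega>. \<phi> (v i \<omega>) \<partial>M) * (\<Prod>j<i. \<integral>\<^sup>+\<omega>. ennreal ((1 - v j \<omega>) ^ q) \<partial>M)"
      by (rule prod'[of "\<lambda>j g. \<integral>\<^sup>+\<omega>. g (v j \<omega>) \<partial>M"])
    finally show ?thesis .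
  qed
  have "(\<integral>\<^sup>+\<omega>. ennreal (v i \<omega> ^ q) * ennreal ((\<Prod>j<i. 1 - v j \<omega>) ^ q) \<partial>M)
      \<le> (ennreal \<delta> * (\<integral>\<^sup>+\<omega>. ennreal (v i \<omega>) \<partial>M)) * (\<Prod>j<i. \<integral>\<^sup>+\<omega>. ennreal ((1 - v j \<omega>) ^ q) \<partial>M)"
    using factor[of "\<lambda>x. ennreal (x ^ q)"] le by (auto intro!: mult_right_mono)
  also have "\<dots> = ennreal \<delta> * (\<integral>\<^sup>+\<omega>. ennreal (v i \<omega>) * ennreal ((\<Prod>j<i. 1 - v j \<omega>) ^ q) \<partial>M)"
    using factor[of ennreal] by (simp add: mult.assoc)
  finally show "(\<integral>\<^sup>+\<omega>. ennreal (v i \<omega> ^ q) * ennreal ((\<Prod>j<i. 1 - v j \<omega>) ^ q) \<partial>M)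
    \<le> ennreal \<delta> * (\<integral>\<^sup>+\<omega>. ennreal (v i \<omega>) * ennreal ((\<Prod>j<i. 1 - v j \<omega>) ^ q) \<partial>M)" .
qed

text \<open>The definition of a conditional density speaks of events of \<open>Y\<close> only.
  Weighting \<open>M\<close> by \<open>G (X \<omega>)\<close>, the law of \<open>Y\<close> under the
  weighted measure turns out to have the density \<open>D\<close>, and equality of measures yields
  every integrand \<open>h\<close> at once.\<close>

lemma (in prob_space) nn_integral_cond_density:
  assumes cd: "has_cond_density M N X Y f"
    and [measurable]: "G \<in> borel_measurable N" "h \<in> borel_measurable borel"
  shows "(\<integral>\<^sup>+\<omega>. h (Y \<omega>) * G (X \<omega>) \<partial>M)
    = (\<integral>\<^sup>+\<omega>. (\<integral>\<^sup>+y. h y * ennreal (f (X \<omega>) y) \<partial>lborel) * G (X \<omega>) \<partial>M)"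
proof -
  from cd have [measurable]: "X \<in> M \<rightarrow>\<^sub>M N" "Y \<in> borel_measurable M"
    "(\<lambda>(x, y). f x y) \<in> borel_measurable (N \<Otimes>\<^sub>M borel)"
    by (auto simp: has_cond_density_def)
  define F where "F = vimage_algebra (space M) X N"
  have "subalgebra M F"
    unfolding subalgebra_def F_def
    by (auto simp: sets_vimage_algebra2[OF measurable_space[OF \<open>X \<in> M \<rightarrow>\<^sub>M N\<close>, THEN funcsetI]])
  then interpret F: finite_measure_subalgebra M F by unfold_locales
  interpret pair_sigma_finite M "lborel :: real measure" by unfold_locales
  have [measurable]: "(\<lambda>\<omega>. G (X \<omega>)) \<in> borel_measurable F"
    unfolding F_def
    by (rule measurable_compose[OF measurable_vimage_algebra1 assms(2)]) (simp add: measurable_space[OF \<open>X \<in> M \<rightarrow>\<^sub>M N\<close>])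
  have [measurable]: "(\<lambda>p. f (X (fst p)) (snd p)) \<in> borel_measurable (M \<Otimes>\<^sub>M lborel)"
  proof -
    have "(\<lambda>p. (\<lambda>(x, y). f x y) (X (fst p), snd p)) \<in> borel_measurable (M \<Otimes>\<^sub>M lborel)"
      by (rule measurable_compose[OF _ \<open>(\<lambda>(x, y). f x y) \<in> _\<close>]) measurable
    then show ?thesis by simp
  qed
  define D where "D = (\<lambda>y. \<integral>\<^sup>+\<omega>. G (X \<omega>) * ennreal (f (X \<omega>) y) \<partial>M)"
  have [measurable]: "(\<lambda>p. f (X (snd p)) (fst p)) \<in> borel_measurable (lborel \<Otimes>\<^sub>M M)"
  proof -
    have "(\<lambda>p. (\<lambda>(x, y). f x y) (X (snd p), fst p)) \<in> borel_measurable (lborel \<Otimes>\<^sub>M M)"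
      by (rule measurable_compose[OF _ \<open>(\<lambda>(x, y). f x y) \<in> _\<close>]) measurable
    then show ?thesis by simp
  qed
  have "D \<in> borel_measurable lborel" unfolding D_def by measurable
  then have [measurable]: "D \<in> borel_measurable borel" by simp
  have swap: "(\<integral>\<^sup>+y. u y * D y \<partial>lborel) = (\<integral>\<^sup>+\<omega>. (\<integral>\<^sup>+y. u y * ennreal (f (X \<omega>) y) \<partial>lborel) * G (X \<omega>) \<partial>M)"
    if [measurable]: "u \<in> borel_measurable borel" for u :: "real \<Rightarrow> ennreal"
  proof -
    have "(\<integral>\<^sup>+y. u y * D y \<partial>lborel) = (\<integral>\<^sup>+y. (\<integral>\<^sup>+\<omega>. u y * (G (X \<omega>) * ennreal (f (X \<omega>) y)) \<partial>M) \<partial>lborel)"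
      unfolding D_def by (intro nn_integral_cong nn_integral_cmult[symmetric]) measurable
    also have "\<dots> = (\<integral>\<^sup>+\<omega>. (\<integral>\<^sup>+y. u y * (G (X \<omega>) * ennreal (f (X \<omega>) y)) \<partial>lborel) \<partial>M)"
      by (rule Fubini') simp
    also have "\<dots> = (\<integral>\<^sup>+\<omega>. (\<integral>\<^sup>+y. u y * ennreal (f (X \<omega>) y) \<partial>lborel) * G (X \<omega>) \<partial>M)"
    proof (intro nn_integral_cong)
      fix \<omega> assume \<omega>[measurable]: "\<omega> \<in> space M"
      have [measurable]: "f (X \<omega>) \<in> borel_measurable lborel"
        using measurable_Pair2[OF \<open>(\<lambda>p. f (X (fst p)) (snd p)) \<in> _\<close> \<omega>] by simp
      show "(\<integral>\<^sup>+y. u y * (G (X \<omega>) * ennreal (f (X \<omega>) y)) \<partial>lborel) = (\<integral>\<^sup>+y. u y * ennreal (f (X \<omega>) y) \<partial>lborel) * G (X \<omega>)"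
        by (subst nn_integral_multc[symmetric]) (auto simp: mult_ac)
    qed
    finally show ?thesis .
  qed
  have "distr (density M (\<lambda>\<omega>. G (X \<omega>))) borel Y = density lborel D"
  proof (rule measure_eqI)
    fix B assume "B \<in> sets (distr (density M (\<lambda>\<omega>. G (X \<omega>))) borel Y)"
    then have B[measurable]: "B \<in> sets borel" by simp
    have "emeasure (distr (density M (\<lambda>\<omega>. G (X \<omega>))) borel Y) B
        = (\<integral>\<^sup>+\<omega>. G (X \<omega>) * indicator (Y -` B \<inter> space M) \<omega> \<partial>M)"
      by (simp add: emeasure_distr emeasure_density)
    also have "\<dots> = (\<integral>\<^sup>+\<omega>. G (X \<omega>) * indicator B (Y \<omega>) \<partial>M)"
      by (intro nn_integral_cong) (auto simp: indicator_def)
    \<comment> \<open>\<open>G (X \<omega>)\<close> is measurable for the sigma-algebra generated by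
      \<open>X\<close>, so the indicator may be replaced by its conditional expectation.\<close>
    also have "\<dots> = (\<integral>\<^sup>+\<omega>. G (X \<omega>) * nn_cond_exp M F (\<lambda>\<omega>. indicator B (Y \<omega>)) \<omega> \<partial>M)"
      by (intro F.nn_cond_exp_intg[symmetric]) measurable
    also have "\<dots> = (\<integral>\<^sup>+\<omega>. G (X \<omega>) * (\<integral>\<^sup>+y\<in>B. ennreal (f (X \<omega>) y) \<partial>lborel) \<partial>M)"
    proof (rule nn_integral_cong_AE)
      have "AE \<omega> in M. nn_cond_exp M F (\<lambda>\<omega>'. indicator B (Y \<omega>')) \<omega> = (\<integral>\<^sup>+y\<in>B. ennreal (f (X \<omega>) y) \<partial>lborel)"
        using cd B by (auto simp: has_cond_density_def F_def)
      then show "AE \<omega> in M. G (X \<omega>) * nn_cond_exp M F (\<lambda>\<omega>'. indicator B (Y \<omega>')) \<omega>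
         = G (X \<omega>) * (\<integral>\<^sup>+y\<in>B. ennreal (f (X \<omega>) y) \<partial>lborel)"
        by eventually_elim simp
    qed
    also have "\<dots> = (\<integral>\<^sup>+y. indicator B y * D y \<partial>lborel)"
      by (subst swap) (auto simp: mult_ac)
    also have "\<dots> = emeasure (density lborel D) B"
      by (simp add: emeasure_density mult_ac)
    finally show "emeasure (distr (density M (\<lambda>\<omega>. G (X \<omega>))) borel Y) B = emeasure (density lborel D) B" .
  qed simp
  then have "(\<integral>\<^sup>+y. h y \<partial>distr (density M (\<lambda>\<omega>. G (X \<omega>))) borel Y) = (\<integral>\<^sup>+y. h y \<partial>density lborel D)" by simp
  then have "(\<integral>\<^sup>+\<omega>. G (X \<omega>) * h (Y \<omega>) \<partial>M) = (\<integral>\<^sup>+y. D y * h y \<partial>lborel)"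
    by (simp add: nn_integral_distr nn_integral_density)
  then show ?thesis using swap[of h] by (simp add: mult.commute)
qed

text \<open>Given the earlier weights the remaining stick is a constant, so a comparison for the
  conditional density can be integrated against its q-th power. The measurability premises inside
  \<open>le1\<close> and \<open>le\<close> hand over what the assumed densities contain to the
  verification for the explicit formulas.\<close>

lemma (in prob_space) sequential_stick_moments:
  fixes v :: "nat \<Rightarrow> 'a \<Rightarrow> real"
  assumes wd: "weights_have_densities M v f1 f"
    and v: "\<And>i \<omega>. \<omega> \<in> space M \<Longrightarrow> v i \<omega> \<in> {0..1}"
    and le1: "(\<lambda>x. ennreal (f1 x)) \<in> borel_measurable borel \<Longrightarrow> (\<integral>\<^sup>+x. ennreal (x ^ q) * ennreal (f1 x) \<partial>lborel)
      \<le> ennreal \<delta> * (\<integral>\<^sup>+x. ennreal x * ennreal (f1 x) \<partial>lborel)"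
    and le: "\<And>m y. 1 \<le> m \<Longrightarrow> (\<And>j. j < m \<Longrightarrow> 0 \<le> y j \<and> y j < 1) \<Longrightarrow> f (Suc m) y \<in> borel_measurable borel \<Longrightarrow>
       (\<integral>\<^sup>+x. ennreal (x ^ q) * ennreal (f (Suc m) y x) \<partial>lborel)
      \<le> ennreal \<delta> * (\<integral>\<^sup>+x. ennreal x * ennreal (f (Suc m) y x) \<partial>lborel)"
    and q: "q \<ge> 1"
  shows "stick_moment_bound M v q \<delta>"
  unfolding stick_moment_bound_def
proof
  fix i
  show "(\<integral>\<^sup>+\<omega>. ennreal (v i \<omega> ^ q) * ennreal ((\<Prod>j<i. 1 - v j \<omega>) ^ q) \<partial>M)
    \<le> ennreal \<delta> * (\<integral>\<^sup>+\<omega>. ennreal (v i \<omega>) * ennreal ((\<Prod>j<i. 1 - v j \<omega>) ^ q) \<partial>M)"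
  proof (cases "i = 0")
  case True
  have d: "distributed M lborel (v 0) (\<lambda>x. ennreal (f1 x))"
    using wd by (simp add: weights_have_densities_def)
  show ?thesis
    using le1 distributed_borel_measurable[OF d] distributed_nn_integral[OF d, of "\<lambda>x. ennreal (x ^ q)"] distributed_nn_integral[OF d, of ennreal] True
    by (simp add: mult.commute)
next
  case False
  then have i: "1 \<le> i" by simp
  define N where "N = (\<Pi>\<^sub>M j\<in>{..<i}. borel :: real measure)"
  define X where "X = (\<lambda>\<omega>. \<lambda>j\<in>{..<i}. v j \<omega>)"
  have cd: "has_cond_density M N X (v i) (f (Suc i))"
    using wd i by (auto simp: weights_have_densities_def N_def X_def)
  then have [measurable]: "X \<in> M \<rightarrow>\<^sub>M N" "v i \<in> borel_measurable M"
    "(\<lambda>(x, y). f (Suc i) x y) \<in> borel_measurable (N \<Otimes>\<^sub>M borel)"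
    by (auto simp: has_cond_density_def)
  define G where "G = (\<lambda>x. ennreal ((\<Prod>j<i. 1 - x j :: real) ^ q))"
  have [measurable]: "G \<in> borel_measurable N" by (simp add: G_def N_def)
  have GX: "G (X \<omega>) = ennreal ((\<Prod>j<i. 1 - v j \<omega>) ^ q)" for \<omega>
    by (simp add: G_def X_def)
  have fm: "f (Suc i) (X \<omega>) \<in> borel_measurable borel" if "\<omega> \<in> space M" for \<omega>
    using measurable_Pair2[OF \<open>(\<lambda>(x, y). f (Suc i) x y) \<in> _\<close> measurable_space[OF \<open>X \<in> _\<close> that]] by simp
  have pm: "(\<lambda>\<omega>. \<integral>\<^sup>+y. ennreal y * ennreal (f (Suc i) (X \<omega>) y) \<partial>lborel) \<in> borel_measurable M"
  proof -
    have "(\<lambda>p. (\<lambda>(x, y). f (Suc i) x y) (X (fst p), snd p)) \<in> borel_measurable (M \<Otimes>\<^sub>M lborel)"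
      by (rule measurable_compose[OF _ \<open>(\<lambda>(x, y). f (Suc i) x y) \<in> _\<close>]) measurable
    then have [measurable]: "(\<lambda>p. f (Suc i) (X (fst p)) (snd p)) \<in> borel_measurable (M \<Otimes>\<^sub>M lborel)" by simp
    show ?thesis by measurable
  qed
  have "(\<integral>\<^sup>+\<omega>. ennreal (v i \<omega> ^ q) * ennreal ((\<Prod>j<i. 1 - v j \<omega>) ^ q) \<partial>M)
    = (\<integral>\<^sup>+\<omega>. (\<integral>\<^sup>+y. ennreal (y ^ q) * ennreal (f (Suc i) (X \<omega>) y) \<partial>lborel) * G (X \<omega>) \<partial>M)"
    unfolding GX[symmetric]
    by (rule nn_integral_cond_density[OF cd, where h = "\<lambda>x. ennreal (x ^ q)"]) auto
  also have "\<dots> \<le> (\<integral>\<^sup>+\<omega>. ennreal \<delta> * ((\<integral>\<^sup>+y. ennreal y * ennreal (f (Suc i) (X \<omega>) y) \<partial>lborel) * G (X \<omega>)) \<partial>M)"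
  proof (intro nn_integral_mono)
    fix \<omega> assume \<omega>: "\<omega> \<in> space M"
    show "(\<integral>\<^sup>+y. ennreal (y ^ q) * ennreal (f (Suc i) (X \<omega>) y) \<partial>lborel) * G (X \<omega>)
      \<le> ennreal \<delta> * ((\<integral>\<^sup>+y. ennreal y * ennreal (f (Suc i) (X \<omega>) y) \<partial>lborel) * G (X \<omega>))"
    \<comment> \<open>Where an earlier weight equals 1 the explicit density degenerates, but there
      the remaining stick is 0 and so is its q-th power, as q \<ge> 1.\<close>
    proof (cases "\<exists>j<i. v j \<omega> = 1")
      case True
      then have z: "(\<Prod>j<i. 1 - v j \<omega>) = 0" by (intro prod_zero) auto
      have "G (X \<omega>) = 0" unfolding GX z using q by (simp add: power_0_left)
      then show ?thesis by simp
    next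
      case False
      then have "0 \<le> X \<omega> j \<and> X \<omega> j < 1" if "j < i" for j
        using that v[OF \<omega>, of j] by (auto simp: X_def less_le)
      from le[OF i this fm[OF \<omega>]] show ?thesis
        by (auto simp: mult.assoc[symmetric] intro!: mult_right_mono)
    qed
  qed
  also have "\<dots> = ennreal \<delta> * (\<integral>\<^sup>+\<omega>. (\<integral>\<^sup>+y. ennreal y * ennreal (f (Suc i) (X \<omega>) y) \<partial>lborel) * G (X \<omega>) \<partial>M)"
    using pm by (intro nn_integral_cmult) measurable
  also have "(\<integral>\<^sup>+\<omega>. (\<integral>\<^sup>+y. ennreal y * ennreal (f (Suc i) (X \<omega>) y) \<partial>lborel) * G (X \<omega>) \<partial>M)
     = (\<integral>\<^sup>+\<omega>. ennreal (v i \<omega>) * ennreal ((\<Prod>j<i. 1 - v j \<omega>) ^ q) \<partial>M)"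
    unfolding GX[symmetric]
    by (rule nn_integral_cond_density[OF cd, where h = ennreal, symmetric]) auto
  finally show ?thesis .
qed
qed

section \<open>Polynomial tail rates along a = n powr \<tau>\<close>

lemma (in prob_space) AE_tendsto_of_tail_rates:
  fixes X :: "nat \<Rightarrow> 'a \<Rightarrow> real"
  assumes X: "\<And>n. n \<ge> 1 \<Longrightarrow> X n \<in> borel_measurable M" and "\<tau> > 0" "\<gamma> > 0"
    and tail: "\<And>e q. e > 0 \<Longrightarrow> q \<ge> 1 \<Longrightarrow> \<exists>K. \<forall>\<^sub>F n in sequentially.
      prob {\<omega>\<in>space M. e < \<bar>X n \<omega> - c\<bar>} \<le> K * (real n powr \<tau>) powr (- \<gamma> * real (q - 1))"
  shows "AE \<omega> in M. (\<lambda>n. X n \<omega>) \<longlonglongrightarrow> c"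
proof -
  \<comment> \<open>The shift by one skips the index 0, where \<open>X\<close> is not known to be
    measurable.\<close>
  have "AE \<omega> in M. (\<lambda>n. X (Suc n) \<omega>) \<longlonglongrightarrow> c"
  proof (rule AE_tendsto_if_summable_tails)
    fix e :: real assume e: "e > 0"
    \<comment> \<open>This q makes \<tau> * \<gamma> * (q - 1) at least 2, so that the tails are
      dominated by a multiple of n powr (-2).\<close>
    define q where "q = nat \<lceil>2 / (\<tau> * \<gamma>)\<rceil> + 1"
    have r: "2 / (\<tau> * \<gamma>) \<le> real (q - 1)" unfolding q_def by simp linarith
    have "2 = 2 / (\<tau> * \<gamma>) * (\<tau> * \<gamma>)" using assms(2,3) by simp
    also have "\<dots> \<le> real (q - 1) * (\<tau> * \<gamma>)" by (rule mult_right_mono[OF r]) (use assms(2,3) in auto)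
    finally have q2: "2 \<le> \<tau> * \<gamma> * real (q - 1)" by (simp only: mult_ac)
    obtain K where K: "\<forall>\<^sub>F n in sequentially.
      prob {\<omega>\<in>space M. e < \<bar>X n \<omega> - c\<bar>} \<le> K * (real n powr \<tau>) powr (- \<gamma> * real (q - 1))"
      using tail[OF e, of q] by (auto simp: q_def)
    have "summable (\<lambda>n. prob {\<omega>\<in>space M. e < \<bar>X n \<omega> - c\<bar>})"
    proof (rule summable_comparison_test_ev)
      show "\<forall>\<^sub>F n in sequentially. norm (prob {\<omega>\<in>space M. e < \<bar>X n \<omega> - c\<bar>}) \<le> \<bar>K\<bar> * real n powr (-2)"
        using K eventually_ge_at_top[of 1]
      proof eventually_elim
        case (elim n)
        have "K * (real n powr \<tau>) powr (- \<gamma> * real (q - 1)) \<le> \<bar>K\<bar> * real n powr (- (\<tau> * \<gamma> * real (q - 1)))"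
          by (auto simp: powr_powr mult.assoc intro!: mult_right_mono)
        also have "\<dots> \<le> \<bar>K\<bar> * real n powr (-2)"
          by (intro mult_left_mono powr_mono; (use q2 in linarith)?) (use elim in auto)
        finally show ?case using elim by simp
      qed
      show "summable (\<lambda>n. \<bar>K\<bar> * real n powr (-2))"
        by (intro summable_mult) (simp add: summable_real_powr_iff)
    qed
    then show "summable (\<lambda>n. prob {\<omega>\<in>space M. e < \<bar>X (Suc n) \<omega> - c\<bar>})"
      by (subst summable_Suc_iff)
  qed (use X in auto)
  then show ?thesis by eventually_elim (rule LIMSEQ_imp_Suc)
qed

lemma (in prob_space) stick_breaking_AE_tendsto:
  fixes H :: "'x::topological_space measure" and P :: "nat \<Rightarrow> 'a \<Rightarrow> 'x measure"
  assumes "A \<in> sets borel" and "\<tau> > 0" "\<gamma> > 0"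
    and sb: "\<And>q. q \<ge> 1 \<Longrightarrow> \<exists>C\<ge>0. \<forall>\<^sub>F n in sequentially. \<exists>v. stick_breaking M H v (P n) \<and>
      stick_moment_bound M v q (C * (real n powr \<tau>) powr (- \<gamma> * real (q - 1)))"
    and rpm: "\<And>n. n \<ge> 1 \<Longrightarrow> random_prob_measure M (P n)"
  shows "AE \<omega> in M. (\<lambda>n. measure (P n \<omega>) A) \<longlonglongrightarrow> measure H A"
proof (rule AE_tendsto_of_tail_rates[OF _ assms(2,3)])
  fix n :: nat assume "n \<ge> 1"
  from rpm[OF this] have [measurable]: "P n \<in> M \<rightarrow>\<^sub>M prob_algebra borel" by (simp add: random_prob_measure_def)
  note [measurable] = assms(1)
  show "(\<lambda>\<omega>. measure (P n \<omega>) A) \<in> borel_measurable M" by measurable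
next
  fix e :: real and q :: nat assume e: "e > 0" and q: "q \<ge> 1"
  obtain C where C: "C \<ge> 0" and ev: "\<forall>\<^sub>F n in sequentially. \<exists>v. stick_breaking M H v (P n) \<and>
      stick_moment_bound M v q (C * (real n powr \<tau>) powr (- \<gamma> * real (q - 1)))"
    using sb[OF q] by auto
  show "\<exists>K. \<forall>\<^sub>F n in sequentially. prob {\<omega>\<in>space M. e < \<bar>measure (P n \<omega>) A - measure H A\<bar>}
      \<le> K * (real n powr \<tau>) powr (- \<gamma> * real (q - 1))"
  proof (rule exI[of _ "2 * fact q / (2 * e\<^sup>2) ^ q * C"], use ev in eventually_elim)
    fix n assume "\<exists>v. stick_breaking M H v (P n) \<and>
      stick_moment_bound M v q (C * (real n powr \<tau>) powr (- \<gamma> * real (q - 1)))"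
    then obtain v where "stick_breaking M H v (P n)"
      "stick_moment_bound M v q (C * (real n powr \<tau>) powr (- \<gamma> * real (q - 1)))" by auto
    from stick_breaking_tail_bound[OF this(1) assms(1) e q _ this(2)] C
    show "prob {\<omega>\<in>space M. e < \<bar>measure (P n \<omega>) A - measure H A\<bar>}
      \<le> 2 * fact q / (2 * e\<^sup>2) ^ q * C * (real n powr \<tau>) powr (- \<gamma> * real (q - 1))"
      by (simp add: mult.assoc)
  qed
qed

lemma stick_moment_bound_mono:
  "stick_moment_bound M v q \<delta> \<Longrightarrow> \<delta> \<le> \<delta>' \<Longrightarrow> stick_moment_bound M v q \<delta>'"
  unfolding stick_moment_bound_def
  by (meson order_trans mult_right_mono ennreal_leI zero_le)

text \<open>Four of the families share the bound with c = \<kappa> * a - 1, the exponent of the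
  comparison Beta law: \<kappa> is 1 for the Dirichlet and Poisson-Dirichlet processes, 1/2 for the
  inverse Gaussian one and \<sigma> for the generalized gamma one.\<close>

lemma (in prob_space) beta_type_sticks_AE_tendsto:
  fixes H :: "'x::topological_space measure" and P :: "nat \<Rightarrow> 'a \<Rightarrow> 'x measure"
  assumes A: "A \<in> sets borel" and \<tau>: "\<tau> > 0" and \<kappa>: "\<kappa> > 0"
    and sb: "\<And>n. n \<ge> 1 \<Longrightarrow> \<exists>v. stick_breaking M H v (P n) \<and> (\<forall>q\<ge>1. \<kappa> * real n powr \<tau> > 1 \<longrightarrow>
      stick_moment_bound M v q (fact q / (\<kappa> * real n powr \<tau> - 1) ^ (q - 1)))"
  shows "AE \<omega> in M. (\<lambda>n. measure (P n \<omega>) A) \<longlonglongrightarrow> measure H A"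
proof (rule stick_breaking_AE_tendsto[OF A \<tau> zero_less_one])
  fix q :: nat assume q: "q \<ge> 1"
  have "filterlim (\<lambda>n. real n powr \<tau>) at_top sequentially"
    using \<tau> by (intro filterlim_compose[OF real_powr_at_top filterlim_real_sequentially]) auto
  then have "\<forall>\<^sub>F n in sequentially. 2 / \<kappa> \<le> real n powr \<tau>" by (simp add: filterlim_at_top)
  then have "\<forall>\<^sub>F n in sequentially. \<exists>v. stick_breaking M H v (P n) \<and>
      stick_moment_bound M v q (fact q * (2 / \<kappa>) ^ (q - 1) * (real n powr \<tau>) powr (- 1 * real (q - 1)))"
    using eventually_ge_at_top[of 1]
  proof eventually_elim
    case (elim n)
    define a where "a = real n powr \<tau>"
    have a: "a > 0" "\<kappa> * a \<ge> 2" using elim \<kappa> by (auto simp: a_def field_simps)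
    obtain v where v: "stick_breaking M H v (P n)"
      "stick_moment_bound M v q (fact q / (\<kappa> * a - 1) ^ (q - 1))"
      using sb[OF elim(2)] q a by (force simp: a_def)
    \<comment> \<open>Since \<kappa> * a \<ge> 2, half of \<kappa> * a absorbs the subtracted
      1.\<close>
    have "fact q / (\<kappa> * a - 1) ^ (q - 1) \<le> fact q / (\<kappa> * a / 2) ^ (q - 1)"
      using a \<kappa> by (intro divide_left_mono power_mono mult_pos_pos zero_less_power) auto
    also have "\<dots> = fact q * (2 / \<kappa>) ^ (q - 1) * a powr (- 1 * real (q - 1))"
      using a by (simp add: powr_minus powr_realpow power_divide power_mult_distrib field_simps)
    finally show ?case
      unfolding a_def[symmetric] by (intro exI[of _ v] conjI v(1) stick_moment_bound_mono[OF v(2)])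
  qed
  then show "\<exists>C\<ge>0. \<forall>\<^sub>F n in sequentially. \<exists>v. stick_breaking M H v (P n) \<and>
      stick_moment_bound M v q (C * (real n powr \<tau>) powr (- 1 * real (q - 1)))"
    using \<kappa> by (intro exI[of _ "fact q * (2 / \<kappa>) ^ (q - 1)"]) auto
next
  fix n :: nat assume "n \<ge> 1"
  from sb[OF this] show "random_prob_measure M (P n)" by (auto simp: stick_breaking_def)
qed

section \<open>Independent weights: Beta laws and general laws\<close>

text \<open>The factor (1 - x) powr (a + (i + 1) * b - 1) divided by (1 - x) powr (a - 1) is
  decreasing, so c = a - 1 serves all i at once. The value b = 0 gives the Dirichlet
  process.\<close>

lemma (in prob_space) beta_stick_moment_bound:
  assumes ind: "indep_vars (\<lambda>_. borel) v UNIV"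
    and v01: "\<And>i \<omega>. \<omega> \<in> space M \<Longrightarrow> v i \<omega> \<in> {0..1}"
    and d: "\<And>i. distributed M lborel (v i) (\<lambda>x. ennreal (beta_density (1 - b) (a + real (Suc i) * b) x))"
    and ab: "0 \<le> b" "b < 1" "1 < a" and q: "q \<ge> 1"
  shows "stick_moment_bound M v q (fact q / (a - 1) ^ (q - 1))"
proof (rule indep_stick_moments[OF ind v01])
  fix i
  define f where "f = beta_density (1 - b) (a + real (Suc i) * b)"
  define \<phi> where "\<phi> = (\<lambda>x::real. (1 - x) powr (a + real (Suc i) * b - 1))"
  have [measurable]: "f \<in> borel_measurable borel"
    unfolding f_def beta_density_def[abs_def] by measurable
  have "(\<integral>\<^sup>+x. ennreal (x ^ q) * ennreal (f x) \<partial>lborel)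
    \<le> ennreal (fact q / (a - 1) ^ (q - 1)) * (\<integral>\<^sup>+x. ennreal x * ennreal (f x) \<partial>lborel)"
  proof (rule size_biased_moment_le[where s = "1 - b" and \<phi> = \<phi> and k = "1 / Beta (1 - b) (a + real (Suc i) * b)"])
    fix x y :: real assume xy: "0 < x" "x \<le> y" "y < 1"
    have e: "\<phi> x = (1 - x) powr (a - 1) * (1 - x) powr (real (Suc i) * b)" for x
      by (simp add: \<phi>_def powr_add[symmetric] algebra_simps)
    have "(1 - y) powr (real (Suc i) * b) \<le> (1 - x) powr (real (Suc i) * b)"
      using xy ab by (intro powr_mono2) auto
    then have "(1 - x) powr (a - 1) * (1 - y) powr (a - 1) * (1 - y) powr (real (Suc i) * b)
       \<le> (1 - x) powr (a - 1) * (1 - y) powr (a - 1) * (1 - x) powr (real (Suc i) * b)"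
      by (intro mult_left_mono) auto
    then show "\<phi> y * (1 - x) powr (a - 1) \<le> \<phi> x * (1 - y) powr (a - 1)"
      unfolding e by (simp only: mult_ac)
  qed (use ab q in \<open>auto simp: f_def beta_density_def \<phi>_def\<close>)
  then show "(\<integral>\<^sup>+\<omega>. ennreal (v i \<omega> ^ q) \<partial>M)
      \<le> ennreal (fact q / (a - 1) ^ (q - 1)) * (\<integral>\<^sup>+\<omega>. ennreal (v i \<omega>) \<partial>M)"
    using distributed_nn_integral[OF d[of i], of "\<lambda>x. ennreal (x ^ q)"] distributed_nn_integral[OF d[of i], of ennreal]
    by (simp add: f_def mult.commute)
qed

lemma (in prob_space) DP_AE_tendsto:
  assumes "A \<in> sets borel" "\<tau> > 0" "\<And>n. n \<ge> 1 \<Longrightarrow> is_DP M (real n powr \<tau>) H (P n)"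
  shows "AE \<omega> in M. (\<lambda>n. measure (P n \<omega>) A) \<longlonglongrightarrow> measure H A"
proof (rule beta_type_sticks_AE_tendsto[OF assms(1,2), of 1])
  fix n :: nat assume "n \<ge> 1"
  from assms(3)[OF this] obtain v where v: "stick_breaking M H v (P n)"
     "indep_vars (\<lambda>_. borel) v UNIV"
     "\<And>i. distributed M lborel (v i) (\<lambda>x. ennreal (beta_density 1 (real n powr \<tau>) x))"
    by (auto simp: is_DP_def)
  have v01: "\<omega> \<in> space M \<Longrightarrow> v i \<omega> \<in> {0..1}" for i \<omega> using v(1) unfolding stick_breaking_def by blast
  have "stick_moment_bound M v q (fact q / (1 * real n powr \<tau> - 1) ^ (q - 1))"
    if "1 * real n powr \<tau> > 1" "q \<ge> 1" for q
    using beta_stick_moment_bound[OF v(2) v01, of 0 "real n powr \<tau>" q] v(3) that by simp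
  then show "\<exists>v. stick_breaking M H v (P n) \<and> (\<forall>q\<ge>1. 1 * real n powr \<tau> > 1 \<longrightarrow>
      stick_moment_bound M v q (fact q / (1 * real n powr \<tau> - 1) ^ (q - 1)))"
    using v(1) by blast
qed auto

lemma (in prob_space) PDP_AE_tendsto:
  assumes "A \<in> sets borel" "\<tau> > 0" "\<And>n. n \<ge> 1 \<Longrightarrow> is_PDP M (real n powr \<tau>) b H (P n)"
  shows "AE \<omega> in M. (\<lambda>n. measure (P n \<omega>) A) \<longlonglongrightarrow> measure H A"
proof (rule beta_type_sticks_AE_tendsto[OF assms(1,2), of 1])
  fix n :: nat assume "n \<ge> 1"
  from assms(3)[OF this] obtain v where b: "0 < b" "b < 1" and v: "stick_breaking M H v (P n)"
     "indep_vars (\<lambda>_. borel) v UNIV"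
     "\<And>i. distributed M lborel (v i) (\<lambda>x. ennreal (beta_density (1 - b) (real n powr \<tau> + real (Suc i) * b) x))"
    by (auto simp: is_PDP_def)
  have v01: "\<omega> \<in> space M \<Longrightarrow> v i \<omega> \<in> {0..1}" for i \<omega> using v(1) unfolding stick_breaking_def by blast
  have "stick_moment_bound M v q (fact q / (1 * real n powr \<tau> - 1) ^ (q - 1))"
    if "1 * real n powr \<tau> > 1" "q \<ge> 1" for q
    using beta_stick_moment_bound[OF v(2) v01, of b "real n powr \<tau>" q] v(3) that b by simp
  then show "\<exists>v. stick_breaking M H v (P n) \<and> (\<forall>q\<ge>1. 1 * real n powr \<tau> > 1 \<longrightarrow>
      stick_moment_bound M v q (fact q / (1 * real n powr \<tau> - 1) ^ (q - 1)))"
    using v(1) by blast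
qed auto

text \<open>By (M) the quotient of the q-th and the first moment is of order a powr (k 1 - k q), and
  the growth condition with j = 1 gives k q \<ge> q * k 1. Hence the rate is \<gamma> = k 1 per unit
  of q - 1.\<close>

lemma (in prob_space) DPG_AE_tendsto:
  assumes A: "A \<in> sets borel" and \<tau>: "\<tau> > 0" and mom: "moment_assumption g"
    and dpg: "\<And>n. n \<ge> 1 \<Longrightarrow> is_DPG M (g (real n powr \<tau>)) H (P n)"
  shows "AE \<omega> in M. (\<lambda>n. measure (P n \<omega>) A) \<longlonglongrightarrow> measure H A"
proof -
  define m where "m = (\<lambda>p a. \<integral>x. x ^ p \<partial>g a)"
  from mom obtain k C where kC: "\<And>p. p \<ge> 1 \<Longrightarrow> k p > 0 \<and> C p \<noteq> (0::real)"
    and k: "\<And>i j. 1 \<le> j \<Longrightarrow> j \<le> i \<Longrightarrow> real j * k i \<ge> real i * k j"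
    and o: "\<And>p. p \<ge> 1 \<Longrightarrow> (\<lambda>a. m p a - C p / a powr k p) \<in> o[at_top](\<lambda>a. 1 / a powr k p)"
    unfolding moment_assumption_def m_def by blast
  have g: "prob_space (g a)" "sets (g a) = sets borel" "emeasure (g a) {0<..<1} = 1" if "a > 0" for a
    using mom that by (auto simp: moment_assumption_def)
  have AE01: "AE x in g a. x \<in> {0<..<1}" if "a > 0" for a
  proof -
    interpret G: prob_space "g a" by (rule g) fact
    have "G.prob {0<..<1} = 1" using g(3)[OF that] by (simp add: G.emeasure_eq_measure)
    then show ?thesis using g(2)[OF that] by (subst (asm) G.prob_eq_1) auto
  qed
  have integ: "integrable (g a) (\<lambda>x. x ^ p)" if "a > 0" for a p
  proof -
    interpret G: prob_space "g a" by (rule g) fact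
    show ?thesis
    proof (rule G.integrable_const_bound[of _ 1])
      show "AE x in g a. norm (x ^ p) \<le> 1"
        using AE01[OF that] by eventually_elim (auto simp: power_le_one)
    qed (use g(2)[OF that] in \<open>simp cong: measurable_cong_sets\<close>)
  qed
  have m_nn: "m p a \<ge> 0" if "a > 0" for p a
    unfolding m_def by (rule integral_nonneg_AE) (use AE01[OF that] in \<open>eventually_elim; auto\<close>)
  have lim: "((\<lambda>a. m p a * a powr k p) \<longlongrightarrow> C p) at_top" if "p \<ge> 1" for p
  proof -
    have "((\<lambda>a. (m p a - C p / a powr k p) / (1 / a powr k p)) \<longlongrightarrow> 0) at_top"
      using o[OF that] by (intro smalloD_tendsto) auto
    then have "((\<lambda>a. m p a * a powr k p - C p) \<longlongrightarrow> 0) at_top"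
    proof (rule Lim_transform_eventually)
      show "\<forall>\<^sub>F a in at_top. (m p a - C p / a powr k p) / (1 / a powr k p) = m p a * a powr k p - C p"
        using eventually_gt_at_top[of 0] by eventually_elim (simp add: field_simps)
    qed
    then show ?thesis by (simp add: LIM_zero_iff)
  qed
  \<comment> \<open>The first moment has to be bounded from below, so its limit constant must be
    positive: it is a limit of nonnegative numbers and nonzero by (M).\<close>
  have C1: "C 1 > 0"
  proof -
    have "C 1 \<ge> 0"
    proof (rule tendsto_lowerbound[OF lim])
      show "\<forall>\<^sub>F a in at_top. 0 \<le> m 1 a * a powr k 1"
        using eventually_gt_at_top[of 0] by eventually_elim (simp add: m_nn)
    qed auto
    then show ?thesis using kC[of 1] by simp
  qed
  have k1: "k 1 > 0" using kC by simp
  show ?thesis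
  proof (rule stick_breaking_AE_tendsto[OF A \<tau> k1])
    fix q :: nat assume q: "q \<ge> 1"
    \<comment> \<open>D is an eventual upper bound for the normalized q-th moment over an eventual
      lower bound for the normalized first one.\<close>
    define D where "D = (\<bar>C q\<bar> + 1) / (C 1 / 2)"
    have D: "D \<ge> 0" using C1 by (simp add: D_def)
    have "\<forall>\<^sub>F a in at_top. m q a * a powr k q < \<bar>C q\<bar> + 1"
      using lim[OF q] by (rule order_tendstoD) simp
    moreover have "\<forall>\<^sub>F a in at_top. C 1 / 2 < m 1 a * a powr k 1"
      using C1 by (intro order_tendstoD(1)[OF lim]) auto
    ultimately have "\<forall>\<^sub>F a in at_top. m q a \<le> D * a powr (- k 1 * real (q - 1)) * m 1 a"
      using eventually_ge_at_top[of 1]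
    proof eventually_elim
      case (elim a)
      have "m q a \<le> (\<bar>C q\<bar> + 1) * a powr (- k q)"
        using elim by (simp add: powr_minus field_simps)
      also have "\<dots> \<le> (\<bar>C q\<bar> + 1) * a powr (- real q * k 1)"
        using elim k[of 1 q] q by (intro mult_left_mono powr_mono) auto
      also have "\<dots> = D * a powr (- k 1 * real (q - 1)) * (C 1 / 2 * a powr (- k 1))"
      proof -
        have "a powr (- real q * k 1) = a powr (- k 1 * real (q - 1)) * a powr (- k 1)"
          using q by (simp add: powr_add[symmetric] of_nat_diff algebra_simps)
        then show ?thesis using C1 by (simp add: D_def)
      qed
      also have "\<dots> \<le> D * a powr (- k 1 * real (q - 1)) * m 1 a"
        using elim D by (intro mult_left_mono) (auto simp: powr_minus field_simps)
      finally show ?case .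
    qed
    moreover have "filterlim (\<lambda>n. real n powr \<tau>) at_top sequentially"
      using \<tau> by (intro filterlim_compose[OF real_powr_at_top filterlim_real_sequentially]) auto
    ultimately have "\<forall>\<^sub>F n in sequentially. m q (real n powr \<tau>) \<le> D * (real n powr \<tau>) powr (- k 1 * real (q - 1)) * m 1 (real n powr \<tau>)"
      by (rule eventually_compose_filterlim)
    then have "\<forall>\<^sub>F n in sequentially. \<exists>v. stick_breaking M H v (P n) \<and>
      stick_moment_bound M v q (D * (real n powr \<tau>) powr (- k 1 * real (q - 1)))"
      using eventually_ge_at_top[of 1]
    proof eventually_elim
      case (elim n)
      define a where "a = real n powr \<tau>"
      have a: "a > 0" using elim by (simp add: a_def)
      from dpg[OF elim(2)] obtain v where v: "stick_breaking M H v (P n)"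
        "indep_vars (\<lambda>_. borel) v UNIV" "\<And>i. distr M borel (v i) = g a"
        by (auto simp: is_DPG_def a_def)
      have v01: "\<omega> \<in> space M \<Longrightarrow> v i \<omega> \<in> {0..1}" for i \<omega> using v(1) unfolding stick_breaking_def by blast
      have [measurable]: "v i \<in> borel_measurable M" for i using v(2) by (auto simp: indep_vars_def)
      have mv: "(\<integral>\<^sup>+\<omega>. ennreal (v i \<omega> ^ p) \<partial>M) = ennreal (m p a)" for i p
      proof -
        have "(\<integral>\<^sup>+\<omega>. ennreal (v i \<omega> ^ p) \<partial>M) = (\<integral>\<^sup>+x. ennreal (x ^ p) \<partial>g a)"
          by (simp add: v(3)[of i, symmetric] nn_integral_distr)
        also have "\<dots> = ennreal (m p a)" unfolding m_def
          by (rule nn_integral_eq_integral[OF integ[OF a]]) (use AE01[OF a] in \<open>eventually_elim; auto\<close>)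
        finally show ?thesis .
      qed
      have "stick_moment_bound M v q (D * a powr (- k 1 * real (q - 1)))"
      proof (rule indep_stick_moments[OF v(2) v01])
        fix i
        have "ennreal (m q a) \<le> ennreal (D * a powr (- k 1 * real (q - 1)) * m 1 a)"
          using elim by (auto simp: a_def intro!: ennreal_leI)
        then show "(\<integral>\<^sup>+\<omega>. ennreal (v i \<omega> ^ q) \<partial>M)
          \<le> ennreal (D * a powr (- k 1 * real (q - 1))) * (\<integral>\<^sup>+\<omega>. ennreal (v i \<omega>) \<partial>M)"
          using mv[of i q] mv[of i 1] D m_nn[OF a, of 1] by (simp add: ennreal_mult)
      qed
      then show ?case using v(1) by (auto simp: a_def)
    qed
    then show "\<exists>C\<ge>0. \<forall>\<^sub>F n in sequentially. \<exists>v. stick_breaking M H v (P n) \<and>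
      stick_moment_bound M v q (C * (real n powr \<tau>) powr (- k 1 * real (q - 1)))"
      using D by blast
  next
    fix n :: nat assume "n \<ge> 1"
    from dpg[OF this] show "random_prob_measure M (P n)" by (auto simp: is_DPG_def stick_breaking_def)
  qed
qed

section \<open>The normalized inverse Gaussian process\<close>

text \<open>With u standing for 1 - x, the logarithmic derivative of u powr (m - c) * exp (- z * u
  powr (- s) * h) is (m - c + s * z * h * u powr (- s)) / u, nonnegative since u \<le> 1, h \<ge> 1
  and c \<le> s * z + m. The proof uses the integrated form of this, with exp y \<ge> 1 + y at y = s
  * l.\<close>

lemma kernel_power_exp_mono:
  fixes u u' :: real
  assumes u: "0 < u" "u \<le> u'" "u' \<le> 1" and s: "0 < s" and z: "0 < z" and h: "1 \<le> h" and c: "c \<le> s * z + m"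
  shows "u powr m * exp (- (z * u powr (- s)) * h) * u' powr c \<le> u' powr m * exp (- (z * u' powr (- s)) * h) * u powr c"
proof -
  define l where "l = ln u' - ln u"
  have l: "l \<ge> 0" using u by (simp add: l_def)
  have "(c - m) * l \<le> s * z * l" using c l by (intro mult_right_mono) auto
  also have "\<dots> = z * (s * l)" by simp
  also have "\<dots> \<le> z * (exp (s * l) - 1)"
  proof -
    have "s * l \<le> exp (s * l) - 1" using exp_ge_add_one_self[of "s * l"] by linarith
    then show ?thesis using z by simp
  qed
  also have "\<dots> \<le> z * (u' powr (- s) * (exp (s * l) - 1))"
  proof -
    have "1 powr (- s) \<le> u' powr (- s)" using u s by (intro powr_mono2') auto
    then have "1 * (exp (s * l) - 1) \<le> u' powr (- s) * (exp (s * l) - 1)"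
      using l s by (intro mult_right_mono) auto
    then show ?thesis using z by simp
  qed
  also have "u' powr (- s) * (exp (s * l) - 1) = u powr (- s) - u' powr (- s)"
  proof -
    have "u' powr (- s) * exp (s * l) = u powr (- s)"
      using u by (simp add: powr_def l_def mult_exp_exp right_diff_distrib)
    then show ?thesis by (simp add: right_diff_distrib)
  qed
  also have "z * (u powr (- s) - u' powr (- s)) \<le> z * (u powr (- s) - u' powr (- s)) * h"
  proof -
    have "u powr (- s) \<ge> u' powr (- s)" using u s by (intro powr_mono2') auto
    then have "z * (u powr (- s) - u' powr (- s)) * 1 \<le> z * (u powr (- s) - u' powr (- s)) * h"
      using z h by (intro mult_left_mono) auto
    then show ?thesis by simp
  qed
  finally have "m * ln u - (z * u powr (- s)) * h + c * ln u' \<le> m * ln u' - (z * u' powr (- s)) * h + c * ln u"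
    by (simp add: l_def algebra_simps)
  then have "exp (m * ln u - (z * u powr (- s)) * h + c * ln u') \<le> exp (m * ln u' - (z * u' powr (- s)) * h + c * ln u)"
    by simp
  moreover have "v powr m * exp (- (z * v powr (- s)) * h) * v' powr c = exp (m * ln v - (z * v powr (- s)) * h + c * ln v')"
    if "0 < v" "0 < v'" for v v'
    using that by (simp add: powr_def[of v m] powr_def[of v' c] mult_exp_exp)
  ultimately show ?thesis using u by simp
qed

text \<open>The inequality for each fixed t survives mixing over t with the nonnegative k.
  Integrability is asked for at every rate because the two sides use different ones.\<close>

lemma kernel_integral_mono:
  fixes x y :: real
  assumes xy: "0 < x" "x \<le> y" "y < 1" and s: "0 < s" and z: "0 < z" and c: "c \<le> s * z + m"
    and h: "\<And>t. t \<in> S \<Longrightarrow> 1 \<le> h t" and k: "\<And>t. t \<in> S \<Longrightarrow> 0 \<le> k t"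
    and int: "\<And>z. z > 0 \<Longrightarrow> set_integrable lborel S (\<lambda>t. exp (- z * h t) * k t)"
  shows "(1 - y) powr m * (LBINT t:S. exp (- (z * (1 - y) powr (- s)) * h t) * k t) * (1 - x) powr c
    \<le> (1 - x) powr m * (LBINT t:S. exp (- (z * (1 - x) powr (- s)) * h t) * k t) * (1 - y) powr c"
proof -
  have i: "set_integrable lborel S (\<lambda>t. exp (- (z * (1 - x) powr (- s)) * h t) * k t)" if "x < 1" for x
    using int[of "z * (1 - x) powr (- s)"] z that by simp
  have "(LBINT t:S. (1 - y) powr m * (1 - x) powr c * (exp (- (z * (1 - y) powr (- s)) * h t) * k t))
    \<le> (LBINT t:S. (1 - x) powr m * (1 - y) powr c * (exp (- (z * (1 - x) powr (- s)) * h t) * k t))"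
  proof (rule set_integral_mono)
    fix t assume t: "t \<in> S"
    have "(1 - y) powr m * exp (- (z * (1 - y) powr (- s)) * h t) * (1 - x) powr c * k t
      \<le> (1 - x) powr m * exp (- (z * (1 - x) powr (- s)) * h t) * (1 - y) powr c * k t"
      using xy s z c h[OF t] k[OF t] by (intro mult_right_mono kernel_power_exp_mono) auto
    then show "(1 - y) powr m * (1 - x) powr c * (exp (- (z * (1 - y) powr (- s)) * h t) * k t)
      \<le> (1 - x) powr m * (1 - y) powr c * (exp (- (z * (1 - x) powr (- s)) * h t) * k t)"
      by (simp only: mult_ac)
  qed (use xy i in auto)
  then show ?thesis unfolding set_integral_mult_right by (simp only: mult_ac)
qed

text \<open>The substitution t = z * (w - b) leads back to the gamma integral. For p < 1 there is a
  singularity at b, which the majorant of the generalized gamma kernel uses.\<close>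

lemma set_integrable_exp_powr:
  fixes p z :: real
  assumes p: "p > 0" and z: "z > 0"
  shows "set_integrable lborel {b<..} (\<lambda>w. (w - b) powr (p - 1) * exp (- z * w))"
proof -
  define F where "F = (\<lambda>t::real. indicator {0..} t * t powr (p - 1) / exp t)"
  have "integrable lborel F"
  proof (rule integrableI_nonneg)
    show "(\<integral>\<^sup>+t. ennreal (F t) \<partial>lborel) < \<infinity>"
      by (simp add: F_def Gamma_conv_nn_integral_real[OF p, symmetric])
  qed (auto simp: F_def)
  then have "integrable lborel (\<lambda>w. F (- z * b + z * w))"
    using z by (subst lborel_integrable_real_affine_iff) auto
  then have "integrable lborel (\<lambda>w. F (- z * b + z * w) * (z powr (1 - p) * exp (- z * b)))"
    by (rule integrable_mult_left)
  also have "(\<lambda>w. F (- z * b + z * w) * (z powr (1 - p) * exp (- z * b)))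
      = (\<lambda>w. indicator {b<..} w *\<^sub>R ((w - b) powr (p - 1) * exp (- z * w)))"
  proof
    fix w
    have e: "- z * b + z * w = z * (w - b)" by (simp add: algebra_simps)
    have "- z * w = - z * b - z * (w - b)" by (simp add: algebra_simps)
    then have ex: "exp (- z * w) = exp (- z * b) / exp (z * (w - b))" by (simp only: exp_diff)
    have zz: "z powr (p - 1) * z powr (1 - p) = 1" using z by (simp add: powr_add[symmetric])
    show "F (- z * b + z * w) * (z powr (1 - p) * exp (- z * b)) = indicator {b<..} w *\<^sub>R ((w - b) powr (p - 1) * exp (- z * w))"
    proof (cases "b < w")
      case True
      have "F (z * (w - b)) * (z powr (1 - p) * exp (- z * b))
          = (z powr (p - 1) * z powr (1 - p)) * ((w - b) powr (p - 1) * (exp (- z * b) / exp (z * (w - b))))"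
        using True z by (simp add: F_def powr_mult zero_le_mult_iff)
      then show ?thesis using True unfolding e ex zz by simp
    next
      case False
      then have "F (z * (w - b)) = 0"
        using z by (cases "w = b") (auto simp: F_def zero_le_mult_iff)
      then show ?thesis using False unfolding e by simp
    qed
  qed
  finally show ?thesis unfolding set_integrable_def .
qed

text \<open>Since cosh t \<ge> t^2 / 4, the first factor decays like a Gaussian and beats the growth
  exp (|\<nu>| * t) of the second.\<close>

lemma set_integrable_bessel:
  fixes \<nu> z :: real
  assumes z: "z > 0"
  shows "set_integrable lborel {0<..} (\<lambda>t. exp (- z * cosh t) * cosh (\<nu> * t))"
proof (rule set_integrable_bound)
  \<comment> \<open>Completing the square with |\<nu>| + 1 rather than |\<nu>| leaves a spare exp (-
    t) for the majorant.\<close>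
  define b where "b = \<bar>\<nu>\<bar> + 1"
  show "set_integrable lborel {0<..} (\<lambda>t. exp (b\<^sup>2 / z) * ((t - 0) powr (1 - 1) * exp (- 1 * t)))"
    by (intro set_integrable_mult_right) (use set_integrable_exp_powr[of 1 1 0] in simp)
  show "set_borel_measurable lborel {0<..} (\<lambda>t. exp (- z * cosh t) * cosh (\<nu> * t))"
    unfolding set_borel_measurable_def cosh_def by measurable
  have "norm (exp (- z * cosh t) * cosh (\<nu> * t)) \<le> norm (exp (b\<^sup>2 / z) * ((t - 0) powr (1 - 1) * exp (- 1 * t)))"
    if t: "t > 0" for t
  proof -
    have "t\<^sup>2 / 4 \<le> cosh t"
    proof -
      have "1 + t + t\<^sup>2 / 2 \<le> exp t" using t by (intro exp_lower_Taylor_quadratic) auto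
      then have "t\<^sup>2 / 2 \<le> exp t" using t by linarith
      moreover have "exp t / 2 \<le> cosh t" by (simp add: cosh_def)
      ultimately show ?thesis by linarith
    qed
    then have "- z * cosh t \<le> - z * (t\<^sup>2 / 4)" using z by (simp add: mult_le_cancel_left)
    moreover have "cosh (\<nu> * t) \<le> exp (\<bar>\<nu>\<bar> * t)"
    proof -
      have "exp (\<nu> * t) \<le> exp (\<bar>\<nu>\<bar> * t)" "exp (- (\<nu> * t)) \<le> exp (\<bar>\<nu>\<bar> * t)"
        using t by (auto simp: abs_if mult_le_cancel_right)
      then have "(exp (\<nu> * t) + exp (- (\<nu> * t))) / 2 \<le> (exp (\<bar>\<nu>\<bar> * t) + exp (\<bar>\<nu>\<bar> * t)) / 2"
        by (intro divide_right_mono add_mono) auto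
      moreover have c: "cosh (\<nu> * t) = (exp (\<nu> * t) + exp (- (\<nu> * t))) / 2" by (simp add: cosh_def)
      ultimately show ?thesis unfolding c by simp
    qed
    ultimately have "exp (- z * cosh t) * cosh (\<nu> * t) \<le> exp (- z * (t\<^sup>2 / 4)) * exp (\<bar>\<nu>\<bar> * t)"
      by (intro mult_mono) auto
    also have "\<dots> = exp (- z * (t\<^sup>2 / 4) + \<bar>\<nu>\<bar> * t)" by (rule exp_add[symmetric])
    also have "- z * (t\<^sup>2 / 4) + \<bar>\<nu>\<bar> * t \<le> b\<^sup>2 / z - t"
    proof -
      have "0 \<le> (b - z * t / 2)\<^sup>2 / z" using z by simp
      also have "\<dots> = b\<^sup>2 / z - b * t + z * (t\<^sup>2 / 4)"
        using z by (simp add: power2_eq_square field_simps)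
      finally show ?thesis by (simp add: b_def algebra_simps)
    qed
    finally have "exp (- z * cosh t) * cosh (\<nu> * t) \<le> exp (b\<^sup>2 / z) * exp (- t)"
      by (simp add: mult_exp_exp)
    then show ?thesis using t by (simp add: abs_mult cosh_real_nonneg)
  qed
  then show "AE t in lborel. t \<in> {0<..} \<longrightarrow> norm (exp (- z * cosh t) * cosh (\<nu> * t))
     \<le> norm (exp (b\<^sup>2 / z) * ((t - 0) powr (1 - 1) * exp (- 1 * t)))" by auto
qed

lemma powr_neg_half: "0 \<le> x \<Longrightarrow> x powr (- (1/2)) = 1 / sqrt x" for x :: real
  using powr_minus_divide[of x "1/2"] by (simp add: powr_half_sqrt)

lemma bessel_K_nonneg: "0 \<le> bessel_K \<nu> x"
  unfolding bessel_K_def set_lebesgue_integral_def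
  by (intro integral_nonneg_AE) (auto simp: cosh_real_nonneg)

text \<open>In the integral representation of the Bessel function the kernel has h = cosh \<ge> 1
  and s = 1/2, so c = a / 2 - 1 is admissible, being at most z / 2 + m. The factor x powr (- 1/2)
  separately gives the Beta parameter 1/2.\<close>

lemma NIG_kernel_moment_le:
  fixes f :: "real \<Rightarrow> real"
  assumes m: "(\<lambda>x. ennreal (f x)) \<in> borel_measurable borel"
    and f: "\<And>x. f x = indicator {0<..<1} x * (k * x powr (-1/2) * ((1 - x) powr m * bessel_K \<nu> (z * (1 - x) powr (- 1/2))))"
    and z: "a \<le> z" "2 < a" and m1: "-1 \<le> m" and q: "q \<ge> 1"
  shows "(\<integral>\<^sup>+x. ennreal (x ^ q) * ennreal (f x) \<partial>lborel)
    \<le> ennreal (fact q / (1/2 * a - 1) ^ (q - 1)) * (\<integral>\<^sup>+x. ennreal x * ennreal (f x) \<partial>lborel)"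
proof (rule size_biased_moment_le[where s = "1/2" and k = k and
      \<phi> = "\<lambda>x. (1 - x) powr m * bessel_K \<nu> (z * (1 - x) powr (- 1/2))", OF m])
  fix x y :: real assume xy: "0 < x" "x \<le> y" "y < 1"
  show "(1 - y) powr m * bessel_K \<nu> (z * (1 - y) powr (- 1/2)) * (1 - x) powr (1/2 * a - 1)
    \<le> (1 - x) powr m * bessel_K \<nu> (z * (1 - x) powr (- 1/2)) * (1 - y) powr (1/2 * a - 1)"
    using kernel_integral_mono[OF xy, of "1/2" z "1/2 * a - 1" m "{0<..}" cosh "\<lambda>t. cosh (\<nu> * t)"] z m1
      set_integrable_bessel[of _ \<nu>]
    by (simp add: bessel_K_def cosh_real_ge_1 cosh_real_nonneg)
qed (use z q in \<open>auto simp: f bessel_K_nonneg\<close>)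

lemma (in prob_space) NIGP_AE_tendsto:
  assumes "A \<in> sets borel" "\<tau> > 0" "\<And>n. n \<ge> 1 \<Longrightarrow> is_NIGP M (real n powr \<tau>) H (P n)"
  shows "AE \<omega> in M. (\<lambda>n. measure (P n \<omega>) A) \<longlonglongrightarrow> measure H A"
proof (rule beta_type_sticks_AE_tendsto[OF assms(1,2), of "1/2"])
  fix n :: nat assume "n \<ge> 1"
  define a where "a = real n powr \<tau>"
  from assms(3)[OF \<open>n \<ge> 1\<close>] obtain v where v: "stick_breaking M H v (P n)"
     "weights_have_densities M v (NIG_density1 a) (NIG_density a)"
    by (auto simp: is_NIGP_def a_def)
  have v01: "\<omega> \<in> space M \<Longrightarrow> v i \<omega> \<in> {0..1}" for i \<omega> using v(1) unfolding stick_breaking_def by blast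
  have "stick_moment_bound M v q (fact q / (1/2 * a - 1) ^ (q - 1))"
    if a: "1/2 * a > 1" and q: "q \<ge> 1" for q
  proof (rule sequential_stick_moments[OF v(2) v01])
    assume m: "(\<lambda>x. ennreal (NIG_density1 a x)) \<in> borel_measurable borel"
    show "(\<integral>\<^sup>+x. ennreal (x ^ q) * ennreal (NIG_density1 a x) \<partial>lborel)
      \<le> ennreal (fact q / (1/2 * a - 1) ^ (q - 1)) * (\<integral>\<^sup>+x. ennreal x * ennreal (NIG_density1 a x) \<partial>lborel)"
    \<comment> \<open>The first weight has the extreme admissible exponent m = -1, which decides the
      constant c; the later exponents are larger.\<close>
    proof (rule NIG_kernel_moment_le[OF m, where z = a and m = "-1" and \<nu> = "-1" and
        k = "a powr (1/2) / ((2 * pi) powr (1/2) * bessel_K (-1/2) a)"])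
      fix x
      have e: "a / sqrt (1 - x) = a * (1 - x) powr (- 1/2)" if "x \<in> {0<..<1}"
        using that by (simp add: powr_neg_half)
      show "NIG_density1 a x = indicator {0<..<1} x * (a powr (1/2) / ((2 * pi) powr (1/2) * bessel_K (-1/2) a) *
        x powr (-1/2) * ((1 - x) powr (-1) * bessel_K (-1) (a * (1 - x) powr (- 1/2))))"
        using e by (cases "x \<in> {0<..<1}") (auto simp: NIG_density1_def)
    qed (use a q in auto)
  next
    fix m and y :: "nat \<Rightarrow> real"
    assume m: "1 \<le> m" and y: "\<And>j. j < m \<Longrightarrow> 0 \<le> y j \<and> y j < 1"
      and meas: "NIG_density a (Suc m) y \<in> borel_measurable borel"
    define pr where "pr = (\<Prod>i<m. 1 - y i)"
    have pr: "0 < pr" "pr \<le> 1" using y unfolding pr_def by (auto intro!: prod_pos prod_le_1 simp: less_imp_le)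
    \<comment> \<open>Dividing by the square root of the remaining stick, which is at most 1, only
      increases the rate; hence the bound is uniform in the earlier weights.\<close>
    define z where "z = a / sqrt pr"
    have z: "a \<le> z" using pr a by (simp add: z_def field_simps)
    have m1: "- 1 \<le> - 5/4 + real (Suc m) / 4" by (simp add: field_simps)
    \<comment> \<open>All factors free of x, including the Bessel normalizer, go into k.\<close>
    define k where "k = a powr (1/2) * (\<Prod>i<m. (1 - y i) powr (-1/4)) /
      ((2 * pi) powr (1/2) * bessel_K (- real (Suc m) / 2) (a / sqrt pr))"
    show "(\<integral>\<^sup>+x. ennreal (x ^ q) * ennreal (NIG_density a (Suc m) y x) \<partial>lborel)
      \<le> ennreal (fact q / (1/2 * a - 1) ^ (q - 1)) * (\<integral>\<^sup>+x. ennreal x * ennreal (NIG_density a (Suc m) y x) \<partial>lborel)"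
    proof (rule NIG_kernel_moment_le[where z = z and m = "-5/4 + real (Suc m) / 4" and \<nu> = "-1/2 - real (Suc m) / 2" and k = k])
      fix x
      have e: "a / sqrt ((1 - x) * pr) = z * (1 - x) powr (- 1/2)" if "x \<in> {0<..<1}"
        using that pr by (simp add: z_def powr_neg_half real_sqrt_mult)
      show "NIG_density a (Suc m) y x = indicator {0<..<1} x * (k * x powr (-1/2) * ((1 - x) powr (-5/4 + real (Suc m) / 4) *
          bessel_K (-1/2 - real (Suc m) / 2) (z * (1 - x) powr (- 1/2))))"
        using e by (cases "x \<in> {0<..<1}") (simp_all add: NIG_density_def k_def pr_def[symmetric])
    qed (use m1 a q z meas in auto)
  qed (use q in auto)
  then show "\<exists>v. stick_breaking M H v (P n) \<and> (\<forall>q\<ge>1. 1/2 * real n powr \<tau> > 1 \<longrightarrow>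
      stick_moment_bound M v q (fact q / (1/2 * real n powr \<tau> - 1) ^ (q - 1)))"
    using v(1) unfolding a_def by blast
qed auto

section \<open>The normalized generalized gamma process\<close>

text \<open>Substituting u = z * w makes the domain independent of z and isolates the power of z, so
  that a series of such terms can be summed under one integral sign.\<close>

lemma upper_Gamma_scale:
  assumes z: "z > 0"
  shows "upper_Gamma c z = z powr c * (LBINT w:{1<..}. w powr (c - 1) * exp (- z * w))"
proof -
  have "upper_Gamma c z = (\<integral>u. indicator {z<..} u *\<^sub>R (u powr (c - 1) * exp (- u)) \<partial>lborel)"
    by (simp add: upper_Gamma_def set_lebesgue_integral_def)
  also have "\<dots> = \<bar>z\<bar> *\<^sub>R (\<integral>w. indicator {z<..} (0 + z * w) *\<^sub>R ((0 + z * w) powr (c - 1) * exp (- (0 + z * w))) \<partial>lborel)"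
    using z by (intro lborel_integral_real_affine) auto
  also have "(\<lambda>w. indicator {z<..} (0 + z * w) *\<^sub>R ((0 + z * w) powr (c - 1) * exp (- (0 + z * w))))
    = (\<lambda>w. z powr (c - 1) * (indicator {1<..} w *\<^sub>R (w powr (c - 1) * exp (- z * w))))"
    using z by (auto simp: fun_eq_iff indicator_def powr_mult)
  also have "\<bar>z\<bar> *\<^sub>R (\<integral>w. z powr (c - 1) * (indicator {1<..} w *\<^sub>R (w powr (c - 1) * exp (- z * w))) \<partial>lborel)
    = (z * z powr (c - 1)) * (LBINT w:{1<..}. w powr (c - 1) * exp (- z * w))"
    using z by (simp add: set_lebesgue_integral_def)
  also have "z * z powr (c - 1) = z powr c" using z by (simp add: powr_diff)
  finally show ?thesis .
qed

text \<open>This is the binomial series: the j-th coefficient is (-1)^j times the generalized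
  binomial coefficient of p - 1 over j.\<close>

lemma pochhammer_binomial_sums:
  fixes y p :: real
  assumes "0 \<le> y" "y < 1"
  shows "(\<lambda>j. pochhammer (1 - p) j / fact j * y ^ j) sums (1 - y) powr (p - 1)"
proof -
  have "(\<lambda>j. ((p - 1) gchoose j) * (- y) ^ j) sums (1 + (- y)) powr (p - 1)"
    using assms by (intro gen_binomial_real) auto
  moreover have "((p - 1) gchoose j) * (- y) ^ j = pochhammer (1 - p) j / fact j * y ^ j" for j
  proof -
    have "(- 1) ^ j * (- y) ^ j = y ^ j" by (simp add: power_mult_distrib[symmetric])
    then show ?thesis by (simp add: gbinomial_pochhammer)
  qed
  ultimately show ?thesis by simp
qed

text \<open>From some index on the coefficients have constant sign, so that up to finitely many terms
  the absolute series agrees with the series itself or with its negative.\<close>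

lemma pochhammer_binomial_abs_bound:
  fixes p :: real
  obtains C where "C \<ge> 0"
    "\<And>J y. 0 \<le> y \<Longrightarrow> y < 1 \<Longrightarrow>
      (\<Sum>j<J. \<bar>pochhammer (1 - p) j / fact j\<bar> * y ^ j) \<le> C + (1 - y) powr (p - 1)"
proof
  define c where "c = (\<lambda>j. pochhammer (1 - p) j / fact j :: real)"
  \<comment> \<open>From J0 \<ge> p on, every further factor 1 - p + i of the rising factorial is
    positive, so the sign is settled at J0.\<close>
  define J0 where "J0 = nat \<lceil>p\<rceil>"
  have J0: "p \<le> real J0" unfolding J0_def by linarith
  define \<epsilon> where "\<epsilon> = (if pochhammer (1 - p) J0 \<ge> 0 then 1 else -1 :: real)"
  have sgn: "\<epsilon> * c j = \<bar>c j\<bar>" if "j \<ge> J0" for j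
  proof -
    define Q where "Q = pochhammer (1 - p + real J0) (j - J0) / fact j"
    have "c j = pochhammer (1 - p) J0 * Q"
      unfolding c_def Q_def by (subst pochhammer_product[OF that]) simp
    moreover have "Q > 0" using J0 by (auto simp: Q_def intro!: divide_pos_pos pochhammer_pos)
    ultimately show ?thesis by (simp add: \<epsilon>_def abs_mult)
  qed
  \<comment> \<open>\<open>d\<close> vanishes from J0 on; it is the finite correction between the
    signed and the absolute series.\<close>
  define d where "d = (\<lambda>j. \<bar>c j\<bar> - \<epsilon> * c j)"
  have d: "d j = 0" if "j \<ge> J0" for j using sgn[OF that] by (simp add: d_def)
  have d2: "0 \<le> d j" "d j \<le> 2 * \<bar>c j\<bar>" for j by (auto simp: d_def \<epsilon>_def)
  show "0 \<le> (\<Sum>j<J0. 2 * \<bar>c j\<bar>)" by (intro sum_nonneg) auto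
  fix J and y :: real assume y: "0 \<le> y" "y < 1"
  have s: "(\<lambda>j. c j * y ^ j) sums (1 - y) powr (p - 1)"
    unfolding c_def by (rule pochhammer_binomial_sums[OF y])
  have "(\<lambda>j. \<epsilon> * (c j * y ^ j) + d j * y ^ j) sums (\<epsilon> * (1 - y) powr (p - 1) + (\<Sum>j<J0. d j * y ^ j))"
    by (intro sums_add sums_mult s sums_finite) (auto simp: d)
  also have "(\<lambda>j. \<epsilon> * (c j * y ^ j) + d j * y ^ j) = (\<lambda>j. \<bar>c j\<bar> * y ^ j)"
    by (auto simp: d_def algebra_simps)
  finally have s2: "(\<lambda>j. \<bar>c j\<bar> * y ^ j) sums (\<epsilon> * (1 - y) powr (p - 1) + (\<Sum>j<J0. d j * y ^ j))" .
  have "(\<Sum>j<J. \<bar>c j\<bar> * y ^ j) \<le> \<epsilon> * (1 - y) powr (p - 1) + (\<Sum>j<J0. d j * y ^ j)"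
    using sum_le_suminf[OF sums_summable[OF s2], of "{..<J}"] y sums_unique[OF s2] by auto
  also have "\<epsilon> * (1 - y) powr (p - 1) \<le> (1 - y) powr (p - 1)" by (auto simp: \<epsilon>_def)
  also have "(\<Sum>j<J0. d j * y ^ j) \<le> (\<Sum>j<J0. 2 * \<bar>c j\<bar>)"
  proof (rule sum_mono)
    fix j
    have "d j * y ^ j \<le> d j * 1" using d2 y by (intro mult_left_mono power_le_one) auto
    then show "d j * y ^ j \<le> 2 * \<bar>c j\<bar>" using d2[of j] by simp
  qed
  finally show "(\<Sum>j<J. \<bar>pochhammer (1 - p) j / fact j\<bar> * y ^ j) \<le> (\<Sum>j<J0. 2 * \<bar>c j\<bar>) + (1 - y) powr (p - 1)"
    by (simp add: c_def add.commute)
qed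

text \<open>One half of the exponential absorbs the power, the other half is kept as decay.\<close>

lemma power_times_exp_le:
  fixes w z :: real
  assumes "w > 0" "z > 0"
  shows "w ^ N * exp (- z * w) \<le> fact N * (2 / z) ^ N * exp (- (z / 2) * w)"
proof -
  have p: "z / 2 * w > 0" using assms by simp
  have "exp (- (z / 2 * w)) \<le> fact N / (z / 2 * w) ^ N" by (rule exp_minus_le_fact[OF p])
  then have "w ^ N * exp (- (z / 2 * w)) \<le> w ^ N * (fact N / (z / 2 * w) ^ N)"
    using assms by (intro mult_left_mono) auto
  also have "\<dots> = fact N * (2 / z) ^ N"
    using assms by (simp add: power_mult_distrib power_divide field_simps)
  finally have f: "w ^ N * exp (- (z / 2 * w)) * exp (- (z / 2 * w)) \<le> fact N * (2 / z) ^ N * exp (- (z / 2 * w))"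
    by (intro mult_right_mono) auto
  have EE: "exp (- (z / 2 * w)) * exp (- (z / 2 * w)) = exp (- z * w)" by (simp add: mult_exp_exp)
  have e: "- (z / 2) * w = - (z / 2 * w)" by simp
  show ?thesis using f unfolding e by (simp only: mult.assoc EE)
qed

text \<open>Near w = 1 the estimate 1 - w powr (- 1 / \<sigma>) \<ge> (w - 1) / w leaves at worst
  the integrable singularity (w - 1) powr (p - 1); at infinity half of the exponential remains. The
  constant C is there because the integrand also has to dominate the partial sums of the absolute
  binomial series.\<close>

lemma NGG_kernel_integrable:
  fixes \<sigma> p C z :: real
  assumes \<sigma>: "0 < \<sigma>" "\<sigma> < 1" and p: "0 < p" and z: "0 < z" and C: "0 \<le> C"
  shows "set_integrable lborel {1<..} (\<lambda>w. exp (- z * w) * (w ^ N * (C + (1 - w powr (- 1 / \<sigma>)) powr (p - 1))))"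
proof (rule set_integrable_bound)
  \<comment> \<open>For p \<ge> 1 the power p - 1 is just bounded by 1, which p' = 1
    encodes.\<close>
  define p' where "p' = min p 1"
  \<comment> \<open>Two powers have to be absorbed: w ^ N, and w ^ (N + 1) from the extra factor w
    in the estimate of the singular term.\<close>
  define K where "K = fact N * (2 / z) ^ N + fact (Suc N) * (2 / z) ^ Suc N"
  have K: "K \<ge> 0" using z by (simp add: K_def)
  define B where "B = (\<lambda>w::real. K * (C * ((w - 1) powr (1 - 1) * exp (- (z / 2) * w)) + (w - 1) powr (p' - 1) * exp (- (z / 2) * w)))"
  show "set_integrable lborel {1<..} B"
    unfolding B_def using p z
    by (intro set_integrable_mult_right set_integral_add set_integrable_exp_powr) (auto simp: p'_def)
  show "set_borel_measurable lborel {1<..} (\<lambda>w. exp (- z * w) * (w ^ N * (C + (1 - w powr (- 1 / \<sigma>)) powr (p - 1))))"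
    unfolding set_borel_measurable_def by measurable
  have "norm (exp (- z * w) * (w ^ N * (C + (1 - w powr (- 1 / \<sigma>)) powr (p - 1)))) \<le> norm (B w)" if w: "w > 1" for w
  proof -
    have y1: "w powr (- 1 / \<sigma>) \<le> w powr (- 1)" using w \<sigma> by (intro powr_mono) (auto simp: field_simps)
    then have y: "1 - 1 / w \<le> 1 - w powr (- 1 / \<sigma>)" using w by (simp add: powr_minus divide_inverse)
    have w1: "0 < 1 - 1 / w" using w by simp
    have "(1 - w powr (- 1 / \<sigma>)) powr (p - 1) \<le> w * (w - 1) powr (p' - 1)"
    proof (cases "p \<ge> 1")
      case True
      have "\<bar>1 - w powr (- 1 / \<sigma>)\<bar> \<le> 1"
        using y w1 powr_ge_zero[of w "- 1 / \<sigma>"] by (intro abs_leI) linarith+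
      then have "(1 - w powr (- 1 / \<sigma>)) powr (p - 1) \<le> 1"
        using True y w1 by (intro powr_le1) auto
      then show ?thesis using w True by (simp add: p'_def)
    next
      case False
      have "(1 - w powr (- 1 / \<sigma>)) powr (p - 1) \<le> (1 - 1 / w) powr (p - 1)"
        using y w1 False by (intro powr_mono2') auto
      also have "1 - 1 / w = (w - 1) / w" using w by (simp add: field_simps)
      also have "((w - 1) / w) powr (p - 1) = (w - 1) powr (p - 1) * w powr (1 - p)"
        using w by (simp add: powr_divide powr_diff)
      also have "\<dots> \<le> (w - 1) powr (p - 1) * w powr 1"
        using w p by (intro mult_left_mono powr_mono) auto
      finally show ?thesis using w False by (simp add: p'_def mult.commute)
    qed
    then have "exp (- z * w) * (w ^ N * (C + (1 - w powr (- 1 / \<sigma>)) powr (p - 1)))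
      \<le> exp (- z * w) * (w ^ N * (C + w * (w - 1) powr (p' - 1)))"
      using w by (intro mult_left_mono add_left_mono) auto
    also have "\<dots> = C * (w ^ N * exp (- z * w)) + (w - 1) powr (p' - 1) * (w ^ Suc N * exp (- z * w))"
      by (simp add: algebra_simps)
    also have "\<dots> \<le> C * (K * exp (- (z / 2) * w)) + (w - 1) powr (p' - 1) * (K * exp (- (z / 2) * w))"
    proof -
      have "w ^ N * exp (- z * w) \<le> K * exp (- (z / 2) * w)"
        using power_times_exp_le[of w z N] w z by (simp add: K_def distrib_right add_increasing2)
      moreover have "w ^ Suc N * exp (- z * w) \<le> K * exp (- (z / 2) * w)"
        using power_times_exp_le[of w z "Suc N"] w z by (simp only: K_def distrib_right) (simp add: add_increasing)
      ultimately show ?thesis using C by (intro add_mono mult_left_mono) auto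
    qed
    also have "\<dots> = B w" using w by (simp add: B_def algebra_simps)
    finally have le: "exp (- z * w) * (w ^ N * (C + (1 - w powr (- 1 / \<sigma>)) powr (p - 1))) \<le> B w" .
    have "0 \<le> exp (- z * w) * (w ^ N * (C + (1 - w powr (- 1 / \<sigma>)) powr (p - 1)))"
      using C w by (intro mult_nonneg_nonneg add_nonneg_nonneg) auto
    then show ?thesis using le by simp
  qed
  then show "AE w in lborel. w \<in> {1<..} \<longrightarrow> norm (exp (- z * w) * (w ^ N * (C + (1 - w powr (- 1 / \<sigma>)) powr (p - 1)))) \<le> norm (B w)"
    by auto
qed

text \<open>After scaling, the j-th incomplete gamma function contributes z ^ n / L ^ j times the
  integral of w ^ (n - 1) * (w powr (- 1 / \<sigma>)) ^ j * exp (- z * w), where z = L powr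
  \<sigma>. The powers of L cancel and a binomial series in w powr (- 1 / \<sigma>) is left under
  the integral. Its coefficients may have either sign, so the interchange rests on the bound for
  absolute partial sums.\<close>

lemma NGG_series_eq_integral:
  fixes \<sigma> p L :: real
  assumes \<sigma>: "0 < \<sigma>" "\<sigma> < 1" and p: "0 < p" and L: "0 < L" and n: "1 \<le> n"
  shows "(\<Sum>j. pochhammer (1 - p) j / fact j * L ^ j * upper_Gamma (real n - real j / \<sigma>) (L powr \<sigma>))
    = (L powr \<sigma>) ^ n * (LBINT w:{1<..}. exp (- (L powr \<sigma>) * w) * (w ^ (n - 1) * (1 - w powr (- 1 / \<sigma>)) powr (p - 1)))"
proof -
  define z where "z = L powr \<sigma>"
  have z: "z > 0" using L by (simp add: z_def)
  define c where "c = (\<lambda>j. pochhammer (1 - p) j / fact j :: real)"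
  define y where "y = (\<lambda>w::real. w powr (- 1 / \<sigma>))"
  have y: "0 \<le> y w" "y w < 1" if "w > 1" for w
    using powr_less_mono[of "- 1 / \<sigma>" 0 w] that \<sigma> by (auto simp: y_def)
  obtain C where C: "C \<ge> 0" and Cb: "\<And>J y. 0 \<le> y \<Longrightarrow> y < 1 \<Longrightarrow>
      (\<Sum>j<J. \<bar>c j\<bar> * y ^ j) \<le> C + (1 - y) powr (p - 1)"
    unfolding c_def using pochhammer_binomial_abs_bound[of p] by blast
  define g where "g = (\<lambda>j w. indicator {1<..} w * (c j * (exp (- z * w) * w ^ (n - 1) * y w ^ j)))"
  have trm: "c j * L ^ j * upper_Gamma (real n - real j / \<sigma>) z = z ^ n * (\<integral>w. g j w \<partial>lborel)" for j
  proof -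
    have "z powr (real n - real j / \<sigma>) = z ^ n / L ^ j"
    proof -
      have "z powr (real j / \<sigma>) = L ^ j" using L \<sigma> by (simp add: z_def powr_powr powr_realpow)
      then show ?thesis using z by (simp add: powr_diff powr_realpow)
    qed
    moreover have "(LBINT w:{1<..}. w powr (real n - real j / \<sigma> - 1) * exp (- z * w))
      = (\<integral>w. indicator {1<..} w * (exp (- z * w) * w ^ (n - 1) * y w ^ j) \<partial>lborel)"
      unfolding set_lebesgue_integral_def
    proof (intro Bochner_Integration.integral_cong refl)
      fix w :: real
      have "w powr (real n - real j / \<sigma> - 1) = w ^ (n - 1) * y w ^ j" if "w > 1"
      proof -
        have "y w ^ j = w powr (- (real j / \<sigma>))"
          using that by (simp add: y_def powr_powr powr_realpow[symmetric])
        moreover have "w ^ (n - 1) = w powr (real n - 1)"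
          using that n by (simp add: powr_realpow[symmetric] of_nat_diff)
        ultimately show ?thesis by (simp add: powr_add[symmetric] algebra_simps)
      qed
      then show "indicator {1<..} w *\<^sub>R (w powr (real n - real j / \<sigma> - 1) * exp (- z * w))
        = indicator {1<..} w * (exp (- z * w) * w ^ (n - 1) * y w ^ j)"
        by (auto simp: indicator_def)
    qed
    moreover have "(\<integral>w. g j w \<partial>lborel) = c j * (\<integral>w. indicator {1<..} w * (exp (- z * w) * w ^ (n - 1) * y w ^ j) \<partial>lborel)"
      unfolding integral_mult_right_zero[symmetric] g_def by (intro Bochner_Integration.integral_cong) auto
    ultimately show ?thesis
      using L by (simp add: upper_Gamma_scale[OF z])
  qed
  define B where "B = (\<lambda>w. indicator {1<..} w * (exp (- z * w) * (w ^ (n - 1) * (C + (1 - y w) powr (p - 1)))))"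
  have B: "integrable lborel B"
    using NGG_kernel_integrable[OF \<sigma> p z C, of "n - 1"] by (simp add: B_def y_def set_integrable_def)
  have g_abs: "\<bar>g j w\<bar> = indicator {1<..} w * (exp (- z * w) * w ^ (n - 1) * (\<bar>c j\<bar> * y w ^ j))" for j w
    using y[of w] by (auto simp: g_def indicator_def abs_mult)
  have psum: "(\<Sum>j<J. \<bar>g j w\<bar>) \<le> B w" for J w
  proof (cases "w > 1")
    case True
    have "(\<Sum>j<J. \<bar>g j w\<bar>) = exp (- z * w) * w ^ (n - 1) * (\<Sum>j<J. \<bar>c j\<bar> * y w ^ j)"
      using True by (simp add: g_abs sum_distrib_left)
    also have "\<dots> \<le> exp (- z * w) * w ^ (n - 1) * (C + (1 - y w) powr (p - 1))"
      using True by (intro mult_left_mono Cb y) auto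
    finally show ?thesis using True by (simp add: B_def)
  qed (simp add: g_abs B_def)
  have gm: "g j \<in> borel_measurable lborel" for j unfolding g_def y_def by measurable
  have g_int: "integrable lborel (g j)" for j
  proof (rule Bochner_Integration.integrable_bound[OF B gm])
    have "\<bar>g j w\<bar> \<le> B w" for w
    proof -
      have "\<bar>g j w\<bar> \<le> (\<Sum>i<Suc j. \<bar>g i w\<bar>)" by (simp add: sum_nonneg)
      then show ?thesis using psum by (rule order_trans)
    qed
    then have "norm (g j w) \<le> norm (B w)" for w using order_trans[OF _ abs_ge_self] by (metis real_norm_def)
    then show "AE w in lborel. norm (g j w) \<le> norm (B w)" by simp
  qed
  have nsm: "summable (\<lambda>j. \<integral>w. norm (g j w) \<partial>lborel)"
  proof (rule summableI_nonneg_bounded)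
    fix J
    have "(\<Sum>j<J. \<integral>w. norm (g j w) \<partial>lborel) = (\<integral>w. (\<Sum>j<J. norm (g j w)) \<partial>lborel)"
      by (rule Bochner_Integration.integral_sum[symmetric]) (use g_int in auto)
    also have "\<dots> \<le> (\<integral>w. B w \<partial>lborel)"
      using psum g_int by (intro integral_mono B) auto
    finally show "(\<Sum>j<J. \<integral>w. norm (g j w) \<partial>lborel) \<le> (\<integral>w. B w \<partial>lborel)" .
  qed auto
  have swap: "(\<integral>w. (\<Sum>j. g j w) \<partial>lborel) = (\<Sum>j. \<integral>w. g j w \<partial>lborel)"
  proof (rule integral_suminf[OF g_int])
    show "AE w in lborel. summable (\<lambda>j. norm (g j w))"
      using psum by (intro AE_I2 summableI_nonneg_bounded) auto
  qed (rule nsm)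
  have lim: "(\<Sum>j. g j w) = indicator {1<..} w * (exp (- z * w) * (w ^ (n - 1) * (1 - y w) powr (p - 1)))" for w
  proof (cases "w > 1")
    case True
    have "(\<lambda>j. exp (- z * w) * w ^ (n - 1) * (c j * y w ^ j)) sums (exp (- z * w) * w ^ (n - 1) * (1 - y w) powr (p - 1))"
      unfolding c_def by (intro sums_mult pochhammer_binomial_sums y True)
    also have "(\<lambda>j. exp (- z * w) * w ^ (n - 1) * (c j * y w ^ j)) = (\<lambda>j. g j w)"
      using True by (auto simp: g_def)
    finally show ?thesis using True by (simp add: sums_unique[symmetric] mult.assoc)
  qed (simp add: g_def)
  have sm: "summable (\<lambda>j. \<integral>w. g j w \<partial>lborel)"
    by (rule summable_comparison_test'[OF nsm integral_norm_bound])
  have "(\<Sum>j. c j * L ^ j * upper_Gamma (real n - real j / \<sigma>) z) = z ^ n * (\<Sum>j. \<integral>w. g j w \<partial>lborel)"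
    unfolding trm by (rule suminf_mult[OF sm])
  also have "\<dots> = z ^ n * (\<integral>w. (\<Sum>j. g j w) \<partial>lborel)" by (simp only: swap)
  finally show ?thesis
    by (simp add: lim set_lebesgue_integral_def c_def z_def y_def)
qed

text \<open>With L = a powr (1 / \<sigma>) / (u * pr), the number L powr \<sigma> is the argument of
  the incomplete gamma function. The prefactor (L powr \<sigma>) ^ n contains u powr (- n *
  \<sigma>), which collapses u powr (n * \<sigma> - 1) to u powr (-1) for every n.\<close>

lemma NGG_numerator_eq:
  fixes \<sigma> a u pr :: real
  assumes \<sigma>: "0 < \<sigma>" "\<sigma> < 1" and a: "0 < a" and u: "0 < u" and pr: "0 < pr" and n: "1 \<le> n"
  shows "u powr (real n * \<sigma> - 1) * (\<Sum>j. pochhammer (1 - real n * \<sigma>) j / fact j * (a powr (real j / \<sigma>) / (u ^ j * pr ^ j))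
      * upper_Gamma (real n - real j / \<sigma>) (a / (u powr \<sigma> * pr powr \<sigma>)))
    = (a / pr powr \<sigma>) ^ n * (u powr (-1) * (LBINT w:{1<..}. exp (- (a / pr powr \<sigma> * u powr (- \<sigma>)) * w) *
        (w ^ (n - 1) * (1 - w powr (- 1 / \<sigma>)) powr (real n * \<sigma> - 1))))"
proof -
  define L where "L = a powr (1 / \<sigma>) / (u * pr)"
  have L: "L > 0" using a u pr by (simp add: L_def)
  have Lj: "a powr (real j / \<sigma>) / (u ^ j * pr ^ j) = L ^ j" for j
  proof -
    have "a powr (real j / \<sigma>) = (a powr (1 / \<sigma>)) ^ j"
      using a by (simp add: powr_powr powr_realpow[symmetric])
    then show ?thesis by (simp add: L_def power_divide power_mult_distrib)
  qed
  have L\<sigma>: "L powr \<sigma> = a / (u powr \<sigma> * pr powr \<sigma>)"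
    using a u pr \<sigma> by (simp add: L_def powr_divide powr_mult powr_powr)
  have z: "a / (u powr \<sigma> * pr powr \<sigma>) = a / pr powr \<sigma> * u powr (- \<sigma>)"
    by (simp add: powr_minus divide_inverse)
  have p: "0 < real n * \<sigma>" using n \<sigma> by simp
  have "u powr (real n * \<sigma> - 1) * (u powr (- \<sigma>)) ^ n = u powr (-1)"
    using u by (simp add: powr_powr powr_realpow[symmetric] powr_add[symmetric])
  then have "u powr (real n * \<sigma> - 1) * (a / pr powr \<sigma> * u powr (- \<sigma>)) ^ n = (a / pr powr \<sigma>) ^ n * u powr (-1)"
    by (simp only: power_mult_distrib) (simp add: mult.left_commute)
  then show ?thesis
    using NGG_series_eq_integral[OF \<sigma> p L n] unfolding Lj L\<sigma> z by (simp only: mult.assoc[symmetric])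
qed

text \<open>Here h is the identity on w > 1 and the power of 1 - x is always m = -1, whence c =
  \<sigma> * a - 1. The factor x powr (- \<sigma>) gives the Beta parameter s = 1 -
  \<sigma>.\<close>

lemma NGG_kernel_moment_le:
  fixes f :: "real \<Rightarrow> real"
  assumes m: "(\<lambda>x. ennreal (f x)) \<in> borel_measurable borel"
    and f: "\<And>x. f x = indicator {0<..<1} x * (k * x powr (- \<sigma>) * ((1 - x) powr (-1) *
      (LBINT w:{1<..}. exp (- (z * (1 - x) powr (- \<sigma>)) * w) * (w ^ N * (1 - w powr (- 1 / \<sigma>)) powr (p - 1)))))"
    and \<sigma>: "0 < \<sigma>" "\<sigma> < 1" and p: "0 < p" and z: "a \<le> z" "1 < \<sigma> * a" and q: "q \<ge> 1"
  shows "(\<integral>\<^sup>+x. ennreal (x ^ q) * ennreal (f x) \<partial>lborel)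
    \<le> ennreal (fact q / (\<sigma> * a - 1) ^ (q - 1)) * (\<integral>\<^sup>+x. ennreal x * ennreal (f x) \<partial>lborel)"
proof -
  have "0 < \<sigma> * a" using z by simp
  then have z0: "0 < z" using \<sigma> z by (simp add: zero_less_mult_iff)
  define I where "I = (\<lambda>x. LBINT w:{1<..}. exp (- (z * (1 - x) powr (- \<sigma>)) * w) * (w ^ N * (1 - w powr (- 1 / \<sigma>)) powr (p - 1)))"
  have I: "I x \<ge> 0" for x
    unfolding I_def set_lebesgue_integral_def by (intro integral_nonneg_AE) (auto simp: indicator_def)
  have f': "f x = indicator {0<..<1} x * (k * x powr (- \<sigma>) * ((1 - x) powr (-1) * I x))" for x
    unfolding I_def by (rule f)
  show ?thesis
  proof (rule size_biased_moment_le[where s = "1 - \<sigma>" and k = k and \<phi> = "\<lambda>x. (1 - x) powr (-1) * I x", OF m])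
    fix x y :: real assume xy: "0 < x" "x \<le> y" "y < 1"
    show "(1 - y) powr (-1) * I y * (1 - x) powr (\<sigma> * a - 1) \<le> (1 - x) powr (-1) * I x * (1 - y) powr (\<sigma> * a - 1)"
      unfolding I_def
    proof (rule kernel_integral_mono[OF xy \<sigma>(1) z0])
      show "\<sigma> * a - 1 \<le> \<sigma> * z + - 1" using z \<sigma> by simp
      show "set_integrable lborel {1<..} (\<lambda>t. exp (- z * t) * (t ^ N * (1 - t powr (- 1 / \<sigma>)) powr (p - 1)))" if "z > 0" for z
        using NGG_kernel_integrable[OF \<sigma> p that, of 0 N] by simp
    qed auto
  qed (use z q \<sigma> I in \<open>auto simp: f' I\<close>)
qed

lemma (in prob_space) NGGP_AE_tendsto:
  assumes "A \<in> sets borel" "\<tau> > 0" "\<And>n. n \<ge> 1 \<Longrightarrow> is_NGGP M \<sigma> (real n powr \<tau>) H (P n)"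
  shows "AE \<omega> in M. (\<lambda>n. measure (P n \<omega>) A) \<longlonglongrightarrow> measure H A"
proof (rule beta_type_sticks_AE_tendsto[OF assms(1,2)])
  show \<sigma>0: "0 < \<sigma>" using assms(3)[of 1] by (simp add: is_NGGP_def)
  have \<sigma>1: "\<sigma> < 1" using assms(3)[of 1] by (simp add: is_NGGP_def)
  fix n :: nat assume "n \<ge> 1"
  define a where "a = real n powr \<tau>"
  from assms(3)[OF \<open>n \<ge> 1\<close>] obtain v where v: "stick_breaking M H v (P n)"
     "weights_have_densities M v (NGG_density1 \<sigma> a) (NGG_density \<sigma> a)" and a0: "0 < a"
    by (auto simp: is_NGGP_def a_def)
  have v01: "\<omega> \<in> space M \<Longrightarrow> v i \<omega> \<in> {0..1}" for i \<omega> using v(1) unfolding stick_breaking_def by blast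
  have "stick_moment_bound M v q (fact q / (\<sigma> * a - 1) ^ (q - 1))"
    if a: "\<sigma> * a > 1" and q: "q \<ge> 1" for q
  proof (rule sequential_stick_moments[OF v(2) v01])
    assume m: "(\<lambda>x. ennreal (NGG_density1 \<sigma> a x)) \<in> borel_measurable borel"
    show "(\<integral>\<^sup>+x. ennreal (x ^ q) * ennreal (NGG_density1 \<sigma> a x) \<partial>lborel)
      \<le> ennreal (fact q / (\<sigma> * a - 1) ^ (q - 1)) * (\<integral>\<^sup>+x. ennreal x * ennreal (NGG_density1 \<sigma> a x) \<partial>lborel)"
    \<comment> \<open>The first density is the case n = 1 with remaining stick 1, so p = \<sigma>
      and the prefactor a joins the constant.\<close>
    proof (rule NGG_kernel_moment_le[OF m, where z = a and N = 0 and p = \<sigma> and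
        k = "exp a / (Gamma \<sigma> * Gamma (1 - \<sigma>)) * a"])
      fix x
      show "NGG_density1 \<sigma> a x = indicator {0<..<1} x * (exp a / (Gamma \<sigma> * Gamma (1 - \<sigma>)) * a * x powr (- \<sigma>) *
        ((1 - x) powr (-1) * (LBINT w:{1<..}. exp (- (a * (1 - x) powr (- \<sigma>)) * w) * (w ^ 0 * (1 - w powr (- 1 / \<sigma>)) powr (\<sigma> - 1)))))"
      proof (cases "x \<in> {0<..<1}")
        case True
        define J where "J = (1 - x) powr (-1) * (LBINT w:{1<..}. exp (- (a * (1 - x) powr (- \<sigma>)) * w) * (w ^ 0 * (1 - w powr (- 1 / \<sigma>)) powr (\<sigma> - 1)))"
        define S where "S = (\<Sum>j. pochhammer (1 - \<sigma>) j / fact j * (a powr (real j / \<sigma>) / (1 - x) ^ j)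
            * upper_Gamma (1 - real j / \<sigma>) (a / (1 - x) powr \<sigma>))"
        have e: "(1 - x) powr (\<sigma> - 1) * S = a * J"
          using NGG_numerator_eq[OF \<sigma>0 \<sigma>1 a0, of "1 - x" 1 1] True by (simp add: S_def J_def)
        have "NGG_density1 \<sigma> a x = x powr (- \<sigma>) * exp a / (Gamma \<sigma> * Gamma (1 - \<sigma>)) * ((1 - x) powr (\<sigma> - 1) * S)"
          unfolding NGG_density1_def S_def[symmetric] using True by simp
        then show ?thesis unfolding e J_def[symmetric] using True by simp
      qed (simp add: NGG_density1_def)
    qed (use a q \<sigma>0 \<sigma>1 in auto)
  next
    fix m and y :: "nat \<Rightarrow> real"
    assume m: "1 \<le> m" and y: "\<And>j. j < m \<Longrightarrow> 0 \<le> y j \<and> y j < 1"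
      and meas: "NGG_density \<sigma> a (Suc m) y \<in> borel_measurable borel"
    define pr where "pr = (\<Prod>i<m. 1 - y i)"
    have pr: "0 < pr" "pr \<le> 1" using y unfolding pr_def by (auto intro!: prod_pos prod_le_1 simp: less_imp_le)
    have prj: "(\<Prod>i<m. (1 - y i) ^ j) = pr ^ j" for j by (simp add: pr_def prod_power_distrib)
    have pr\<sigma>: "(\<Prod>i<m. (1 - y i) powr \<sigma>) = pr powr \<sigma>"
      unfolding pr_def by (rule prod_powr_distrib[symmetric])
    \<comment> \<open>As the remaining stick is at most 1, the rate z is at least a for every
      history.\<close>
    define z where "z = a / pr powr \<sigma>"
    have "pr powr \<sigma> \<le> 1" "0 < pr powr \<sigma>" using pr \<sigma>0 by (auto intro!: powr_le1)
    then have z: "a \<le> z" using a0 by (simp add: z_def field_simps)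
    \<comment> \<open>The denominator is free of x; its value and sign are left open and absorbed
      into k.\<close>
    define den where "den = (\<Sum>j. pochhammer (1 - real m * \<sigma>) j / fact j
              * (a powr (real j / \<sigma>) / pr ^ j) * upper_Gamma (real m - real j / \<sigma>) (a / pr powr \<sigma>))"
    define k where "k = \<sigma> * Gamma (real m * \<sigma>) / (Gamma (1 - \<sigma>) * Gamma (real (Suc m) * \<sigma>)) / den * z ^ Suc m"
    show "(\<integral>\<^sup>+x. ennreal (x ^ q) * ennreal (NGG_density \<sigma> a (Suc m) y x) \<partial>lborel)
      \<le> ennreal (fact q / (\<sigma> * a - 1) ^ (q - 1)) * (\<integral>\<^sup>+x. ennreal x * ennreal (NGG_density \<sigma> a (Suc m) y x) \<partial>lborel)"
    proof (rule NGG_kernel_moment_le[where z = z and N = m and p = "real (Suc m) * \<sigma>" and k = k])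
      fix x
      show "NGG_density \<sigma> a (Suc m) y x = indicator {0<..<1} x * (k * x powr (- \<sigma>) *
        ((1 - x) powr (-1) * (LBINT w:{1<..}. exp (- (z * (1 - x) powr (- \<sigma>)) * w) * (w ^ m * (1 - w powr (- 1 / \<sigma>)) powr (real (Suc m) * \<sigma> - 1)))))"
      proof (cases "x \<in> {0<..<1}")
        case True
        define J where "J = (1 - x) powr (-1) * (LBINT w:{1<..}. exp (- (z * (1 - x) powr (- \<sigma>)) * w) * (w ^ m * (1 - w powr (- 1 / \<sigma>)) powr (real (Suc m) * \<sigma> - 1)))"
        define S where "S = (\<Sum>j. pochhammer (1 - real (Suc m) * \<sigma>) j / fact j * (a powr (real j / \<sigma>) / ((1 - x) ^ j * pr ^ j))
            * upper_Gamma (real (Suc m) - real j / \<sigma>) (a / ((1 - x) powr \<sigma> * pr powr \<sigma>)))"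
        have e: "(1 - x) powr (real (Suc m) * \<sigma> - 1) * S = z ^ Suc m * J"
          using NGG_numerator_eq[OF \<sigma>0 \<sigma>1 a0 _ pr(1), of "1 - x" "Suc m"] True
          by (simp only: S_def J_def z_def) simp
        have "NGG_density \<sigma> a (Suc m) y x = x powr (- \<sigma>) * (\<sigma> * Gamma (real m * \<sigma>) / (Gamma (1 - \<sigma>) * Gamma (real (Suc m) * \<sigma>)) / den)
            * ((1 - x) powr (real (Suc m) * \<sigma> - 1) * S)"
        proof -
          have d: "real (Suc m) - 1 - real j / \<sigma> = real m - real j / \<sigma>" for j by simp
          show ?thesis
            unfolding NGG_density_def diff_Suc_1 prj pr\<sigma> d S_def[symmetric] den_def[symmetric]
            using True by simp
        qed
        then show ?thesis unfolding e J_def[symmetric] using True by (simp add: k_def)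
      qed (simp add: NGG_density_def)
    qed (use a q z meas \<sigma>0 \<sigma>1 in auto)
  qed (use q in auto)
  then show "\<exists>v. stick_breaking M H v (P n) \<and> (\<forall>q\<ge>1. \<sigma> * real n powr \<tau> > 1 \<longrightarrow>
      stick_moment_bound M v q (fact q / (\<sigma> * real n powr \<tau> - 1) ^ (q - 1)))"
    using v(1) unfolding a_def by blast
qed

section \<open>The generalized Dirichlet process\<close>

definition Phi2_term :: "nat \<Rightarrow> real \<Rightarrow> real \<Rightarrow> real \<Rightarrow> (nat \<Rightarrow> nat) \<Rightarrow> real" where
  "Phi2_term N \<alpha> c s i = (\<Prod>k\<in>{1..N}. pochhammer \<alpha> (i k)) / pochhammer c (\<Sum>k\<in>{1..N}. i k)
       * (\<Prod>k\<in>{1..N}. (s * real k) ^ i k / fact (i k))"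

text \<open>The same series with values in \<open>[0, \<infinity>]\<close>. Only upper bounds on the density are needed, so no
  convergence statement about the Lauricella function enters.\<close>

definition Phi2_nn :: "nat \<Rightarrow> real \<Rightarrow> real \<Rightarrow> real \<Rightarrow> ennreal" where
  "Phi2_nn N \<alpha> c s = (\<integral>\<^sup>+i. ennreal (Phi2_term N \<alpha> c s i) \<partial>count_space ({1..N} \<rightarrow>\<^sub>E UNIV))"

lemma countable_multi_index: "countable ({1..N::nat} \<rightarrow>\<^sub>E (UNIV :: nat set))"
  by (intro countable_PiE) auto

lemma Phi2_term_nonneg: "0 \<le> s \<Longrightarrow> 0 < \<alpha> \<Longrightarrow> 0 < c \<Longrightarrow> 0 \<le> Phi2_term N \<alpha> c s i"
  unfolding Phi2_term_def
  by (intro mult_nonneg_nonneg divide_nonneg_nonneg prod_nonneg pochhammer_nonneg) auto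

lemma borel_measurable_Phi2_nn [measurable]: "Phi2_nn N \<alpha> c \<in> borel_measurable borel"
proof -
  interpret C: sigma_finite_measure "count_space ({1..N} \<rightarrow>\<^sub>E (UNIV :: nat set))"
    by (rule sigma_finite_measure_count_space_countable[OF countable_multi_index])
  have "(\<lambda>p. ennreal (Phi2_term N \<alpha> c (fst p) (snd p)))
      \<in> borel_measurable (borel \<Otimes>\<^sub>M count_space ({1..N} \<rightarrow>\<^sub>E (UNIV :: nat set)))"
    by (rule measurable_compose_countable'[where f = "\<lambda>i p. ennreal (Phi2_term N \<alpha> c (fst p) i)" and g = snd,
          OF _ measurable_snd countable_multi_index]) (simp add: Phi2_term_def)
  then have "(\<lambda>s. \<integral>\<^sup>+i. ennreal (Phi2_term N \<alpha> c s i) \<partial>count_space ({1..N} \<rightarrow>\<^sub>E UNIV)) \<in> borel_measurable borel"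
    by (intro C.borel_measurable_nn_integral) (simp add: case_prod_beta')
  then show ?thesis by (simp add: Phi2_nn_def[abs_def])
qed

lemma Lauricella_Phi2_nonneg:
  assumes "0 \<le> s" "0 < \<alpha>" "0 < c"
  shows "0 \<le> Lauricella_Phi2 N (\<lambda>_. \<alpha>) c (\<lambda>k. s * real k)"
  unfolding Lauricella_Phi2_def Phi2_term_def[symmetric] using assms
  by (intro infsum_nonneg Phi2_term_nonneg)

text \<open>A series that is not summable has \<open>infsum\<close> equal to 0, and an infinite
  right side is trivial; what remains is a comparison of finite partial sums with the counting
  integral.\<close>

lemma Lauricella_Phi2_le:
  assumes "0 \<le> s" "0 < \<alpha>" "0 < c"
  shows "ennreal (Lauricella_Phi2 N (\<lambda>_. \<alpha>) c (\<lambda>k. s * real k)) \<le> Phi2_nn N \<alpha> c s"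
proof (cases "Phi2_nn N \<alpha> c s")
  case (real b)
  define I where "I = {1..N} \<rightarrow>\<^sub>E (UNIV :: nat set)"
  have L: "Lauricella_Phi2 N (\<lambda>_. \<alpha>) c (\<lambda>k. s * real k) = (\<Sum>\<^sub>\<infinity>i\<in>I. Phi2_term N \<alpha> c s i)"
    by (simp add: Lauricella_Phi2_def Phi2_term_def I_def)
  have "(\<Sum>\<^sub>\<infinity>i\<in>I. Phi2_term N \<alpha> c s i) \<le> b"
  proof (cases "Phi2_term N \<alpha> c s summable_on I")
    case True
    then show ?thesis
    proof (rule infsum_le_finite_sums)
      fix F assume F: "finite F" "F \<subseteq> I"
      have "ennreal (\<Sum>i\<in>F. Phi2_term N \<alpha> c s i) = (\<Sum>i\<in>F. ennreal (Phi2_term N \<alpha> c s i))"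
        using assms by (simp add: sum_ennreal Phi2_term_nonneg)
      also have "\<dots> = (\<integral>\<^sup>+i. ennreal (Phi2_term N \<alpha> c s i) * indicator F i \<partial>count_space I)"
        using F by (subst nn_integral_count_space'[of F]) (auto simp: indicator_def intro!: sum.cong)
      also have "\<dots> \<le> (\<integral>\<^sup>+i. ennreal (Phi2_term N \<alpha> c s i) \<partial>count_space I)"
        by (intro nn_integral_mono) (auto simp: indicator_def)
      also have "\<dots> = ennreal b" using real by (simp add: Phi2_nn_def I_def)
      finally show "(\<Sum>i\<in>F. Phi2_term N \<alpha> c s i) \<le> b" using real by simp
    qed
  qed (use real in \<open>simp add: infsum_not_exists\<close>)
  then show ?thesis using real L by (simp add: ennreal_leI)
qed simp

lemma Gamma_nn_integral_scaled:
  assumes x: "0 < x" and \<beta>: "0 < (\<beta>::real)"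
  shows "(\<integral>\<^sup>+s. ennreal (indicator {0<..} s * (s powr (x - 1) * exp (- \<beta> * s))) \<partial>lborel)
    = ennreal (Gamma x * \<beta> powr (- x))"
proof -
  define F where "F = (\<lambda>t::real. ennreal (indicator {0..} t * t powr (x - 1) / exp t))"
  have [measurable]: "F \<in> borel_measurable borel" by (simp add: F_def)
  have "F (0 + \<beta> * s) = ennreal (\<beta> powr (x - 1)) * ennreal (indicator {0<..} s * (s powr (x - 1) * exp (- \<beta> * s)))" for s
  proof (cases "s > 0")
    case True
    have "(\<beta> * s) powr (x - 1) / exp (\<beta> * s) = \<beta> powr (x - 1) * (s powr (x - 1) * exp (- \<beta> * s))"
      using True \<beta> by (simp add: powr_mult exp_minus divide_inverse)
    then show ?thesis using True \<beta> by (simp add: F_def ennreal_mult)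
  next
    case False
    then show ?thesis using \<beta> by (cases "s = 0") (auto simp: F_def zero_le_mult_iff)
  qed
  then have "ennreal (Gamma x) = ennreal \<beta> * (ennreal (\<beta> powr (x - 1)) *
      (\<integral>\<^sup>+s. ennreal (indicator {0<..} s * (s powr (x - 1) * exp (- \<beta> * s))) \<partial>lborel))"
    using nn_integral_real_affine[of F \<beta> 0] \<beta>
    by (simp add: F_def[symmetric] Gamma_conv_nn_integral_real[OF x] nn_integral_cmult flip: F_def)
  then have "ennreal (\<beta> powr (- x)) * ennreal (Gamma x) = (ennreal (\<beta> powr (- x)) * ennreal \<beta> * ennreal (\<beta> powr (x - 1))) *
      (\<integral>\<^sup>+s. ennreal (indicator {0<..} s * (s powr (x - 1) * exp (- \<beta> * s))) \<partial>lborel)"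
    by (simp add: mult.assoc)
  also have "ennreal (\<beta> powr (- x)) * ennreal \<beta> * ennreal (\<beta> powr (x - 1)) = ennreal (\<beta> powr (- x) * \<beta> * \<beta> powr (x - 1))"
    using \<beta> by (simp add: ennreal_mult)
  also have "\<beta> powr (- x) * \<beta> * \<beta> powr (x - 1) = 1"
    using \<beta> by (simp add: powr_minus powr_diff)
  finally show ?thesis using x by (simp add: ennreal_mult mult.commute Gamma_real_pos)
qed

text \<open>Integrating term by term produces Gamma (c + m) for total degree m, which cancels the
  only coupling \<open>pochhammer c m\<close> between the indices. What is left is a product of N
  binomial series in k / \<beta>, convergent because \<beta> > N.\<close>

lemma Phi2_laplace:
  assumes \<alpha>: "0 < \<alpha>" and c: "0 < c" and \<beta>: "real N < \<beta>"
  shows "(\<integral>\<^sup>+s. ennreal (indicator {0<..} s * (s powr (c - 1) * exp (- \<beta> * s))) * Phi2_nn N \<alpha> c s \<partial>lborel)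
    = ennreal (Gamma c * \<beta> powr (- c) * (\<Prod>k\<in>{1..N}. (1 - real k / \<beta>) powr (- \<alpha>)))"
proof -
  define I where "I = {1..N} \<rightarrow>\<^sub>E (UNIV :: nat set)"
  have \<beta>0: "0 < \<beta>" using \<beta> by linarith
  define u where "u = (\<lambda>k n. ennreal (pochhammer \<alpha> n / fact n * (real k / \<beta>) ^ n))"
  have "(\<integral>\<^sup>+s. ennreal (indicator {0<..} s * (s powr (c - 1) * exp (- \<beta> * s))) * Phi2_nn N \<alpha> c s \<partial>lborel)
    = (\<integral>\<^sup>+s. (\<integral>\<^sup>+i. ennreal (indicator {0<..} s * (s powr (c - 1) * exp (- \<beta> * s))) * ennreal (Phi2_term N \<alpha> c s i) \<partial>count_space I) \<partial>lborel)"
    unfolding Phi2_nn_def I_def by (intro nn_integral_cong nn_integral_cmult[symmetric]) simp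
  also have "\<dots> = (\<integral>\<^sup>+i. (\<integral>\<^sup>+s. ennreal (indicator {0<..} s * (s powr (c - 1) * exp (- \<beta> * s))) * ennreal (Phi2_term N \<alpha> c s i) \<partial>lborel) \<partial>count_space I)"
    unfolding I_def by (intro nn_integral_count_space_nn_integral countable_multi_index) (simp add: Phi2_term_def)
  also have "\<dots> = (\<integral>\<^sup>+i. ennreal (Gamma c * \<beta> powr (- c)) * (\<Prod>k\<in>{1..N}. u k (i k)) \<partial>count_space I)"
  proof (intro nn_integral_cong)
    fix i :: "nat \<Rightarrow> nat"
    define m where "m = (\<Sum>k\<in>{1..N}. i k)"
    define D where "D = (\<Prod>k\<in>{1..N}. pochhammer \<alpha> (i k) / fact (i k) * real k ^ i k)"
    have D: "D \<ge> 0" unfolding D_def using \<alpha> by (intro prod_nonneg mult_nonneg_nonneg divide_nonneg_nonneg pochhammer_nonneg ballI) auto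
    have pc: "pochhammer c m > 0" using c by (rule pochhammer_pos)
    have term_eq: "Phi2_term N \<alpha> c s i = D / pochhammer c m * s ^ m" for s
      by (simp add: Phi2_term_def D_def m_def power_sum power_mult_distrib prod.distrib prod_dividef mult_ac)
    have "(\<integral>\<^sup>+s. ennreal (indicator {0<..} s * (s powr (c - 1) * exp (- \<beta> * s))) * ennreal (Phi2_term N \<alpha> c s i) \<partial>lborel)
      = (\<integral>\<^sup>+s. ennreal (D / pochhammer c m) * ennreal (indicator {0<..} s * (s powr (c + real m - 1) * exp (- \<beta> * s))) \<partial>lborel)"
    proof (intro nn_integral_cong)
      fix s :: real
      show "ennreal (indicator {0<..} s * (s powr (c - 1) * exp (- \<beta> * s))) * ennreal (Phi2_term N \<alpha> c s i)
        = ennreal (D / pochhammer c m) * ennreal (indicator {0<..} s * (s powr (c + real m - 1) * exp (- \<beta> * s)))"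
      proof (cases "s > 0")
        case True
        have "s powr (c + real m - 1) = s powr (c - 1) * s ^ m"
          using True by (simp add: powr_realpow[symmetric] powr_add[symmetric] algebra_simps)
        then show ?thesis using True D pc by (simp add: term_eq ennreal_mult[symmetric] mult_ac)
      qed simp
    qed
    also have "\<dots> = ennreal (D / pochhammer c m) * ennreal (Gamma (c + real m) * \<beta> powr (- (c + real m)))"
      using c \<beta>0 by (subst nn_integral_cmult, simp, subst Gamma_nn_integral_scaled) auto
    also have "\<dots> = ennreal (D / pochhammer c m * (Gamma (c + real m) * \<beta> powr (- (c + real m))))"
      using D pc c by (intro ennreal_mult[symmetric] mult_nonneg_nonneg less_imp_le[OF Gamma_real_pos]) auto
    also have "D / pochhammer c m * (Gamma (c + real m) * \<beta> powr (- (c + real m)))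
      = Gamma c * \<beta> powr (- c) * (D / \<beta> ^ m)"
    proof -
      have "c \<notin> \<int>\<^sub>\<le>\<^sub>0" using c by auto
      then have "Gamma (c + real m) = pochhammer c m * Gamma c"
        using c by (simp add: pochhammer_Gamma Gamma_eq_zero_iff)
      moreover have "\<beta> powr (- (c + real m)) = \<beta> powr (- c) / \<beta> ^ m"
        using \<beta>0 by (simp add: powr_diff powr_realpow)
      ultimately show ?thesis using pc by simp
    qed
    also have "D / \<beta> ^ m = (\<Prod>k\<in>{1..N}. pochhammer \<alpha> (i k) / fact (i k) * (real k / \<beta>) ^ i k)"
      by (simp add: D_def m_def power_sum power_divide prod_dividef prod.distrib mult_ac)
    also have "ennreal (Gamma c * \<beta> powr (- c) * (\<Prod>k\<in>{1..N}. pochhammer \<alpha> (i k) / fact (i k) * (real k / \<beta>) ^ i k))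
      = ennreal (Gamma c * \<beta> powr (- c)) * (\<Prod>k\<in>{1..N}. u k (i k))"
    proof -
      have "0 \<le> pochhammer \<alpha> (i k) / fact (i k) * (real k / \<beta>) ^ i k" for k
        using \<alpha> \<beta>0 by (intro mult_nonneg_nonneg divide_nonneg_nonneg pochhammer_nonneg) auto
      then show ?thesis unfolding u_def using c
        by (subst prod_ennreal) (auto intro!: ennreal_mult prod_nonneg mult_nonneg_nonneg simp: Gamma_real_pos less_imp_le)
    qed
    finally show "(\<integral>\<^sup>+s. ennreal (indicator {0<..} s * (s powr (c - 1) * exp (- \<beta> * s))) * ennreal (Phi2_term N \<alpha> c s i) \<partial>lborel)
      = ennreal (Gamma c * \<beta> powr (- c)) * (\<Prod>k\<in>{1..N}. u k (i k))" .
  qed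
  also have "\<dots> = ennreal (Gamma c * \<beta> powr (- c)) * (\<integral>\<^sup>+i. (\<Prod>k\<in>{1..N}. u k (i k)) \<partial>count_space I)"
    by (rule nn_integral_cmult) simp
  \<comment> \<open>Counting measure on the multi-indices is a product measure, so the sum of
    products becomes a product of sums.\<close>
  also have "(\<integral>\<^sup>+i. (\<Prod>k\<in>{1..N}. u k (i k)) \<partial>count_space I) = (\<Prod>k\<in>{1..N}. \<integral>\<^sup>+n. u k n \<partial>count_space UNIV)"
  proof -
    interpret product_sigma_finite "\<lambda>_::nat. count_space (UNIV :: nat set)"
      by (intro product_sigma_finite.intro sigma_finite_measure_count_space_countable) auto
    have "count_space I = PiM {1..N} (\<lambda>_. count_space UNIV)"
      unfolding I_def by (rule count_space_PiM_finite[symmetric]) auto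
    then show ?thesis by (simp add: product_nn_integral_prod)
  qed
  also have "\<dots> = (\<Prod>k\<in>{1..N}. ennreal ((1 - real k / \<beta>) powr (- \<alpha>)))"
  proof (intro prod.cong refl)
    fix k assume k: "k \<in> {1..N}"
    have y: "0 \<le> real k / \<beta>" "real k / \<beta> < 1" using k \<beta> \<beta>0 by auto
    have "(\<lambda>n. pochhammer \<alpha> n / fact n * (real k / \<beta>) ^ n) sums (1 - real k / \<beta>) powr (- \<alpha>)"
      using pochhammer_binomial_sums[OF y, of "1 - \<alpha>"] by simp
    moreover have "0 \<le> pochhammer \<alpha> n / fact n * (real k / \<beta>) ^ n" for n
      using \<alpha> \<beta>0 by (intro mult_nonneg_nonneg divide_nonneg_nonneg pochhammer_nonneg) auto
    ultimately show "(\<integral>\<^sup>+n. u k n \<partial>count_space UNIV) = ennreal ((1 - real k / \<beta>) powr (- \<alpha>))"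
      unfolding nn_integral_count_space_nat u_def by (intro suminf_ennreal_eq)
  qed
  also have "ennreal (Gamma c * \<beta> powr (- c)) * \<dots> = ennreal (Gamma c * \<beta> powr (- c) * (\<Prod>k\<in>{1..N}. (1 - real k / \<beta>) powr (- \<alpha>)))"
    using c by (subst prod_ennreal) (auto intro!: ennreal_mult[symmetric] prod_nonneg simp: Gamma_real_pos less_imp_le)
  finally show ?thesis .
qed

text \<open>With \<beta> = r - \<mu> and c = r * \<alpha> the factors combine to the product of (j -
  \<mu>) powr (- \<alpha>) over j = 1, ..., r, where j = r - k. Up to constants this is the moment
  generating function at \<mu> of a sum of r independent gamma variables of shape \<alpha> and rates
  1, ..., r, finite for \<mu> < 1.\<close>

lemma Phi2_laplace_shifted:
  assumes \<alpha>: "0 < \<alpha>" and r: "1 \<le> r" and \<mu>: "\<mu> < 1"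
  shows "(\<integral>\<^sup>+s. ennreal (indicator {0<..} s * (s powr (real r * \<alpha> - 1) * exp (- (real r - \<mu>) * s))) * Phi2_nn (r - 1) \<alpha> (real r * \<alpha>) s \<partial>lborel)
    = ennreal (Gamma (real r * \<alpha>) / fact r powr \<alpha> * exp (- \<alpha> * (\<Sum>j\<in>{1..r}. ln (1 - \<mu> / real j))))"
proof -
  define \<beta> where "\<beta> = real r - \<mu>"
  have \<beta>: "real (r - 1) < \<beta>" using r \<mu> by (simp add: \<beta>_def of_nat_diff)
  then have \<beta>0: "0 < \<beta>" by linarith
  have f1: "\<beta> powr (- (real r * \<alpha>)) = exp (- \<alpha> * (real r * ln \<beta>))" using \<beta>0 by (simp add: powr_def)
  have f2: "(\<Prod>k\<in>{1..r-1}. (1 - real k / \<beta>) powr (- \<alpha>)) = exp (- \<alpha> * (\<Sum>k\<in>{1..r-1}. ln (\<beta> - real k) - ln \<beta>))"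
  proof -
    have "(1 - real k / \<beta>) powr (- \<alpha>) = exp (- \<alpha> * (ln (\<beta> - real k) - ln \<beta>))" if "k \<in> {1..r-1}" for k
    proof -
      have k: "real k < \<beta>" using that \<beta> by auto
      have "1 - real k / \<beta> = (\<beta> - real k) / \<beta>" using \<beta>0 by (simp add: field_simps)
      then show ?thesis using k \<beta>0 by (simp add: powr_def ln_div)
    qed
    then show ?thesis by (simp add: exp_sum sum_distrib_left)
  qed
  have f3: "real r * ln \<beta> + (\<Sum>k\<in>{1..r-1}. ln (\<beta> - real k) - ln \<beta>) = (\<Sum>j\<in>{1..r}. ln (real j - \<mu>))"
  proof -
    have "(\<Sum>j\<in>{1..r}. ln (real j - \<mu>)) = (\<Sum>k\<in>{0..r-1}. ln (\<beta> - real k))"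
      by (rule sum.reindex_bij_witness[of _ "\<lambda>k. r - k" "\<lambda>j. r - j"]) (use r in \<open>auto simp: \<beta>_def of_nat_diff\<close>)
    also have "{0..r-1} = insert 0 {1..r-1}" by auto
    also have "(\<Sum>k\<in>insert 0 {1..r-1}. ln (\<beta> - real k)) = ln \<beta> + (\<Sum>k\<in>{1..r-1}. ln (\<beta> - real k))" by simp
    finally show ?thesis using r by (simp add: sum_subtractf of_nat_diff algebra_simps)
  qed
  have f4: "(\<Sum>j\<in>{1..r}. ln (real j - \<mu>)) = ln (fact r) + (\<Sum>j\<in>{1..r}. ln (1 - \<mu> / real j))"
  proof -
    have "ln (real j - \<mu>) = ln (real j) + ln (1 - \<mu> / real j)" if "j \<in> {1..r}" for j
    proof -
      have j: "\<mu> < real j" "0 < real j" using that \<mu> by auto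
      then have "real j - \<mu> = real j * (1 - \<mu> / real j)" by (simp add: field_simps)
      moreover have "0 < 1 - \<mu> / real j" using j by simp
      ultimately show ?thesis using j by (simp add: ln_mult)
    qed
    then have "(\<Sum>j\<in>{1..r}. ln (real j - \<mu>)) = (\<Sum>j\<in>{1..r}. ln (real j)) + (\<Sum>j\<in>{1..r}. ln (1 - \<mu> / real j))"
      by (simp add: sum.distrib)
    also have "(\<Sum>j\<in>{1..r}. ln (real j)) = ln (fact r)"
      unfolding fact_prod of_nat_prod by (rule ln_prod[symmetric]) auto
    finally show ?thesis .
  qed
  have "Gamma (real r * \<alpha>) * \<beta> powr (- (real r * \<alpha>)) * (\<Prod>k\<in>{1..r-1}. (1 - real k / \<beta>) powr (- \<alpha>))
    = Gamma (real r * \<alpha>) * exp (- \<alpha> * (real r * ln \<beta> + (\<Sum>k\<in>{1..r-1}. ln (\<beta> - real k) - ln \<beta>)))"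
    unfolding f1 f2 by (simp only: mult.assoc exp_add[symmetric] distrib_left)
  also have "\<dots> = Gamma (real r * \<alpha>) * exp (- \<alpha> * ln (fact r) + - \<alpha> * (\<Sum>j\<in>{1..r}. ln (1 - \<mu> / real j)))"
    unfolding f3 f4 by (simp only: distrib_left)
  also have "\<dots> = Gamma (real r * \<alpha>) / fact r powr \<alpha> * exp (- \<alpha> * (\<Sum>j\<in>{1..r}. ln (1 - \<mu> / real j)))"
    by (simp only: exp_add) (simp add: powr_def exp_minus divide_inverse)
  finally show ?thesis
    using Phi2_laplace[OF \<alpha> _ \<beta>, of "real r * \<alpha>"] \<alpha> r by (simp add: \<beta>_def)
qed

text \<open>Under s1 = t * x and s2 = t * (1 - x) the Jacobian is t, so the left side is the
  integral of g1 s1 * g2 s2 over the half plane s1 + s2 > 0. Dropping that restriction gives the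
  product.\<close>

lemma nn_integral_polar_le:
  fixes g1 g2 :: "real \<Rightarrow> ennreal"
  assumes [measurable]: "g1 \<in> borel_measurable borel" "g2 \<in> borel_measurable borel"
  shows "(\<integral>\<^sup>+x. (\<integral>\<^sup>+t. ennreal (indicator {0<..} t * t) * (g1 (t * x) * g2 (t * (1 - x))) \<partial>lborel) \<partial>lborel)
    \<le> (\<integral>\<^sup>+s. g1 s \<partial>lborel) * (\<integral>\<^sup>+s. g2 s \<partial>lborel)"
proof -
  have "(\<integral>\<^sup>+x. (\<integral>\<^sup>+t. ennreal (indicator {0<..} t * t) * (g1 (t * x) * g2 (t * (1 - x))) \<partial>lborel) \<partial>lborel)
    = (\<integral>\<^sup>+t. (\<integral>\<^sup>+x. ennreal (indicator {0<..} t * t) * (g1 (t * x) * g2 (t * (1 - x))) \<partial>lborel) \<partial>lborel)"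
    by (rule lborel_pair.Fubini') measurable
  also have "\<dots> \<le> (\<integral>\<^sup>+t. (\<integral>\<^sup>+s. g1 s * g2 (t - s) \<partial>lborel) \<partial>lborel)"
  proof (rule nn_integral_mono)
    fix t :: real
    show "(\<integral>\<^sup>+x. ennreal (indicator {0<..} t * t) * (g1 (t * x) * g2 (t * (1 - x))) \<partial>lborel)
      \<le> (\<integral>\<^sup>+s. g1 s * g2 (t - s) \<partial>lborel)"
    proof (cases "t > 0")
      case True
      have "(\<integral>\<^sup>+s. g1 s * g2 (t - s) \<partial>lborel) = ennreal \<bar>t\<bar> * (\<integral>\<^sup>+x. g1 (0 + t * x) * g2 (t - (0 + t * x)) \<partial>lborel)"
        using True by (intro nn_integral_real_affine) auto
      also have "\<dots> = (\<integral>\<^sup>+x. ennreal (indicator {0<..} t * t) * (g1 (t * x) * g2 (t * (1 - x))) \<partial>lborel)"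
        using True by (subst nn_integral_cmult[symmetric]) (auto simp: right_diff_distrib)
      finally show ?thesis by simp
    qed simp
  qed
  also have "\<dots> = (\<integral>\<^sup>+s. (\<integral>\<^sup>+t. g1 s * g2 (t - s) \<partial>lborel) \<partial>lborel)"
    by (rule lborel_pair.Fubini') measurable
  also have "\<dots> = (\<integral>\<^sup>+s. g1 s * (\<integral>\<^sup>+t. g2 t \<partial>lborel) \<partial>lborel)"
  proof (intro nn_integral_cong)
    fix s :: real
    have "(\<integral>\<^sup>+t. g1 s * g2 (t - s) \<partial>lborel) = g1 s * (\<integral>\<^sup>+t. g2 (t - s) \<partial>lborel)"
      by (rule nn_integral_cmult) measurable
    also have "(\<integral>\<^sup>+t. g2 (t - s) \<partial>lborel) = (\<integral>\<^sup>+t. g2 t \<partial>lborel)"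
      using nn_integral_real_affine[of g2 1 "- s"] by simp
    finally show "(\<integral>\<^sup>+t. g1 s * g2 (t - s) \<partial>lborel) = g1 s * (\<integral>\<^sup>+t. g2 t \<partial>lborel)" .
  qed
  also have "\<dots> = (\<integral>\<^sup>+s. g1 s \<partial>lborel) * (\<integral>\<^sup>+s. g2 s \<partial>lborel)"
    by (rule nn_integral_multc) simp
  finally show ?thesis .
qed

text \<open>The Bochner integral is 0 by convention when f is not integrable, so the bound holds in
  that case too.\<close>

lemma ennreal_integral_le_nn_integral:
  assumes "\<And>x. 0 \<le> f x"
  shows "ennreal (\<integral>x. f x \<partial>M) \<le> (\<integral>\<^sup>+x. ennreal (f x) \<partial>M)"
proof (cases "integrable M f")
  case True
  then show ?thesis using assms by (simp add: nn_integral_eq_integral)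
qed (simp add: not_integrable_integral_eq)

text \<open>Chernoff's bound. The density is that of \<open>S1 / (S1 + S2)\<close>, where \<open>S1\<close> and \<open>S2\<close> are independent
  sums of \<open>r\<close> independent gamma variables with rates \<open>1, \<dots>, r\<close> and shapes \<open>a h\<close> and \<open>a (1 - h)\<close>,
  written in the coordinates \<open>t = S1 + S2\<close> and \<open>x = S1 / t\<close>.\<close>

lemma (in prob_space) GDP_chernoff:
  fixes H :: "'x::topological_space measure"
  assumes gdp: "is_GDP M a r H P" and H: "prob_space H" "sets H = sets borel"
    and A: "A \<in> sets borel" and h: "0 < measure H A" "measure H A < 1"
    and q: "0 < q" "q < 1" and l: "0 \<le> l" "l * (1 - q) < 1"
  shows "prob {\<omega>\<in>space M. q \<le> measure (P \<omega>) A}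
    \<le> exp (- a * (\<Sum>j\<in>{1..r}. measure H A * ln (1 - l * (1 - q) / real j) + (1 - measure H A) * ln (1 + l * q / real j)))"
proof -
  interpret H: prob_space H by fact
  define h where "h = measure H A"
  have a: "0 < a" and r: "1 \<le> r" using gdp by (auto simp: is_GDP_def)
  have Hc: "measure H (- A) = 1 - h"
    using H.prob_compl[of A] A H(2) sets_eq_imp_space_eq[OF H(2)] by (simp add: h_def Compl_eq_Diff_UNIV)
  \<comment> \<open>For the partition into A and its complement the density is a function of the
    first coordinate alone.\<close>
  define Ap where "Ap = (\<lambda>i::nat. if i = 1 then A else - A)"
  define \<alpha> where "\<alpha> = (\<lambda>i. a * measure H (Ap i))"
  have \<alpha>12: "\<alpha> 1 = a * h" "\<alpha> (Suc 0) = a * h" "\<alpha> 2 = a * (1 - h)" by (auto simp: \<alpha>_def Ap_def Hc h_def)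
  have \<alpha>pos: "0 < \<alpha> 1" "0 < \<alpha> 2" unfolding \<alpha>12 using a h by (auto simp: h_def)
  have I2: "{1..2::nat} = {1, 2}" "{Suc 0..2} = {1, 2}" by auto
  have I1: "{1..2-1::nat} = {1}" by auto
  define dens where "dens = (\<lambda>x::nat \<Rightarrow> real. let x' = x(2 := 1 - (\<Sum>i\<in>{1..2-1}. x i))
              in if \<forall>i\<in>{1..2}. 0 \<le> x' i
                 then ennreal (GDP_density a r 2 \<alpha> x') else 0)"
  define N where "N = (\<Pi>\<^sub>M i\<in>{1..2-1::nat}. (lborel :: real measure))"
  define X where "X = (\<lambda>\<omega>. \<lambda>i\<in>{1..2-1::nat}. measure (P \<omega>) (Ap i))"
  have d: "distributed M N X dens"
    unfolding N_def X_def dens_def \<alpha>_def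
  proof (rule gdp[unfolded is_GDP_def, THEN conjunct2, THEN conjunct2, THEN conjunct2, rule_format])
    show "disjoint_family_on Ap {1..2}" by (auto simp: disjoint_family_on_def Ap_def)
    show "(\<Union>i\<in>{1..2}. Ap i) = UNIV" by (auto simp: I2 Ap_def)
    show "Ap i \<in> sets borel \<and> 0 < measure H (Ap i)" if "i \<in> {1..2}" for i
      using A h Hc by (auto simp: Ap_def h_def)
  qed simp
  \<comment> \<open>On the event q \<le> S1 / (S1 + S2) one has (1 - q) * S1 - q * S2 \<ge> 0.
    Tilting by exp (l * ((1 - q) * S1 - q * S2)) moves the arguments of the two generating functions
    from 0 to \<open>\<mu>1\<close> and \<open>\<mu>2\<close>.\<close>
  define \<mu>1 where "\<mu>1 = l * (1 - q)"
  define \<mu>2 where "\<mu>2 = - (l * q)"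
  have "0 \<le> l * q" using l q by simp
  then have \<mu>: "\<mu>1 < 1" "\<mu>2 < 1" using l(2) by (auto simp: \<mu>1_def \<mu>2_def)
  define g where "g = (\<lambda>i \<mu> s. ennreal (indicator {0<..} s * (s powr (real r * \<alpha> i - 1) * exp (- (real r - \<mu>) * s)))
    * Phi2_nn (r - 1) (\<alpha> i) (real r * \<alpha> i) s)"
  have [measurable]: "g i \<mu> \<in> borel_measurable borel" for i \<mu> by (simp add: g_def)
  define K where "K = fact r powr a / (Gamma (real r * \<alpha> 1) * Gamma (real r * \<alpha> 2))"
  have rp: "0 < real r * \<alpha> 1" "0 < real r * \<alpha> 2" using r \<alpha>pos by auto
  have G: "0 < Gamma (real r * \<alpha> 1)" "0 < Gamma (real r * \<alpha> 2)" using rp by (auto intro: Gamma_real_pos)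
  have K: "K > 0" using G by (simp add: K_def)
  define U where "U = (\<lambda>x. ennreal K * (\<integral>\<^sup>+t. ennreal (indicator {0<..} t * t) * (g 1 \<mu>1 (t * x) * g 2 \<mu>2 (t * (1 - x))) \<partial>lborel))"
  have [measurable]: "U \<in> borel_measurable borel" unfolding U_def by measurable
  have dens_le: "dens x * indicator {x \<in> space N. q \<le> x 1} x \<le> U (x 1)" for x
  proof (cases "q \<le> x 1 \<and> x 1 < 1")
    case True
    define \<xi> where "\<xi> = x 1"
    have \<xi>: "0 < \<xi>" "\<xi> < 1" "q \<le> \<xi>" using True q by (auto simp: \<xi>_def)
    define x' where "x' = x(2 := 1 - \<xi>)"
    have x': "x' 1 = \<xi>" "x' (Suc 0) = \<xi>" "x' 2 = 1 - \<xi>" by (auto simp: x'_def \<xi>_def)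
    define F where "F = (\<lambda>i s. Lauricella_Phi2 (r - 1) (\<lambda>_. \<alpha> i) (real r * \<alpha> i) (\<lambda>k. s * real k))"
    have F: "0 \<le> F i s" "ennreal (F i s) \<le> Phi2_nn (r - 1) (\<alpha> i) (real r * \<alpha> i) s" if "0 \<le> s" "i = 1 \<or> i = 2" for i s
      using that rp \<alpha>pos unfolding F_def by (auto intro!: Lauricella_Phi2_nonneg Lauricella_Phi2_le)
    define T where "T = (\<lambda>t. t powr (real r * a - 1) * exp (- real r * t) * (F 1 (t * \<xi>) * F 2 (t * (1 - \<xi>))))"
    define W where "W = \<xi> powr (real r * \<alpha> 1 - 1) * (1 - \<xi>) powr (real r * \<alpha> 2 - 1)"
    have W: "W \<ge> 0" by (simp add: W_def)
    have T: "0 \<le> indicator {0<..} t *\<^sub>R T t" for t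
      using \<xi> by (auto simp: T_def indicator_def intro!: mult_nonneg_nonneg F)
    have gd: "GDP_density a r 2 \<alpha> x' = K * (W * (LBINT t:{0<..}. T t))"
      by (simp add: GDP_density_def I2 x' K_def W_def T_def F_def mult.assoc)
    have "dens x = ennreal (GDP_density a r 2 \<alpha> x')"
    proof -
      have "x (Suc 0) = \<xi>" by (simp add: \<xi>_def)
      then show ?thesis using \<xi> by (simp add: dens_def I1 I2 x'_def Let_def)
    qed
    also have "\<dots> = ennreal K * (ennreal W * ennreal (LBINT t:{0<..}. T t))"
    proof -
      have "0 \<le> (LBINT t:{0<..}. T t)" unfolding set_lebesgue_integral_def using T by (intro integral_nonneg_AE) auto
      then show ?thesis unfolding gd using K W by (simp add: ennreal_mult)
    qed
    also have "\<dots> \<le> ennreal K * (ennreal W * (\<integral>\<^sup>+t. ennreal (indicator {0<..} t *\<^sub>R T t) \<partial>lborel))"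
      unfolding set_lebesgue_integral_def by (intro mult_left_mono ennreal_integral_le_nn_integral T) auto
    also have "\<dots> \<le> U \<xi>"
      unfolding U_def
    proof (intro mult_left_mono)
      have "ennreal W * (\<integral>\<^sup>+t. ennreal (indicator {0<..} t *\<^sub>R T t) \<partial>lborel)
        \<le> ennreal W * (\<integral>\<^sup>+t. ennreal (indicator {0<..} t * (t powr (real r * a - 1) * exp (- real r * t))) *
             (Phi2_nn (r - 1) (\<alpha> 1) (real r * \<alpha> 1) (t * \<xi>) * Phi2_nn (r - 1) (\<alpha> 2) (real r * \<alpha> 2) (t * (1 - \<xi>))) \<partial>lborel)"
      proof (intro mult_left_mono nn_integral_mono)
        fix t :: real
        show "ennreal (indicator {0<..} t *\<^sub>R T t) \<le> ennreal (indicator {0<..} t * (t powr (real r * a - 1) * exp (- real r * t))) *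
             (Phi2_nn (r - 1) (\<alpha> 1) (real r * \<alpha> 1) (t * \<xi>) * Phi2_nn (r - 1) (\<alpha> 2) (real r * \<alpha> 2) (t * (1 - \<xi>)))"
        proof (cases "t > 0")
          case True
          then have s: "0 \<le> t * \<xi>" "0 \<le> t * (1 - \<xi>)" using \<xi> by auto
          have "ennreal (T t) = ennreal (t powr (real r * a - 1) * exp (- real r * t)) * (ennreal (F 1 (t * \<xi>)) * ennreal (F 2 (t * (1 - \<xi>))))"
            unfolding T_def using F(1)[OF s(1), of 1] F(1)[OF s(2), of 2] by (simp add: ennreal_mult)
          also have "\<dots> \<le> ennreal (t powr (real r * a - 1) * exp (- real r * t)) *
             (Phi2_nn (r - 1) (\<alpha> 1) (real r * \<alpha> 1) (t * \<xi>) * Phi2_nn (r - 1) (\<alpha> 2) (real r * \<alpha> 2) (t * (1 - \<xi>)))"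
            using s by (intro mult_left_mono mult_mono F) auto
          finally show ?thesis using True by simp
        qed simp
      qed auto
      also have "\<dots> = (\<integral>\<^sup>+t. ennreal W * (ennreal (indicator {0<..} t * (t powr (real r * a - 1) * exp (- real r * t))) *
             (Phi2_nn (r - 1) (\<alpha> 1) (real r * \<alpha> 1) (t * \<xi>) * Phi2_nn (r - 1) (\<alpha> 2) (real r * \<alpha> 2) (t * (1 - \<xi>)))) \<partial>lborel)"
        by (rule nn_integral_cmult[symmetric]) measurable
      also have "\<dots> \<le> (\<integral>\<^sup>+t. ennreal (indicator {0<..} t * t) * (g 1 \<mu>1 (t * \<xi>) * g 2 \<mu>2 (t * (1 - \<xi>))) \<partial>lborel)"
      proof (intro nn_integral_mono)
        fix t :: real
        show "ennreal W * (ennreal (indicator {0<..} t * (t powr (real r * a - 1) * exp (- real r * t))) *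
             (Phi2_nn (r - 1) (\<alpha> 1) (real r * \<alpha> 1) (t * \<xi>) * Phi2_nn (r - 1) (\<alpha> 2) (real r * \<alpha> 2) (t * (1 - \<xi>))))
          \<le> ennreal (indicator {0<..} t * t) * (g 1 \<mu>1 (t * \<xi>) * g 2 \<mu>2 (t * (1 - \<xi>)))"
        proof (cases "t > 0")
          case True
          define E1 where "E1 = (t * \<xi>) powr (real r * \<alpha> 1 - 1) * exp (- (real r - \<mu>1) * (t * \<xi>))"
          define E2 where "E2 = (t * (1 - \<xi>)) powr (real r * \<alpha> 2 - 1) * exp (- (real r - \<mu>2) * (t * (1 - \<xi>)))"
          \<comment> \<open>The Jacobian t supplies the missing exponent: 1 + (r * \<alpha> 1 - 1) +
            (r * \<alpha> 2 - 1) = r * a - 1.\<close>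
          have pw: "t * (t * \<xi>) powr (real r * \<alpha> 1 - 1) * (t * (1 - \<xi>)) powr (real r * \<alpha> 2 - 1) = W * t powr (real r * a - 1)"
          proof -
            have "t powr (real r * a - 1) = t powr 1 * t powr (real r * \<alpha> 1 - 1) * t powr (real r * \<alpha> 2 - 1)"
              by (simp only: powr_add[symmetric]) (simp add: \<alpha>12 algebra_simps)
            then show ?thesis using True \<xi> by (simp add: W_def powr_mult)
          qed
          \<comment> \<open>The tilt adds t * l * (\<xi> - q) to the exponent, which is nonnegative
            on the event.\<close>
          have "0 \<le> t * (l * (\<xi> - q))" using True l \<xi> by simp
          then have "- real r * t \<le> - (real r - \<mu>1) * (t * \<xi>) + - (real r - \<mu>2) * (t * (1 - \<xi>))"
            by (simp add: \<mu>1_def \<mu>2_def algebra_simps)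
          then have "exp (- real r * t) \<le> exp (- (real r - \<mu>1) * (t * \<xi>)) * exp (- (real r - \<mu>2) * (t * (1 - \<xi>)))"
            unfolding mult_exp_exp by simp
          then have "W * t powr (real r * a - 1) * exp (- real r * t)
            \<le> W * t powr (real r * a - 1) * (exp (- (real r - \<mu>1) * (t * \<xi>)) * exp (- (real r - \<mu>2) * (t * (1 - \<xi>))))"
            using W by (intro mult_left_mono) auto
          also have "\<dots> = t * (E1 * E2)"
            unfolding pw[symmetric] E1_def E2_def by (simp only: mult_ac)
          finally have "ennreal (W * (t powr (real r * a - 1) * exp (- real r * t))) \<le> ennreal (t * (E1 * E2))"
            by (intro ennreal_leI) (simp only: mult.assoc)
          moreover have "E1 \<ge> 0" "E2 \<ge> 0" by (auto simp: E1_def E2_def)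
          ultimately have le: "ennreal W * ennreal (t powr (real r * a - 1) * exp (- real r * t)) \<le> ennreal t * (ennreal E1 * ennreal E2)"
            using W True by (simp add: ennreal_mult)
          have g12: "g 1 \<mu>1 (t * \<xi>) = ennreal E1 * Phi2_nn (r - 1) (\<alpha> 1) (real r * \<alpha> 1) (t * \<xi>)"
            "g 2 \<mu>2 (t * (1 - \<xi>)) = ennreal E2 * Phi2_nn (r - 1) (\<alpha> 2) (real r * \<alpha> 2) (t * (1 - \<xi>))"
            using True \<xi> by (auto simp: g_def E1_def E2_def)
          have "ennreal W * ennreal (t powr (real r * a - 1) * exp (- real r * t)) *
             (Phi2_nn (r - 1) (\<alpha> 1) (real r * \<alpha> 1) (t * \<xi>) * Phi2_nn (r - 1) (\<alpha> 2) (real r * \<alpha> 2) (t * (1 - \<xi>)))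
            \<le> ennreal t * (ennreal E1 * ennreal E2) *
             (Phi2_nn (r - 1) (\<alpha> 1) (real r * \<alpha> 1) (t * \<xi>) * Phi2_nn (r - 1) (\<alpha> 2) (real r * \<alpha> 2) (t * (1 - \<xi>)))"
            by (rule mult_right_mono[OF le]) simp
          then show ?thesis unfolding g12 using True by (simp add: mult_ac)
        qed simp
      qed
      finally show "ennreal W * (\<integral>\<^sup>+t. ennreal (indicator {0<..} t *\<^sub>R T t) \<partial>lborel)
        \<le> (\<integral>\<^sup>+t. ennreal (indicator {0<..} t * t) * (g 1 \<mu>1 (t * \<xi>) * g 2 \<mu>2 (t * (1 - \<xi>))) \<partial>lborel)" .
    qed simp
    finally show ?thesis by (auto simp: \<xi>_def indicator_def)
  next
    case False
    \<comment> \<open>For \<open>x 1 > 1\<close> the last coordinate is negative and the case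
      distinction gives 0; for \<open>x 1 = 1\<close> it is 0, and 0 powr y is 0 for every
      y.\<close>
    have "dens x = 0" if "q \<le> x 1"
    proof -
      consider "1 < x 1" | "x 1 = 1" using False \<open>q \<le> x 1\<close> by force
      then show ?thesis
      proof cases
        case 1
        then show ?thesis by (simp add: dens_def I1 I2 Let_def)
      next
        case 2
        then show ?thesis by (simp add: dens_def I1 I2 Let_def GDP_density_def)
      qed
    qed
    then show ?thesis by (auto simp: indicator_def)
  qed
  have ev: "{\<omega>\<in>space M. q \<le> measure (P \<omega>) A} = X -` {x \<in> space N. q \<le> x 1} \<inter> space M"
    by (auto simp: X_def N_def I1 Ap_def space_PiM)
  have st: "{x \<in> space N. q \<le> x 1} \<in> sets N"
    unfolding N_def I1 by measurable
  have "emeasure M {\<omega>\<in>space M. q \<le> measure (P \<omega>) A} = (\<integral>\<^sup>+x. dens x * indicator {x \<in> space N. q \<le> x 1} x \<partial>N)"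
    unfolding ev by (rule distributed_emeasure[OF d st])
  also have "\<dots> \<le> (\<integral>\<^sup>+x. U (x 1) \<partial>N)" by (intro nn_integral_mono dens_le)
  also have "\<dots> = (\<integral>\<^sup>+x. U x \<partial>lborel)"
  proof -
    interpret product_sigma_finite "\<lambda>_::nat. lborel :: real measure" by unfold_locales
    show ?thesis unfolding N_def I1 by (rule product_nn_integral_singleton) simp
  qed
  also have "\<dots> = ennreal K * (\<integral>\<^sup>+x. (\<integral>\<^sup>+t. ennreal (indicator {0<..} t * t) * (g 1 \<mu>1 (t * x) * g 2 \<mu>2 (t * (1 - x))) \<partial>lborel) \<partial>lborel)"
    unfolding U_def by (rule nn_integral_cmult) measurable
  also have "\<dots> \<le> ennreal K * ((\<integral>\<^sup>+s. g 1 \<mu>1 s \<partial>lborel) * (\<integral>\<^sup>+s. g 2 \<mu>2 s \<partial>lborel))"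
    by (intro mult_left_mono nn_integral_polar_le) auto
  also have "\<dots> = ennreal (K * (Gamma (real r * \<alpha> 1) / fact r powr \<alpha> 1 * exp (- \<alpha> 1 * (\<Sum>j\<in>{1..r}. ln (1 - \<mu>1 / real j)))
       * (Gamma (real r * \<alpha> 2) / fact r powr \<alpha> 2 * exp (- \<alpha> 2 * (\<Sum>j\<in>{1..r}. ln (1 - \<mu>2 / real j))))))"
  proof -
    have en: "ennreal K * (ennreal x * ennreal y) = ennreal (K * (x * y))" if "0 \<le> x" "0 \<le> y" for x y
      using K that by (simp add: ennreal_mult mult.assoc)
    show ?thesis
      unfolding g_def Phi2_laplace_shifted[OF \<alpha>pos(1) r \<mu>(1)] Phi2_laplace_shifted[OF \<alpha>pos(2) r \<mu>(2)]
      by (rule en) (use G in \<open>auto simp del: One_nat_def\<close>)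
  qed
  \<comment> \<open>The gamma factors and the powers of r! cancel, leaving a pure
    exponential.\<close>
  also have "K * (Gamma (real r * \<alpha> 1) / fact r powr \<alpha> 1 * exp (- \<alpha> 1 * (\<Sum>j\<in>{1..r}. ln (1 - \<mu>1 / real j)))
       * (Gamma (real r * \<alpha> 2) / fact r powr \<alpha> 2 * exp (- \<alpha> 2 * (\<Sum>j\<in>{1..r}. ln (1 - \<mu>2 / real j)))))
     = exp (- \<alpha> 1 * (\<Sum>j\<in>{1..r}. ln (1 - \<mu>1 / real j)) + - \<alpha> 2 * (\<Sum>j\<in>{1..r}. ln (1 - \<mu>2 / real j)))"
  proof -
    have "(fact r :: real) powr a = fact r powr \<alpha> 1 * fact r powr \<alpha> 2"
      by (simp add: \<alpha>12 powr_add[symmetric] algebra_simps)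
    then show ?thesis using G unfolding exp_add by (simp add: K_def)
  qed
  also have "- \<alpha> 1 * (\<Sum>j\<in>{1..r}. ln (1 - \<mu>1 / real j)) + - \<alpha> 2 * (\<Sum>j\<in>{1..r}. ln (1 - \<mu>2 / real j))
    = - a * (\<Sum>j\<in>{1..r}. h * ln (1 - l * (1 - q) / real j) + (1 - h) * ln (1 + l * q / real j))"
    unfolding \<alpha>12 \<mu>1_def \<mu>2_def sum.distrib sum_distrib_left[symmetric] by (simp add: algebra_simps)
  finally show ?thesis by (simp add: emeasure_eq_measure h_def)
qed

text \<open>The exponent vanishes at l = 0 and its derivative there is the sum of (q - h) / j, which
  is positive; small l > 0 therefore works.\<close>

lemma chernoff_exponent_pos:
  fixes h q :: real
  assumes h: "0 < h" and hq: "h < q" and q: "q < 1" and r: "1 \<le> (r::nat)"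
  obtains l where "0 < l" "l * (1 - q) < 1"
    "0 < (\<Sum>j\<in>{1..r}. h * ln (1 - l * (1 - q) / real j) + (1 - h) * ln (1 + l * q / real j))"
proof -
  define f where "f = (\<lambda>l. \<Sum>j\<in>{1..r}. h * ln (1 - l * (1 - q) / real j) + (1 - h) * ln (1 + l * q / real j))"
  have "(f has_field_derivative (\<Sum>j\<in>{1..r}. h * (- (1 - q) / real j) + (1 - h) * (q / real j))) (at 0)"
    unfolding f_def
    by (rule DERIV_sum)
      (auto intro!: derivative_eq_intros simp: algebra_simps diff_divide_distrib add_divide_distrib)
  moreover have "0 < (\<Sum>j\<in>{1..r}. h * (- (1 - q) / real j) + (1 - h) * (q / real j))"
  proof (rule sum_pos)
    fix j assume j: "j \<in> {1..r}"
    have "h * (- (1 - q) / real j) + (1 - h) * (q / real j) = (q - h) / real j"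
      using j by (simp add: field_simps)
    then show "0 < h * (- (1 - q) / real j) + (1 - h) * (q / real j)" using j hq by simp
  qed (use r in auto)
  ultimately obtain d where d: "0 < d" "\<And>l. 0 < l \<Longrightarrow> l < d \<Longrightarrow> f 0 < f (0 + l)"
    using DERIV_pos_inc_right[of f _ 0] by blast
  \<comment> \<open>The cap 1/2 secures l * (1 - q) < 1, and d / 2 stays where f is
    positive.\<close>
  define l where "l = min (d / 2) (1 / 2)"
  have l: "0 < l" "l < d" "l \<le> 1 / 2" using d(1) by (auto simp: l_def)
  have "l * (1 - q) \<le> 1 / 2 * 1" using l h hq q by (intro mult_mono) auto
  moreover have "0 < f l" using d(2)[OF l(1,2)] by (simp add: f_def)
  ultimately show ?thesis using l by (intro that[of l]) (auto simp: f_def)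
qed

text \<open>The logarithm of Chernoff's bound is linear in a, so one c serves all a and all P; this
  uniformity is what a = n powr \<tau> requires. If the threshold is at least 1, the event is
  empty.\<close>

lemma (in prob_space) GDP_upper_tail:
  fixes H :: "'x::topological_space measure"
  assumes H: "prob_space H" "sets H = sets borel"
    and A: "A \<in> sets borel" and h: "0 < measure H A" "measure H A < 1" and e: "0 < e" and r: "1 \<le> r"
  obtains c where "0 < c" "\<And>a P. is_GDP M a r H P \<Longrightarrow>
    prob {\<omega>\<in>space M. measure H A + e < measure (P \<omega>) A} \<le> exp (- (c * a))"
proof (cases "measure H A + e < 1")
  case False
  have "prob {\<omega>\<in>space M. measure H A + e < measure (P \<omega>) A} \<le> exp (- (1 * a))" if "is_GDP M a r H P" for a P
  proof -
    have P: "P \<in> M \<rightarrow>\<^sub>M prob_algebra borel" using that by (simp add: is_GDP_def random_prob_measure_def)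
    have "measure (P \<omega>) A \<le> 1" if "\<omega> \<in> space M" for \<omega>
      using measurable_space[OF P that] prob_space.prob_le_1 by (auto simp: space_prob_algebra)
    then have "{\<omega>\<in>space M. measure H A + e < measure (P \<omega>) A} = {}" using False by force
    then show ?thesis by (simp only: measure_empty) simp
  qed
  then show ?thesis using that[of 1] by auto
next
  case True
  define q where "q = measure H A + e"
  have q: "0 < q" "q < 1" "measure H A < q" using True e h by (auto simp: q_def)
  obtain l where l: "0 < l" "l * (1 - q) < 1"
    and pos: "0 < (\<Sum>j\<in>{1..r}. measure H A * ln (1 - l * (1 - q) / real j) + (1 - measure H A) * ln (1 + l * q / real j))" (is "0 < ?c")
    using chernoff_exponent_pos[OF h(1) q(3,2) r] by blast
  show ?thesis
  proof (rule that[OF pos])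
    fix a P assume gdp: "is_GDP M a r H P"
    have P[measurable]: "P \<in> M \<rightarrow>\<^sub>M prob_algebra borel" using gdp by (simp add: is_GDP_def random_prob_measure_def)
    note [measurable] = A
    have "prob {\<omega>\<in>space M. measure H A + e < measure (P \<omega>) A} \<le> prob {\<omega>\<in>space M. q \<le> measure (P \<omega>) A}"
      by (rule finite_measure_mono) (auto simp: q_def)
    also have "\<dots> \<le> exp (- a * ?c)"
      using l by (intro GDP_chernoff[OF gdp H A h q(1,2)]) auto
    finally show "prob {\<omega>\<in>space M. measure H A + e < measure (P \<omega>) A} \<le> exp (- (?c * a))"
      by (simp add: mult.commute)
  qed
qed

lemma measure_Compl_borel:
  fixes Q :: "'x::topological_space measure"
  assumes "prob_space Q" "sets Q = sets borel" "A \<in> sets borel"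
  shows "measure Q (- A) = 1 - measure Q A"
proof -
  interpret Q: prob_space Q by fact
  show ?thesis using Q.prob_compl[of A] assms sets_eq_imp_space_eq[OF assms(2)] by (simp add: Compl_eq_Diff_UNIV)
qed

lemma random_prob_measureD:
  assumes "random_prob_measure M P" "\<omega> \<in> space M"
  shows "prob_space (P \<omega>)" "sets (P \<omega>) = sets borel"
  using assms measurable_space[of P M "prob_algebra borel" \<omega>]
  by (auto simp: random_prob_measure_def space_prob_algebra)

text \<open>A lower deviation at A is an upper deviation at the complement, so two one-sided bounds
  suffice. The exponentials are then weakened to powers to fit
  \<open>AE_tendsto_of_tail_rates\<close> with \<gamma> = 1.\<close>

lemma (in prob_space) GDP_AE_tendsto_nondegenerate:
  fixes H :: "'x::topological_space measure"
  assumes H: "prob_space H" "sets H = sets borel"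
    and A: "A \<in> sets borel" and h: "0 < measure H A" "measure H A < 1" and \<tau>: "\<tau> > 0"
    and gdp: "\<And>n. n \<ge> 1 \<Longrightarrow> is_GDP M (real n powr \<tau>) r H (P n)"
  shows "AE \<omega> in M. (\<lambda>n. measure (P n \<omega>) A) \<longlonglongrightarrow> measure H A"
proof (rule AE_tendsto_of_tail_rates[OF _ \<tau> zero_less_one])
  have rpm: "random_prob_measure M (P n)" if "n \<ge> 1" for n using gdp[OF that] by (simp add: is_GDP_def)
  have r: "1 \<le> r" using gdp[of 1] by (simp add: is_GDP_def)
  have meas: "(\<lambda>\<omega>. measure (P n \<omega>) B) \<in> borel_measurable M" if "n \<ge> 1" "B \<in> sets borel" for n B
  proof -
    have [measurable]: "P n \<in> M \<rightarrow>\<^sub>M prob_algebra borel" using rpm[OF that(1)] by (simp add: random_prob_measure_def)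
    note [measurable] = that(2)
    show ?thesis by measurable
  qed
  then show "(\<lambda>\<omega>. measure (P n \<omega>) A) \<in> borel_measurable M" if "n \<ge> 1" for n using that A by blast
  fix e :: real and q :: nat assume e: "e > 0"
  obtain c1 where c1: "0 < c1" "\<And>a P. is_GDP M a r H P \<Longrightarrow>
      prob {\<omega>\<in>space M. measure H A + e < measure (P \<omega>) A} \<le> exp (- (c1 * a))"
    using GDP_upper_tail[OF H A h e r] by blast
  have hc: "measure H (- A) = 1 - measure H A" by (rule measure_Compl_borel[OF H A])
  have "- A \<in> sets borel" "0 < measure H (- A)" "measure H (- A) < 1" using A h hc by auto
  from GDP_upper_tail[OF H this e r]
  obtain c2 where c2: "0 < c2" "\<And>a P. is_GDP M a r H P \<Longrightarrow>
      prob {\<omega>\<in>space M. measure H (- A) + e < measure (P \<omega>) (- A)} \<le> exp (- (c2 * a))"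
    by blast
  define K where "K = fact (q - 1) / c1 ^ (q - 1) + fact (q - 1) / c2 ^ (q - 1)"
  have "\<forall>\<^sub>F n in sequentially. prob {\<omega>\<in>space M. e < \<bar>measure (P n \<omega>) A - measure H A\<bar>}
      \<le> K * (real n powr \<tau>) powr (- 1 * real (q - 1))"
    using eventually_ge_at_top[of 1]
  proof eventually_elim
    case (elim n)
    define a where "a = real n powr \<tau>"
    have a: "a > 0" using elim by (simp add: a_def)
    have g: "is_GDP M a r H (P n)" using gdp[OF elim] by (simp add: a_def)
    have [measurable]: "(\<lambda>\<omega>. measure (P n \<omega>) A) \<in> borel_measurable M" "(\<lambda>\<omega>. measure (P n \<omega>) (- A)) \<in> borel_measurable M"
      using meas[OF elim] A by auto
    have "{\<omega>\<in>space M. e < \<bar>measure (P n \<omega>) A - measure H A\<bar>}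
      \<subseteq> {\<omega>\<in>space M. measure H A + e < measure (P n \<omega>) A} \<union> {\<omega>\<in>space M. measure H (- A) + e < measure (P n \<omega>) (- A)}"
    proof
      fix \<omega> assume \<omega>: "\<omega> \<in> {\<omega>\<in>space M. e < \<bar>measure (P n \<omega>) A - measure H A\<bar>}"
      then have "measure (P n \<omega>) (- A) = 1 - measure (P n \<omega>) A"
        using random_prob_measureD[OF rpm[OF elim], of \<omega>] A by (intro measure_Compl_borel) auto
      then show "\<omega> \<in> {\<omega>\<in>space M. measure H A + e < measure (P n \<omega>) A} \<union> {\<omega>\<in>space M. measure H (- A) + e < measure (P n \<omega>) (- A)}"
        using \<omega> hc by auto
    qed
    then have "prob {\<omega>\<in>space M. e < \<bar>measure (P n \<omega>) A - measure H A\<bar>}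
      \<le> prob ({\<omega>\<in>space M. measure H A + e < measure (P n \<omega>) A} \<union> {\<omega>\<in>space M. measure H (- A) + e < measure (P n \<omega>) (- A)})"
      by (rule finite_measure_mono) measurable
    also have "\<dots> \<le> prob {\<omega>\<in>space M. measure H A + e < measure (P n \<omega>) A} + prob {\<omega>\<in>space M. measure H (- A) + e < measure (P n \<omega>) (- A)}"
      by (rule measure_Un_le) measurable
    also have "\<dots> \<le> exp (- (c1 * a)) + exp (- (c2 * a))" by (intro add_mono c1(2) c2(2) g)
    also have "\<dots> \<le> fact (q - 1) / (c1 * a) ^ (q - 1) + fact (q - 1) / (c2 * a) ^ (q - 1)"
      using a c1(1) c2(1) by (intro add_mono exp_minus_le_fact) auto
    also have "\<dots> = K * a powr (- 1 * real (q - 1))"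
      using a c1(1) c2(1) by (simp add: K_def powr_minus powr_realpow power_mult_distrib field_simps)
    finally show ?case unfolding a_def .
  qed
  then show "\<exists>K. \<forall>\<^sub>F n in sequentially. prob {\<omega>\<in>space M. e < \<bar>measure (P n \<omega>) A - measure H A\<bar>}
      \<le> K * (real n powr \<tau>) powr (- 1 * real (q - 1))" by blast
qed

section \<open>Null sets and sets of full measure\<close>

text \<open>Nonatomicity splits a set of positive measure into two parts of positive measure, one of
  which has at most half of it; this is iterated.\<close>

lemma nonatomic_small_set:
  assumes "prob_space H" "nonatomic H"
  shows "\<exists>B\<in>sets H. 0 < measure H B \<and> measure H B \<le> 1 / 2 ^ n"
proof (induction n)
  interpret H: prob_space H by fact
  case 0
  show ?case by (rule bexI[of _ "space H"]) (auto simp: H.prob_space)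
next
  interpret H: prob_space H by fact
  case (Suc n)
  then obtain B where B: "B \<in> sets H" "0 < measure H B" "measure H B \<le> 1 / 2 ^ n" by blast
  then have "emeasure H B > 0" by (simp add: H.emeasure_eq_measure)
  then obtain C where C: "C \<in> sets H" "C \<subseteq> B" "0 < emeasure H C" "emeasure H C < emeasure H B"
    using assms(2) B(1) unfolding nonatomic_def by blast
  then have m: "0 < measure H C" "measure H C < measure H B" by (auto simp: H.emeasure_eq_measure ennreal_less_iff)
  have D: "measure H (B - C) = measure H B - measure H C"
    using B C by (intro H.finite_measure_Diff) auto
  show ?case
  proof (cases "measure H C \<le> measure H B / 2")
    case True
    then show ?thesis using C m B by (intro bexI[of _ C]) auto
  next
    case False
    then show ?thesis using C m B D by (intro bexI[of _ "B - C"]) auto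
  qed
qed

text \<open>The defining densities say nothing about partitions with null cells, so a null set is enclosed
  in sets of small positive measure.\<close>

lemma (in prob_space) GDP_AE_tendsto_null:
  fixes H :: "'x::topological_space measure"
  assumes H: "prob_space H" "sets H = sets borel" "nonatomic H"
    and A: "A \<in> sets borel" "measure H A = 0" and \<tau>: "\<tau> > 0"
    and gdp: "\<And>n. n \<ge> 1 \<Longrightarrow> is_GDP M (real n powr \<tau>) r H (P n)"
  shows "AE \<omega> in M. (\<lambda>n. measure (P n \<omega>) A) \<longlonglongrightarrow> 0"
proof -
  interpret H: prob_space H by fact
  \<comment> \<open>The exponent \<open>Suc k\<close> keeps each \<open>B k\<close> at measure at
    most 1/2, so that \<open>A \<union> B k\<close> has measure strictly between 0 and 1 already for
    k = 0.\<close>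
  have "\<exists>B\<in>sets H. 0 < measure H B \<and> measure H B \<le> 1 / 2 ^ Suc k" for k
    by (rule nonatomic_small_set[OF H(1,3)])
  then obtain B where B: "\<And>k. B k \<in> sets H" "\<And>k. 0 < measure H (B k)" "\<And>k. measure H (B k) \<le> 1 / 2 ^ Suc k" by metis
  have AB: "measure H (A \<union> B k) = measure H (B k)" for k
  proof -
    have "A \<in> null_sets H" using A H(2) by (auto simp: null_sets_def H.emeasure_eq_measure)
    then show ?thesis using B(1)[of k] by (simp add: measure_def emeasure_Un_null_set Un_commute[of A])
  qed
  have "AE \<omega> in M. (\<lambda>n. measure (P n \<omega>) (A \<union> B k)) \<longlonglongrightarrow> measure H (A \<union> B k)" for k
  proof (rule GDP_AE_tendsto_nondegenerate[OF H(1,2) _ _ _ \<tau> gdp])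
    have "(1::real) / 2 ^ Suc k \<le> 1 / 2" by simp
    then show "measure H (A \<union> B k) < 1" using B(3)[of k] unfolding AB by linarith
  qed (use A B AB H(2) in auto)
  \<comment> \<open>Countably many enlargements share one null set; off it, monotonicity puts
    \<open>measure (P n \<omega>) A\<close> below sequences with arbitrarily small limits.\<close>
  then have "AE \<omega> in M. \<forall>k. (\<lambda>n. measure (P n \<omega>) (A \<union> B k)) \<longlonglongrightarrow> measure H (A \<union> B k)"
    by (simp add: AE_all_countable)
  then show ?thesis
    using AE_space
  proof eventually_elim
    case (elim \<omega>)
    show ?case
    proof (rule LIMSEQ_I)
      fix e :: real assume e: "e > 0"
      obtain k where k: "(1 / 2) ^ k < e" using real_arch_pow_inv[OF e, of "1 / 2"] by auto
      have "measure H (A \<union> B k) \<le> (1 / 2) ^ k / 2" using B(3)[of k] AB[of k] by (simp add: power_one_over)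
      then have "measure H (A \<union> B k) < e" using k by (smt (verit) half_gt_zero_iff zero_less_power zero_less_divide_1_iff field_sum_of_halves)
      then have "\<forall>\<^sub>F n in sequentially. measure (P n \<omega>) (A \<union> B k) < e"
        using elim(1) by (intro order_tendstoD(2)[of _ "measure H (A \<union> B k)"]) auto
      then have "\<forall>\<^sub>F n in sequentially. norm (measure (P n \<omega>) A - 0) < e"
        using eventually_ge_at_top[of 1]
      proof eventually_elim
        case (elim n)
        have "random_prob_measure M (P n)" using gdp[OF elim(2)] by (simp add: is_GDP_def)
        note Q = random_prob_measureD[OF this \<open>\<omega> \<in> space M\<close>]
        interpret Q: prob_space "P n \<omega>" by (rule Q)
        have "measure (P n \<omega>) A \<le> measure (P n \<omega>) (A \<union> B k)"
          using A(1) B(1)[of k] H(2) Q(2) by (intro Q.finite_measure_mono) auto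
        then show ?case using elim(1) by simp
      qed
      then show "\<exists>no. \<forall>n\<ge>no. norm (measure (P n \<omega>) A - 0) < e" by (simp add: eventually_sequentially)
    qed
  qed
qed

lemma (in prob_space) GDP_AE_tendsto:
  fixes H :: "'x::topological_space measure"
  assumes H: "prob_space H" "sets H = sets borel" "nonatomic H" and A: "A \<in> sets borel" and \<tau>: "\<tau> > 0"
    and gdp: "\<And>n. n \<ge> 1 \<Longrightarrow> is_GDP M (real n powr \<tau>) r H (P n)"
  shows "AE \<omega> in M. (\<lambda>n. measure (P n \<omega>) A) \<longlonglongrightarrow> measure H A"
proof -
  interpret H: prob_space H by fact
  consider "measure H A = 0" | "measure H A = 1" | "0 < measure H A" "measure H A < 1"
    using H.prob_le_1[of A] by (cases "measure H A = 0"; cases "measure H A = 1") (auto simp: less_le)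
  then show ?thesis
  proof cases
    case 1
    then show ?thesis using GDP_AE_tendsto_null[OF H A _ \<tau> gdp] by simp
  next
    case 2
    have "- A \<in> sets borel" "measure H (- A) = 0" using A 2 measure_Compl_borel[OF H(1,2) A] by auto
    from GDP_AE_tendsto_null[OF H this \<tau> gdp] have "AE \<omega> in M. (\<lambda>n. measure (P n \<omega>) (- A)) \<longlonglongrightarrow> 0" .
    then show ?thesis
      using AE_space
    proof eventually_elim
      case (elim \<omega>)
      have "(\<lambda>n. 1 - measure (P n \<omega>) (- A)) \<longlonglongrightarrow> 1 - 0" by (intro tendsto_intros elim)
      moreover have "\<forall>\<^sub>F n in sequentially. 1 - measure (P n \<omega>) (- A) = measure (P n \<omega>) A"
        using eventually_ge_at_top[of 1]
      proof eventually_elim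
        case (elim n)
        have "random_prob_measure M (P n)" using gdp[OF elim] by (simp add: is_GDP_def)
        from measure_Compl_borel[OF random_prob_measureD[OF this \<open>\<omega> \<in> space M\<close>] A] show ?case by simp
      qed
      ultimately show ?case using 2 by (simp add: tendsto_cong)
    qed
  next
    case 3
    then show ?thesis by (intro GDP_AE_tendsto_nondegenerate[OF H(1,2) A _ _ \<tau> gdp])
  qed
qed

theorem theorem4p2:
  fixes M :: "'w measure" and H :: "'x::polish_space measure"
    and P :: "nat \<Rightarrow> 'w \<Rightarrow> 'x measure"
    and g :: "real \<Rightarrow> real measure" and b \<sigma> \<tau> :: real and r :: nat
  assumes "prob_space M" and "complete_measure M"
    and "prob_space H" and "sets H = sets borel" and "nonatomic H"
    and "\<tau> > 0"
    and "(\<forall>n\<ge>1. is_DP M (real n powr \<tau>) H (P n))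
       \<or> (moment_assumption g \<and> (\<forall>n\<ge>1. is_DPG M (g (real n powr \<tau>)) H (P n)))
       \<or> (\<forall>n\<ge>1. is_PDP M (real n powr \<tau>) b H (P n))
       \<or> (\<forall>n\<ge>1. is_NIGP M (real n powr \<tau>) H (P n))
       \<or> (\<forall>n\<ge>1. is_NGGP M \<sigma> (real n powr \<tau>) H (P n))
       \<or> (\<forall>n\<ge>1. is_GDP M (real n powr \<tau>) r H (P n))"
  shows "\<forall>A\<in>sets borel. AE \<omega> in M. (\<lambda>n. measure (P n \<omega>) A) \<longlonglongrightarrow> measure H A"
proof
  fix A :: "'x set" assume A: "A \<in> sets borel"
  interpret prob_space M by fact
  from assms(7) show "AE \<omega> in M. (\<lambda>n. measure (P n \<omega>) A) \<longlonglongrightarrow> measure H A"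
  proof (elim disjE conjE)
    assume "\<forall>n\<ge>1. is_DP M (real n powr \<tau>) H (P n)"
    then show ?thesis by (intro DP_AE_tendsto[OF A \<open>\<tau> > 0\<close>]) auto
  next
    assume "moment_assumption g" "\<forall>n\<ge>1. is_DPG M (g (real n powr \<tau>)) H (P n)"
    then show ?thesis by (intro DPG_AE_tendsto[OF A \<open>\<tau> > 0\<close>]) auto
  next
    assume "\<forall>n\<ge>1. is_PDP M (real n powr \<tau>) b H (P n)"
    then show ?thesis by (intro PDP_AE_tendsto[OF A \<open>\<tau> > 0\<close>]) auto
  next
    assume "\<forall>n\<ge>1. is_NIGP M (real n powr \<tau>) H (P n)"
    then show ?thesis by (intro NIGP_AE_tendsto[OF A \<open>\<tau> > 0\<close>]) auto
  next
    assume "\<forall>n\<ge>1. is_NGGP M \<sigma> (real n powr \<tau>) H (P n)"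
    then show ?thesis by (intro NGGP_AE_tendsto[OF A \<open>\<tau> > 0\<close>]) auto
  next
    assume "\<forall>n\<ge>1. is_GDP M (real n powr \<tau>) r H (P n)"
    then show ?thesis
      by (intro GDP_AE_tendsto[OF \<open>prob_space H\<close> \<open>sets H = sets borel\<close> \<open>nonatomic H\<close> A \<open>\<tau> > 0\<close>]) auto
  qed
qed

end
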